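(* Let $K$ be a compact Abelian group and $G$ a weakly essential subgroup of $K$. (a) If $G$ is locally essential in $K$, then $( * )$: for every prime $p$ the subgroup $G[p]$ of $K[p]$ is open in $K[p]$; and moreover there exists $n\in\mathbb N$ such that $r_p(K[p]/G[p])\le n$ for every prime $p$. (b) If $( * )$ holds and $\pi_{(K:G)}$ is finite, then $G$ is locally essential in $K$. (c) If $K_1:=\overline{\mathrm{Soc}(K)}$ is finite-dimensional, then the following are equivalent: (c$_1$) $G$ is locally essential in $K$; (c$_2$) for every prime $p$, $G[p]$ is open in $K[p]$, and $\pi_{(M:G)}$ is finite for every $\delta$-subgroup $M$ of $K$; (c$_3$) $G\cap N$ is locally essential in $N$ for some $\delta$-subgroup $N$ of $K_1$ (equivalently, for every $\delta$-subgroup $N$ of $K_1$). In particular, if $K$ is totally disconnected, then $G$ is locally essential in $K$ if and only if $\pi_{(K:G)}$ is finite and $G[p]$ is open in $K[p]$ for every prime $p$.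
   Context: Groups are Abelian and Hausdorff. For an Abelian group $A$ and $n\in\mathbb N$, $A[n]=\{x\in A: nx=0\}$; $\mathrm{Soc}(A)=\bigoplus_{p\text{ prime}}A[p]$; for a prime $p$, $r_p(B)$ is the $p$-rank (dimension over $\mathbb Z/p$ of $B[p]$). A topological group is $p$-monothetic if it is a cyclic $p$-group or topologically isomorphic to a subgroup of the $p$-adic integers $\mathbb Z_p$. A subgroup $H$ of a topological Abelian group $L$ is: weakly essential if for every prime $p$, $H$ meets non-trivially every infinite closed $p$-monothetic subgroup of $L$; locally essential if there is a neighbourhood $V$ of $0$ such that $H$ meets non-trivially every non-trivial closed subgroup of $L$ contained in $V$. For subgroups $H,G$ of $K$, $\pi_{(H:G)}=\{p \text{ prime}: H[p]\not\le G\}$. A $\delta$-subgroup of a compact Abelian group $L$ is a closed totally disconnected subgroup $N$ such that $L/N$ is topologically isomorphic to a (possibly infinite) power of the circle group $\mathbb T$. Dimension of compact groups is the covering dimension. *)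

theory Defs
  imports "HOL-Analysis.Analysis" "HOL-Computational_Algebra.Primes"
begin

primrec nmul :: "nat \<Rightarrow> 'a::ab_group_add \<Rightarrow> 'a" where
  "nmul 0 x = 0"
| "nmul (Suc n) x = x + nmul n x"

definition subgrp :: "'a::ab_group_add set \<Rightarrow> bool" where
  "subgrp S \<longleftrightarrow> 0 \<in> S \<and> (\<forall>x\<in>S. \<forall>y\<in>S. x + y \<in> S) \<and> (\<forall>x\<in>S. - x \<in> S)"

definition gen_subgrp :: "'a::ab_group_add set \<Rightarrow> 'a set" where
  "gen_subgrp F = \<Inter>{H. subgrp H \<and> F \<subseteq> H}"

definition tors :: "nat \<Rightarrow> 'a::ab_group_add set \<Rightarrow> 'a set" where
  "tors n A = {x \<in> A. nmul n x = 0}"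

definition socle :: "'a::ab_group_add set \<Rightarrow> 'a set" where
  "socle A = gen_subgrp (\<Union>p\<in>{p. prime p}. tors p A)"

definition pi_set :: "'a::ab_group_add set \<Rightarrow> 'a set \<Rightarrow> nat set" where
  "pi_set H G = {p. prime p \<and> \<not> tors p H \<subseteq> G}"

text \<open>r_p(A/B) \<le> n for A an elementary abelian p-group (exponent p) and B \<le> A:
  the Z/p-dimension of A/B is at most n, i.e. A/B is generated by at most n cosets.\<close>
definition quot_rank_le :: "'a::ab_group_add set \<Rightarrow> 'a set \<Rightarrow> nat \<Rightarrow> bool" where
  "quot_rank_le A B n \<longleftrightarrow>
     (\<exists>F. finite F \<and> card F \<le> n \<and> F \<subseteq> A \<and> A \<subseteq> {b + s | b s. b \<in> B \<and> s \<in> gen_subgrp F})"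

definition totally_disconn :: "'a::topological_space set \<Rightarrow> bool" where
  "totally_disconn S \<longleftrightarrow> (\<forall>C. C \<subseteq> S \<and> connected C \<longrightarrow> (\<exists>x. C \<subseteq> {x}))"

definition covering_dim_le :: "'a::topological_space set \<Rightarrow> nat \<Rightarrow> bool" where
  "covering_dim_le S n \<longleftrightarrow>
     (\<forall>\<U>. finite \<U> \<and> (\<forall>U\<in>\<U>. openin (top_of_set S) U) \<and> S \<subseteq> \<Union>\<U> \<longrightarrow>
        (\<exists>\<V>. finite \<V> \<and> (\<forall>V\<in>\<V>. openin (top_of_set S) V) \<and> S \<subseteq> \<Union>\<V> \<and>
             (\<forall>V\<in>\<V>. \<exists>U\<in>\<U>. V \<subseteq> U) \<and>
             (\<forall>x\<in>S. card {V\<in>\<V>. x \<in> V} \<le> n + 1)))"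

definition finite_dimensional :: "'a::topological_space set \<Rightarrow> bool" where
  "finite_dimensional S \<longleftrightarrow> (\<exists>n. covering_dim_le S n)"

definition padic_int :: "nat \<Rightarrow> (nat \<Rightarrow> int) set" where
  "padic_int p = {x. \<forall>n. 0 \<le> x n \<and> x n < int p ^ n \<and> x n = x (Suc n) mod int p ^ n}"

definition padic_add :: "nat \<Rightarrow> (nat \<Rightarrow> int) \<Rightarrow> (nat \<Rightarrow> int) \<Rightarrow> (nat \<Rightarrow> int)" where
  "padic_add p x y = (\<lambda>n. (x n + y n) mod int p ^ n)"

definition padic_neg :: "nat \<Rightarrow> (nat \<Rightarrow> int) \<Rightarrow> (nat \<Rightarrow> int)" where
  "padic_neg p x = (\<lambda>n. (- x n) mod int p ^ n)"

definition padic_subgrp :: "nat \<Rightarrow> (nat \<Rightarrow> int) set \<Rightarrow> bool" where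
  "padic_subgrp p H \<longleftrightarrow> H \<subseteq> padic_int p \<and> (\<lambda>n. 0) \<in> H \<and>
     (\<forall>x\<in>H. \<forall>y\<in>H. padic_add p x y \<in> H) \<and> (\<forall>x\<in>H. padic_neg p x \<in> H)"

text \<open>Z_p carries the product topology of the discrete groups (euclidean topology
  on nat => int is the product of the discrete topologies on int).\<close>

definition p_monothetic :: "nat \<Rightarrow> 'a::topological_ab_group_add set \<Rightarrow> bool" where
  "p_monothetic p C \<longleftrightarrow>
     (subgrp C \<and> finite C \<and> (\<exists>g. C = gen_subgrp {g}) \<and> (\<exists>k. card C = p ^ k)) \<or>
     (subgrp C \<and> (\<exists>H f. padic_subgrp p H \<and> bij_betw f C H \<and>
        (\<forall>x\<in>C. \<forall>y\<in>C. f (x + y) = padic_add p (f x) (f y)) \<and>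
        homeomorphic_map (top_of_set C) (top_of_set H) f))"

definition weakly_essential :: "'a::topological_ab_group_add set \<Rightarrow> 'a set \<Rightarrow> bool" where
  "weakly_essential L H \<longleftrightarrow>
     (\<forall>p C. prime p \<and> subgrp C \<and> C \<subseteq> L \<and> closedin (top_of_set L) C \<and> infinite C \<and>
            p_monothetic p C \<longrightarrow> H \<inter> C \<noteq> {0})"

definition locally_essential :: "'a::topological_ab_group_add set \<Rightarrow> 'a set \<Rightarrow> bool" where
  "locally_essential L H \<longleftrightarrow>
     (\<exists>V. V \<subseteq> L \<and> (\<exists>U. openin (top_of_set L) U \<and> 0 \<in> U \<and> U \<subseteq> V) \<and>
        (\<forall>C. subgrp C \<and> C \<subseteq> V \<and> closedin (top_of_set L) C \<and> C \<noteq> {0} \<longrightarrow> H \<inter> C \<noteq> {0}))"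

definition circle_pow :: "'i set \<Rightarrow> ('i \<Rightarrow> complex) set" where
  "circle_pow I = PiE I (\<lambda>_. sphere 0 1)"

definition circle_pow_top :: "'i set \<Rightarrow> ('i \<Rightarrow> complex) topology" where
  "circle_pow_top I = product_topology (\<lambda>_. top_of_set (sphere 0 1)) I"

definition circle_pow_mult :: "'i set \<Rightarrow> ('i \<Rightarrow> complex) \<Rightarrow> ('i \<Rightarrow> complex) \<Rightarrow> ('i \<Rightarrow> complex)" where
  "circle_pow_mult I f g = restrict (\<lambda>i. f i * g i) I"

definition circle_pow_one :: "'i set \<Rightarrow> ('i \<Rightarrow> complex)" where
  "circle_pow_one I = restrict (\<lambda>_. 1) I"

text \<open>L/N topologically isomorphic to T^I: there is a continuous open surjective
  homomorphism L -> T^I with kernel N (first isomorphism theorem for topological groups).\<close>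
definition quotient_is_torus :: "'i set \<Rightarrow> 'a::topological_ab_group_add set \<Rightarrow> 'a set \<Rightarrow> bool" where
  "quotient_is_torus I L N \<longleftrightarrow>
     (\<exists>\<phi>. continuous_map (top_of_set L) (circle_pow_top I) \<phi> \<and>
          open_map (top_of_set L) (circle_pow_top I) \<phi> \<and>
          \<phi> ` L = circle_pow I \<and>
          (\<forall>x\<in>L. \<forall>y\<in>L. \<phi> (x + y) = circle_pow_mult I (\<phi> x) (\<phi> y)) \<and>
          {x \<in> L. \<phi> x = circle_pow_one I} = N)"

text \<open>delta-subgroup of the compact group L. The index set of the torus is taken
  from 'a: this is no restriction, since |I| \<le> |T^I| = |L/N| \<le> |L|.\<close>
definition delta_subgroup :: "'a::topological_ab_group_add set \<Rightarrow> 'a set \<Rightarrow> bool" where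
  "delta_subgroup L N \<longleftrightarrow>
     subgrp N \<and> N \<subseteq> L \<and> closed N \<and> totally_disconn N \<and>
     (\<exists>I::'a set. quotient_is_torus I L N)"

definition star_cond :: "'a::topological_ab_group_add set \<Rightarrow> 'a set \<Rightarrow> bool" where
  "star_cond K G \<longleftrightarrow>
     (\<forall>p. prime p \<longrightarrow> openin (top_of_set (tors p K)) (tors p G)) \<and>
     (\<exists>n. \<forall>p. prime p \<longrightarrow> quot_rank_le (tors p K) (tors p G) n)"

end

theory Submission
  imports Defs
begin

text \<open>Let \<open>annih F\<close> be the common kernel of a finite set \<open>F\<close> of continuous characters of \<open>K\<close>.
  Every neighbourhood of \<open>0\<close> contains some \<open>annih F\<close>, and conversely every subgroup in the
  neighbourhood where the members of \<open>F\<close> have positive real part lies in \<open>annih F\<close>. Hence \<open>G\<close> is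
  locally essential iff some \<open>annih F\<close> satisfies \<open>tors p (annih F) \<subseteq> G\<close> for all primes \<open>p\<close>;
  weak essentiality takes care of torsion-free closed subgroups, because a nontrivial one
  contains an infinite closed subgroup isomorphic to a group of \<open>p\<close>-adic integers.

  Characters are found by Fourier analysis on finite groups: for a finite set \<open>S\<close> there is \<open>N\<close>
  with \<open>N s\<close> close to \<open>0\<close> for all \<open>s \<in> S\<close>, so that \<open>(\<int>/N)\<^sup>S\<close> maps almost
  homomorphically to \<open>K\<close>. A large Fourier coefficient of a suitable function on this finite group
  gives an approximate eigenfunction of translations whose modulus of continuity is controlled, and
  a limit of these is a multiple of a continuous character.

  A \<open>\<delta>\<close>-subgroup is obtained as the common kernel of a set of characters that is maximal with the
  property of mapping the group onto the torus. That finite covering dimension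
  makes this set finite follows from Kuhn's combinatorial lemma.\<close>

subsection \<open>Multiples and subgroups\<close>

text \<open>All characters are characters of the whole group K; subgroups only see their
  restrictions. The coordinates of K1/N for a \<delta>-subgroup N of K1 are not such characters, but
  if the torus has finite rank they are controlled by a neighbourhood of 0, which contains
  \<open>annih F\<close> for some finite F. Since K1 contains every K[p], this puts
  \<open>tors p (annih F)\<close> into N for all p at once. This is what finite dimension
  contributes to (c). Total disconnectedness is used in one form: every character has finite order
  on the subgroup. Finitely many characters then have a common exponent t there, and for a prime p
  not dividing t the elements of order p are killed by all of them. So only finitely many primes are
  exceptional, and for these the openness of G[p] supplies further characters. The uniform rank
  bound is \<open>card F\<close>, because one character lowers the dimension of K[p] by at most one.
  In the construction of characters the danger is a limit that is constant or zero. Hence the lower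
  bound on the Fourier coefficient is fixed before the finite set of translations and the tolerance
  are chosen.\<close>

lemma nmul_add: "nmul (m + n) x = nmul m x + nmul n x"
  by (induction m) (simp_all add: add.assoc)

lemma nmul_mult: "nmul (m * n) x = nmul m (nmul n x)"
  by (induction m) (simp_all add: nmul_add)

lemma nmul_0_right [simp]: "nmul n 0 = 0"
  by (induction n) simp_all

lemma nmul_add_right: "nmul n (x + y) = nmul n x + nmul n y"
  by (induction n) (simp_all add: algebra_simps)

lemma nmul_minus: "nmul n (- x) = - nmul n x"
  by (induction n) simp_all

lemma nmul_diff_right: "nmul n (x - y) = nmul n x - nmul n y"
  using nmul_add_right[of n x "- y"] by (simp add: nmul_minus)

lemma nmul_diff: "m \<le> n \<Longrightarrow> nmul (n - m) x = nmul n x - nmul m x"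
  using nmul_add[of "n - m" m x] by simp

lemma continuous_nmul: "continuous_on UNIV (nmul n :: 'a::topological_ab_group_add \<Rightarrow> 'a)"
  by (induction n) (auto intro!: continuous_intros)

lemma subgrp_0: "subgrp S \<Longrightarrow> 0 \<in> S"
  and subgrp_add: "subgrp S \<Longrightarrow> x \<in> S \<Longrightarrow> y \<in> S \<Longrightarrow> x + y \<in> S"
  and subgrp_minus: "subgrp S \<Longrightarrow> x \<in> S \<Longrightarrow> - x \<in> S"
  by (auto simp: subgrp_def)

lemma subgrp_diff: "subgrp S \<Longrightarrow> x \<in> S \<Longrightarrow> y \<in> S \<Longrightarrow> x - y \<in> S"
  using subgrp_add[of S x "- y"] subgrp_minus[of S y] by simp

lemma subgrp_nmul: "subgrp S \<Longrightarrow> x \<in> S \<Longrightarrow> nmul n x \<in> S"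
  by (induction n) (auto intro: subgrp_0 subgrp_add)

lemma subgrp_sum: "subgrp S \<Longrightarrow> (\<And>i. i \<in> R \<Longrightarrow> g i \<in> S) \<Longrightarrow> sum g R \<in> S"
  by (induction R rule: infinite_finite_induct) (auto intro: subgrp_0 subgrp_add)

lemma subgrp_Int: "subgrp S \<Longrightarrow> subgrp T \<Longrightarrow> subgrp (S \<inter> T)"
  by (auto simp: subgrp_def)

subsection \<open>Neighbourhoods of zero\<close>

lemma Hausdorff_euclidean_t2: "Hausdorff_space (euclidean :: 'a::t2_space topology)"
  unfolding Hausdorff_space_def using hausdorff by (auto simp: disjnt_def)

lemma open_translate:
  fixes W :: "'a::topological_ab_group_add set"
  assumes "open W" shows "open {y. y - x \<in> W}"
  using open_vimage[OF assms, of "\<lambda>y. y - x"] by (simp add: vimage_def continuous_intros)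

lemma nhd_add:
  fixes W :: "'a::topological_ab_group_add set"
  assumes "open W" "0 \<in> W"
  obtains U where "open U" "0 \<in> U" "\<And>u v. u \<in> U \<Longrightarrow> v \<in> U \<Longrightarrow> u + v \<in> W"
proof -
  have "((\<lambda>x. fst x + snd x) \<longlongrightarrow> 0 + (0::'a)) (nhds 0 \<times>\<^sub>F nhds 0)"
    by (rule tendsto_add_Pair)
  then have "eventually (\<lambda>x. fst x + snd x \<in> W) (nhds 0 \<times>\<^sub>F nhds 0)"
    using assms by (auto simp: tendsto_def)
  then obtain P Q where PQ: "eventually P (nhds (0::'a))" "eventually Q (nhds 0)"
      "\<And>x y. P x \<Longrightarrow> Q y \<Longrightarrow> x + y \<in> W"
    by (auto simp: eventually_prod_filter)
  from PQ(1) obtain U1 where "open U1" "0 \<in> U1" "\<And>x. x \<in> U1 \<Longrightarrow> P x"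
    by (auto simp: eventually_nhds)
  moreover from PQ(2) obtain U2 where "open U2" "0 \<in> U2" "\<And>x. x \<in> U2 \<Longrightarrow> Q x"
    by (auto simp: eventually_nhds)
  ultimately show ?thesis using PQ(3) that[of "U1 \<inter> U2"] by auto
qed

lemma nhd_diff:
  fixes W :: "'a::topological_ab_group_add set"
  assumes "open W" "0 \<in> W"
  obtains U where "open U" "0 \<in> U" "\<And>u v. u \<in> U \<Longrightarrow> v \<in> U \<Longrightarrow> u - v \<in> W"
proof -
  obtain U where U: "open U" "0 \<in> U" "\<And>u v. u \<in> U \<Longrightarrow> v \<in> U \<Longrightarrow> u + v \<in> W"
    using nhd_add[OF assms] by metis
  have "open (uminus -` U)"
    using U(1) by (intro open_vimage continuous_intros)
  with U show ?thesis
    using that[of "U \<inter> uminus -` U"] by (auto simp: diff_conv_add_uminus simp del: add_uminus_conv_diff)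
qed

text \<open>One U serves all index sets of size at most n. It is applied to the carries in (Z/N)^S
  and to the steps of the grid over a torus.\<close>

lemma nhd_sum:
  fixes W :: "'a::topological_ab_group_add set"
  assumes "open W" "0 \<in> W"
  shows "\<exists>U. open U \<and> 0 \<in> U \<and>
    (\<forall>R (g::'b \<Rightarrow> 'a). finite R \<and> card R \<le> n \<and> (\<forall>i\<in>R. g i \<in> U) \<longrightarrow> sum g R \<in> W)"
  using assms
proof (induction n arbitrary: W)
  case 0
  then show ?case by (intro exI[of _ W]) auto
next
  case (Suc n)
  obtain U where U: "open U" "0 \<in> U" "\<And>u v. u \<in> U \<Longrightarrow> v \<in> U \<Longrightarrow> u + v \<in> W"
    using nhd_add[OF Suc.prems] by metis
  obtain U' where U': "open U'" "0 \<in> U'"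
      "\<And>R (g::'b \<Rightarrow> 'a). finite R \<Longrightarrow> card R \<le> n \<Longrightarrow> (\<forall>i\<in>R. g i \<in> U') \<Longrightarrow> sum g R \<in> U"
    using Suc.IH[OF U(1,2)] by metis
  have "sum g R \<in> W" if "finite R" "card R \<le> Suc n" "\<forall>i\<in>R. g i \<in> U \<inter> U'" for R and g :: "'b \<Rightarrow> 'a"
  proof (cases "R = {}")
    case False
    then obtain i where i: "i \<in> R" by auto
    have "sum g R = g i + sum g (R - {i})" using i that(1) by (simp add: sum.remove)
    moreover have "sum g (R - {i}) \<in> U" using that i by (intro U'(3)) auto
    ultimately show ?thesis using U(3) that(3) i by auto
  qed (use Suc.prems in simp)
  with U U' show ?case by (intro exI[of _ "U \<inter> U'"]) auto
qed

text \<open>W plays the role of a Lebesgue number: each x in L has all of its W-close points of L in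
  one member of the cover. As usual, each point gets room for two small steps, one to a centre of a
  finite subcover and one away from x.\<close>

lemma lebesgue_nhd:
  fixes L :: "'a::topological_ab_group_add set"
  assumes L: "compact L" and op: "\<And>V. V \<in> \<V> \<Longrightarrow> openin (top_of_set L) V" and cov: "L \<subseteq> \<Union>\<V>"
  obtains W where "open W" "0 \<in> W" "\<And>x. x \<in> L \<Longrightarrow> \<exists>V\<in>\<V>. \<forall>y\<in>L. y - x \<in> W \<longrightarrow> y \<in> V"
proof -
  have "\<exists>V W. V \<in> \<V> \<and> open W \<and> 0 \<in> W \<and> (\<forall>u\<in>W. \<forall>v\<in>W. x + (u + v) \<in> L \<longrightarrow> x + (u + v) \<in> V)"
    if xL: "x \<in> L" for x
  proof -
    obtain V where V: "V \<in> \<V>" "x \<in> V" using cov xL by blast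
    then obtain T where T: "open T" "V = L \<inter> T" using op by (auto simp: openin_open)
    have "open {y. y - (- x) \<in> T}" using open_translate[OF T(1)] .
    moreover have "0 \<in> {y. y - (- x) \<in> T}" using V T by simp
    ultimately obtain U where "open U" "0 \<in> U" "\<And>u v. u \<in> U \<Longrightarrow> v \<in> U \<Longrightarrow> u + v \<in> {y. y - (- x) \<in> T}"
      using nhd_add by metis
    then show ?thesis using V T by (intro exI[of _ V] exI[of _ U]) (auto simp: add.commute)
  qed
  then obtain V W where VW: "\<And>x. x \<in> L \<Longrightarrow> V x \<in> \<V> \<and> open (W x) \<and> 0 \<in> W x \<and>
      (\<forall>u\<in>W x. \<forall>v\<in>W x. x + (u + v) \<in> L \<longrightarrow> x + (u + v) \<in> V x)"
    by metis
  have "open {y. y - x \<in> W x}" if "x \<in> L" for x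
    using VW[OF that] by (intro open_translate) simp
  moreover have "L \<subseteq> (\<Union>x\<in>L. {y. y - x \<in> W x})"
  proof
    fix x assume "x \<in> L"
    then show "x \<in> (\<Union>x\<in>L. {y. y - x \<in> W x})" using VW[of x] by (intro UN_I[of x]) auto
  qed
  ultimately obtain D where D: "D \<subseteq> L" "finite D" "L \<subseteq> (\<Union>x\<in>D. {y. y - x \<in> W x})"
    by (rule compactE_image[OF L])
  show ?thesis
  proof (rule that[of "\<Inter>x\<in>D. W x"])
    have D_VW: "open (W x)" "0 \<in> W x" if "x \<in> D" for x
      using VW[of x] that D(1) by auto
    show "open (\<Inter>x\<in>D. W x)" using D(2) D_VW by (intro open_INT) auto
    show "0 \<in> (\<Inter>x\<in>D. W x)" using D_VW by auto
    fix x assume "x \<in> L"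
    then have "x \<in> (\<Union>x\<in>D. {y. y - x \<in> W x})" using D(3) by (rule rev_subsetD)
    then obtain z where z: "z \<in> D" "x - z \<in> W z" by auto
    have "y \<in> V z" if "y \<in> L" "y - x \<in> (\<Inter>x\<in>D. W x)" for y
    proof -
      have "z \<in> L" using z(1) D(1) by auto
      then have *: "z + (u + v) \<in> L \<Longrightarrow> z + (u + v) \<in> V z" if "u \<in> W z" "v \<in> W z" for u v
        using VW[of z] that by simp
      have "y - x \<in> W z" using that(2) z(1) by auto
      then show ?thesis using *[OF z(2), of "y - x"] that(1) by simp
    qed
    then show "\<exists>V\<in>\<V>. \<forall>y\<in>L. y - x \<in> (\<Inter>x\<in>D. W x) \<longrightarrow> y \<in> V"
      using VW[of z] z D(1) by (intro bexI[of _ "V z"]) auto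
  qed
qed

lemma uniform_nhd:
  fixes f :: "'a::topological_ab_group_add \<Rightarrow> 'b::metric_space"
  assumes K: "compact (UNIV :: 'a set)" and f: "continuous_on UNIV f" and e: "e > 0"
  obtains W where "open W" "0 \<in> W" "\<And>x y. y - x \<in> W \<Longrightarrow> dist (f y) (f x) < e"
proof -
  let ?V = "range (\<lambda>x. {y. dist (f y) (f x) < e / 2})"
  have op: "open {y. dist (f y) (f x) < e / 2}" for x
    by (intro open_Collect_less continuous_intros f)
  obtain W where W: "open W" "0 \<in> W" "\<And>x. \<exists>V\<in>?V. \<forall>y. y - x \<in> W \<longrightarrow> y \<in> V"
    by (rule lebesgue_nhd[OF K, of ?V]) (use op e in \<open>auto simp: openin_open\<close>)
  show ?thesis
  proof (rule that[OF W(1,2)])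
    fix x y :: 'a assume "y - x \<in> W"
    obtain z where "\<forall>y. y - x \<in> W \<longrightarrow> dist (f y) (f z) < e / 2" using W(3)[of x] by auto
    then have "dist (f y) (f z) < e / 2" "dist (f x) (f z) < e / 2" using \<open>y - x \<in> W\<close> W(2) by auto
    then show "dist (f y) (f x) < e" by (metis dist_triangle_half_r dist_commute)
  qed
qed

lemma finite_translates:
  fixes W :: "'a::topological_ab_group_add set"
  assumes K: "compact (UNIV :: 'a set)" and W: "open W" "0 \<in> W"
  obtains A where "finite A" "A \<noteq> {}" "\<And>x. \<exists>a\<in>A. x - a \<in> W"
proof -
  have "UNIV \<subseteq> (\<Union>x\<in>UNIV. {y. y - x \<in> W})" using W by auto
  then obtain D where "D \<subseteq> UNIV" "finite D" "UNIV \<subseteq> (\<Union>x\<in>D. {y. y - x \<in> W})"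
    using compactE_image[OF K, of UNIV "\<lambda>x. {y. y - x \<in> W}"] open_translate[OF W(1)] by metis
  then show ?thesis using that[of D] by auto
qed

lemma simultaneous_recurrence:
  fixes U :: "'a::topological_ab_group_add set"
  assumes K: "compact (UNIV :: 'a set)" and U: "open U" "0 \<in> U" and S: "finite S"
  obtains N where "N \<ge> 2" "\<And>s. s \<in> S \<Longrightarrow> nmul N s \<in> U"
proof -
  obtain W where W: "open W" "0 \<in> W" "\<And>u v. u \<in> W \<Longrightarrow> v \<in> W \<Longrightarrow> u - v \<in> U"
    using nhd_diff[OF U] by metis
  obtain A where A: "finite A" "\<And>x. \<exists>a\<in>A. x - a \<in> W" using finite_translates[OF K W(1,2)] by metis
  then obtain c where c: "\<And>x. c x \<in> A \<and> x - c x \<in> W" by metis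
  \<comment> \<open>Pigeonhole on the rough positions of the multiples. Using only even multiples
    makes the difference of two indices at least 2, so that digit vectors may later have an entry
    1.\<close>
  define F where "F j = (\<lambda>s\<in>S. c (nmul (2 * j) s))" for j :: nat
  have "F ` UNIV \<subseteq> PiE S (\<lambda>_. A)" using c by (auto simp: F_def)
  then have "finite (range F)" using S A finite_PiE finite_subset by (metis (no_types, lifting))
  then have "\<not> inj F" using finite_imageD infinite_UNIV_nat by blast
  then obtain i j where ij: "F i = F j" "i < j" by (metis injI linorder_neqE_nat)
  show ?thesis
  proof (rule that[of "2 * j - 2 * i"])
    fix s assume s: "s \<in> S"
    have "c (nmul (2 * i) s) = c (nmul (2 * j) s)" using ij(1) s unfolding F_def by (metis restrict_apply')
    then have "(nmul (2 * j) s - c (nmul (2 * j) s)) - (nmul (2 * i) s - c (nmul (2 * j) s)) \<in> U"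
      using c W(3) by metis
    then show "nmul (2 * j - 2 * i) s \<in> U" using ij by (simp add: nmul_diff)
  qed (use ij in auto)
qed


subsection \<open>Fourier analysis on finite groups\<close>

lemma finite_parseval:
  fixes e :: "'x \<Rightarrow> 'v \<Rightarrow> complex"
  assumes fin: "finite A"
    and orth: "\<And>v w. v \<in> A \<Longrightarrow> w \<in> A \<Longrightarrow> (\<Sum>\<xi>\<in>X. e \<xi> v * cnj (e \<xi> w)) = (if v = w then of_real q else 0)"
  shows "(\<Sum>\<xi>\<in>X. (cmod (\<Sum>v\<in>A. g v * cnj (e \<xi> v)))\<^sup>2) = q * (\<Sum>v\<in>A. (cmod (g v))\<^sup>2)"
proof -
  have "complex_of_real (\<Sum>\<xi>\<in>X. (cmod (\<Sum>v\<in>A. g v * cnj (e \<xi> v)))\<^sup>2)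
      = (\<Sum>\<xi>\<in>X. \<Sum>v\<in>A. \<Sum>w\<in>A. g v * cnj (g w) * (e \<xi> w * cnj (e \<xi> v)))"
    by (simp only: of_real_sum complex_norm_square cnj_sum sum_product complex_cnj_mult
        complex_cnj_cnj mult_ac)
  also have "\<dots> = (\<Sum>v\<in>A. \<Sum>\<xi>\<in>X. \<Sum>w\<in>A. g v * cnj (g w) * (e \<xi> w * cnj (e \<xi> v)))"
    by (rule sum.swap)
  also have "\<dots> = (\<Sum>v\<in>A. \<Sum>w\<in>A. \<Sum>\<xi>\<in>X. g v * cnj (g w) * (e \<xi> w * cnj (e \<xi> v)))"
    by (intro sum.cong refl sum.swap)
  also have "\<dots> = (\<Sum>v\<in>A. \<Sum>w\<in>A. if v = w then g v * cnj (g v) * of_real q else 0)"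
    by (intro sum.cong refl) (simp add: orth sum_distrib_left[symmetric])
  also have "\<dots> = (\<Sum>v\<in>A. of_real q * (g v * cnj (g v)))"
    using fin by (simp add: sum.delta mult_ac)
  also have "\<dots> = complex_of_real (q * (\<Sum>v\<in>A. (cmod (g v))\<^sup>2))"
    by (simp only: of_real_mult of_real_sum complex_norm_square sum_distrib_left)
  finally show ?thesis by (simp only: of_real_eq_iff)
qed

text \<open>A quantitative form of: an almost periodic function has a nonzero Fourier coefficient.
  Here \<open>\<tau> u\<close> is translation by \<open>u\<close>; it matters that the bound does not depend on the size of \<open>A\<close>.\<close>

lemma large_fourier_coefficient:
  fixes e :: "'x \<Rightarrow> 'v \<Rightarrow> complex" and h h' :: "'v \<Rightarrow> complex" and \<beta> \<eta> M :: real
  assumes A: "finite A" "A \<noteq> {}" and X: "finite X"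
    and orth: "\<And>v w. v \<in> A \<Longrightarrow> w \<in> A \<Longrightarrow>
      (\<Sum>\<xi>\<in>X. e \<xi> v * cnj (e \<xi> w)) = (if v = w then of_real (card A) else 0)"
    and norm_e: "\<And>\<xi> v. \<xi> \<in> X \<Longrightarrow> v \<in> A \<Longrightarrow> cmod (e \<xi> v) = 1"
    and shift: "\<And>u. u \<in> A \<Longrightarrow> bij_betw (\<tau> u) A A"
    and e_shift: "\<And>\<xi> u v. \<xi> \<in> X \<Longrightarrow> u \<in> A \<Longrightarrow> v \<in> A \<Longrightarrow> e \<xi> (\<tau> u v) = e \<xi> u * e \<xi> v"
    and P: "P \<subseteq> A" "card A \<le> m * card P"
    and near: "\<And>u v. u \<in> P \<Longrightarrow> v \<in> A \<Longrightarrow> cmod (h' v - h (\<tau> u v)) \<le> \<eta>"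
    and large: "(\<Sum>v\<in>A. (cmod (h v))\<^sup>2) \<ge> \<beta> * card A"
    and bounded: "\<And>v. v \<in> A \<Longrightarrow> cmod (h' v) \<le> 1"
    and small: "\<And>\<xi>. \<xi> \<in> X \<Longrightarrow> cmod (\<Sum>v\<in>A. h v * cnj (e \<xi> v)) \<le> M * card A"
    and M: "0 \<le> M" and eta: "0 \<le> \<eta>"
  shows "\<beta> - \<eta>\<^sup>2 \<le> 2 * M * sqrt m"
proof -
  define Q where "Q = real (card A)"
  have Q: "Q > 0" using A by (simp add: Q_def card_gt_0_iff)
  define F where "F g \<xi> = (\<Sum>v\<in>A. g v * cnj (e \<xi> v))" for g \<xi>
  have parseval: "(\<Sum>\<xi>\<in>X. (cmod (F g \<xi>))\<^sup>2) = Q * (\<Sum>v\<in>A. (cmod (g v))\<^sup>2)" for g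
    unfolding F_def Q_def by (rule finite_parseval[OF A(1) orth])
  have F_shift: "F (\<lambda>v. h (\<tau> u v)) \<xi> = e \<xi> u * F h \<xi>" if "\<xi> \<in> X" "u \<in> A" for \<xi> u
  proof -
    have "e \<xi> u * cnj (e \<xi> u) = 1"
      using norm_e[OF that] by (metis complex_norm_square of_real_1 one_power2)
    then have "h (\<tau> u v) * cnj (e \<xi> v) = e \<xi> u * (h (\<tau> u v) * cnj (e \<xi> (\<tau> u v)))" if "v \<in> A" for v
      using e_shift[OF \<open>\<xi> \<in> X\<close> \<open>u \<in> A\<close> that]
        arg_cong[where f = "\<lambda>c. c * (h (\<tau> u v) * cnj (e \<xi> v))", of "e \<xi> u * cnj (e \<xi> u)" 1]
      by (simp add: mult_ac)
    then have "F (\<lambda>v. h (\<tau> u v)) \<xi> = (\<Sum>v\<in>A. e \<xi> u * (h (\<tau> u v) * cnj (e \<xi> (\<tau> u v))))"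
      unfolding F_def by (intro sum.cong refl)
    also have "\<dots> = e \<xi> u * (\<Sum>v\<in>A. h (\<tau> u v) * cnj (e \<xi> (\<tau> u v)))"
      by (simp add: sum_distrib_left)
    also have "(\<Sum>v\<in>A. h (\<tau> u v) * cnj (e \<xi> (\<tau> u v))) = F h \<xi>"
      unfolding F_def by (rule sum.reindex_bij_betw[OF shift[OF that(2)]])
    finally show ?thesis .
  qed
  have F_diff: "F (\<lambda>v. g v - g' v) \<xi> = F g \<xi> - F g' \<xi>" for g g' \<xi>
    unfolding F_def by (simp add: algebra_simps sum_subtractf)
  have expand: "(cmod (z - w))\<^sup>2 = (cmod z)\<^sup>2 + (cmod w)\<^sup>2 - 2 * Re (z * cnj w)" for z w
    by (simp only: cmod_power2) (simp add: power2_eq_square algebra_simps)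
  \<comment> \<open>Parseval for the difference of \<open>h'\<close> and the shift of h by u, whose
    coefficients are F h' \<xi> - e \<xi> u * F h \<xi>. After expanding the square, the term with F
    h' alone is dropped and \<open>large\<close> bounds the one with F h.\<close>
  have one: "(\<beta> - \<eta>\<^sup>2) * Q\<^sup>2 / 2 \<le> Re (\<Sum>\<xi>\<in>X. F h' \<xi> * cnj (F h \<xi>) * cnj (e \<xi> u))" if u: "u \<in> P" for u
  proof -
    have uA: "u \<in> A" using u P by auto
    have "(\<Sum>\<xi>\<in>X. (cmod (F h' \<xi> - e \<xi> u * F h \<xi>))\<^sup>2) = (\<Sum>\<xi>\<in>X. (cmod (F (\<lambda>v. h' v - h (\<tau> u v)) \<xi>))\<^sup>2)"
      using uA by (intro sum.cong refl) (simp add: F_diff F_shift)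
    also have "\<dots> = Q * (\<Sum>v\<in>A. (cmod (h' v - h (\<tau> u v)))\<^sup>2)" by (rule parseval)
    also have "\<dots> \<le> Q * (\<Sum>v\<in>A. \<eta>\<^sup>2)"
      using near[OF u] Q by (intro mult_left_mono sum_mono power_mono) auto
    finally have le: "(\<Sum>\<xi>\<in>X. (cmod (F h' \<xi> - e \<xi> u * F h \<xi>))\<^sup>2) \<le> Q\<^sup>2 * \<eta>\<^sup>2"
      by (simp add: Q_def power2_eq_square mult_ac)
    have "(\<Sum>\<xi>\<in>X. (cmod (F h' \<xi> - e \<xi> u * F h \<xi>))\<^sup>2)
        = (\<Sum>\<xi>\<in>X. (cmod (F h' \<xi>))\<^sup>2) + (\<Sum>\<xi>\<in>X. (cmod (F h \<xi>))\<^sup>2)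
          - 2 * Re (\<Sum>\<xi>\<in>X. F h' \<xi> * cnj (F h \<xi>) * cnj (e \<xi> u))"
    proof -
      have "(cmod (F h' \<xi> - e \<xi> u * F h \<xi>))\<^sup>2 = (cmod (F h' \<xi>))\<^sup>2 + (cmod (F h \<xi>))\<^sup>2
          - 2 * Re (F h' \<xi> * cnj (F h \<xi>) * cnj (e \<xi> u))" if "\<xi> \<in> X" for \<xi>
        unfolding expand using norm_e[OF that uA] by (simp add: norm_mult mult_ac)
      then show ?thesis by (simp add: sum.distrib sum_subtractf sum_distrib_left)
    qed
    moreover have "(\<Sum>\<xi>\<in>X. (cmod (F h' \<xi>))\<^sup>2) \<ge> 0" by (intro sum_nonneg) auto
    moreover have "(\<Sum>\<xi>\<in>X. (cmod (F h \<xi>))\<^sup>2) \<ge> Q * (\<beta> * Q)"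
      unfolding parseval using large Q by (intro mult_left_mono) (auto simp: Q_def)
    ultimately show ?thesis using le by (simp add: power2_eq_square algebra_simps)
  qed
  \<comment> \<open>T is the transform of the indicator function of P, so Parseval evaluates its
    square sum.\<close>
  define T where "T \<xi> = (\<Sum>u\<in>P. cnj (e \<xi> u))" for \<xi>
  have finP: "finite P" using P A finite_subset by auto
  have T: "(\<Sum>\<xi>\<in>X. (cmod (T \<xi>))\<^sup>2) = Q * card P"
  proof -
    have "T \<xi> = F (\<lambda>u. if u \<in> P then 1 else 0) \<xi>" for \<xi>
    proof -
      have "F (\<lambda>u. if u \<in> P then 1 else 0) \<xi> = (\<Sum>v\<in>A. if v \<in> P then cnj (e \<xi> v) else 0)"
        unfolding F_def by (intro sum.cong) auto
      also have "\<dots> = (\<Sum>v\<in>A \<inter> P. cnj (e \<xi> v))" using A by (simp add: sum.inter_restrict)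
      also have "A \<inter> P = P" using P by auto
      finally show ?thesis by (simp add: T_def)
    qed
    then have "(\<Sum>\<xi>\<in>X. (cmod (T \<xi>))\<^sup>2) = Q * (\<Sum>v\<in>A. (cmod (if v \<in> P then 1 else 0))\<^sup>2)"
      by (simp add: parseval)
    also have "(\<Sum>v\<in>A. (cmod (if v \<in> P then 1 else 0))\<^sup>2) = (\<Sum>v\<in>A. if v \<in> P then 1 else (0::real))"
      by (intro sum.cong) auto
    also have "\<dots> = card P"
      using A P by (simp add: sum.If_cases Int_absorb1)
    finally show ?thesis .
  qed
  \<comment> \<open>Summation over u in P turns the phases into T. With the bound M * Q on F h
    pulled out, Cauchy-Schwarz leaves Q * sqrt (Q * card P), and the density of P in A lets card P
    and all powers of Q cancel.\<close>
  have "card P * ((\<beta> - \<eta>\<^sup>2) * Q\<^sup>2 / 2) \<le> (\<Sum>u\<in>P. Re (\<Sum>\<xi>\<in>X. F h' \<xi> * cnj (F h \<xi>) * cnj (e \<xi> u)))"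
    using sum_mono[of P "\<lambda>_. (\<beta> - \<eta>\<^sup>2) * Q\<^sup>2 / 2", OF one] by simp
  also have "\<dots> = Re (\<Sum>u\<in>P. \<Sum>\<xi>\<in>X. F h' \<xi> * cnj (F h \<xi>) * cnj (e \<xi> u))"
    by simp
  also have "\<dots> = Re (\<Sum>\<xi>\<in>X. F h' \<xi> * cnj (F h \<xi>) * T \<xi>)"
    by (subst sum.swap) (simp add: T_def sum_distrib_left)
  also have "\<dots> \<le> cmod (\<Sum>\<xi>\<in>X. F h' \<xi> * cnj (F h \<xi>) * T \<xi>)"
    by (rule complex_Re_le_cmod)
  also have "\<dots> \<le> (\<Sum>\<xi>\<in>X. M * Q * (\<bar>cmod (F h' \<xi>)\<bar> * \<bar>cmod (T \<xi>)\<bar>))"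
  proof (rule order_trans[OF norm_sum sum_mono])
    fix \<xi> assume "\<xi> \<in> X"
    then have "cmod (F h \<xi>) * (cmod (F h' \<xi>) * cmod (T \<xi>)) \<le> M * Q * (cmod (F h' \<xi>) * cmod (T \<xi>))"
      using small by (intro mult_right_mono) (auto simp: F_def Q_def)
    then show "cmod (F h' \<xi> * cnj (F h \<xi>) * T \<xi>) \<le> M * Q * (\<bar>cmod (F h' \<xi>)\<bar> * \<bar>cmod (T \<xi>)\<bar>)"
      by (simp add: norm_mult mult_ac)
  qed
  also have "\<dots> = M * Q * (\<Sum>\<xi>\<in>X. \<bar>cmod (F h' \<xi>)\<bar> * \<bar>cmod (T \<xi>)\<bar>)"
    by (simp add: sum_distrib_left)
  also have "\<dots> \<le> M * Q * (L2_set (\<lambda>\<xi>. cmod (F h' \<xi>)) X * L2_set (\<lambda>\<xi>. cmod (T \<xi>)) X)"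
    using M Q by (intro mult_left_mono L2_set_mult_ineq) auto
  also have "L2_set (\<lambda>\<xi>. cmod (F h' \<xi>)) X \<le> Q"
  proof -
    have "(\<Sum>v\<in>A. (cmod (h' v))\<^sup>2) \<le> (\<Sum>v\<in>A. 1)"
      using bounded by (intro sum_mono) (simp add: power_le_one)
    then have "Q * (\<Sum>v\<in>A. (cmod (h' v))\<^sup>2) \<le> Q\<^sup>2"
      using Q by (simp add: Q_def power2_eq_square)
    then show ?thesis
      unfolding L2_set_def parseval using Q real_sqrt_le_mono by fastforce
  qed
  also have "L2_set (\<lambda>\<xi>. cmod (T \<xi>)) X = sqrt (Q * card P)"
    unfolding L2_set_def T ..
  also have "sqrt (Q * card P) \<le> sqrt m * card P"
  proof -
    have "Q * card P \<le> m * (card P)\<^sup>2"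
    proof -
      have "Q \<le> real m * real (card P)" using P(2) unfolding Q_def
        by (metis of_nat_le_iff of_nat_mult)
      then have "Q * real (card P) \<le> (real m * real (card P)) * real (card P)"
        by (rule mult_right_mono) simp
      then show ?thesis by (simp add: power2_eq_square mult_ac)
    qed
    then have "sqrt (Q * card P) \<le> sqrt (real m * (real (card P))\<^sup>2)" by (simp add: real_sqrt_le_mono)
    then show ?thesis by (simp add: real_sqrt_mult)
  qed
  finally have fin: "card P * ((\<beta> - \<eta>\<^sup>2) * Q\<^sup>2 / 2) \<le> M * Q * (Q * (sqrt m * card P))"
    using M Q by (simp add: mult_left_mono mult_right_mono)
  have "card P > 0"
    using P(2) A by (cases "card P = 0") (auto simp: card_gt_0_iff)
  then have "card P * Q\<^sup>2 > 0" using Q by simp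
  moreover have "(card P * Q\<^sup>2) * (\<beta> - \<eta>\<^sup>2) \<le> (card P * Q\<^sup>2) * (2 * M * sqrt m)"
    using fin by (simp add: power2_eq_square mult_ac)
  ultimately show ?thesis by (simp only: mult_le_cancel_left_pos)
qed

section \<open>The finite group (Z/N)^S, its characters and its almost homomorphism into K\<close>

definition box :: "'s set \<Rightarrow> nat \<Rightarrow> ('s \<Rightarrow> nat) set" where
  "box S N = PiE S (\<lambda>_. {..<N})"

text \<open>Additive up to carries: a carry at s costs \<open>nmul N s\<close>, which
  \<open>simultaneous_recurrence\<close> makes small.\<close>

definition box_map :: "'a::ab_group_add set \<Rightarrow> ('a \<Rightarrow> nat) \<Rightarrow> 'a" where
  "box_map S v = (\<Sum>s\<in>S. nmul (v s) s)"

definition box_shift :: "'s set \<Rightarrow> nat \<Rightarrow> ('s \<Rightarrow> nat) \<Rightarrow> ('s \<Rightarrow> nat) \<Rightarrow> 's \<Rightarrow> nat" where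
  "box_shift S N u v = (\<lambda>s\<in>S. (v s + u s) mod N)"

definition box_char :: "'s set \<Rightarrow> nat \<Rightarrow> ('s \<Rightarrow> nat) \<Rightarrow> ('s \<Rightarrow> nat) \<Rightarrow> complex" where
  "box_char S N \<xi> v = (\<Prod>s\<in>S. exp (2 * of_real pi * \<i> / of_nat N) ^ (\<xi> s * v s))"

lemma finite_box: "finite S \<Longrightarrow> finite (box S N)"
  by (simp add: box_def finite_PiE)

lemma card_box: "finite S \<Longrightarrow> card (box S N) = N ^ card S"
  by (simp add: box_def card_PiE)

lemma root_unity_power:
  assumes "N > 0"
  shows "exp (2 * of_real pi * \<i> / of_nat N) ^ v = exp (2 * of_real pi * \<i> * of_nat v / of_nat N)"
  by (simp add: exp_of_nat_mult[symmetric] mult_ac)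

lemma root_unity_N: "N > 0 \<Longrightarrow> exp (2 * of_real pi * \<i> / of_nat N) ^ N = 1"
  by (simp add: root_unity_power complex_root_unity_eq_1)

lemma root_unity_mod:
  assumes "N > 0"
  shows "exp (2 * of_real pi * \<i> / of_nat N) ^ (a * (x mod N)) = exp (2 * of_real pi * \<i> / of_nat N) ^ (a * x)"
    (is "?w ^ _ = _")
proof -
  have "a * x = N * (a * (x div N)) + a * (x mod N)"
    by (metis distrib_left mult.left_commute mult_div_mod_eq)
  then have "?w ^ (a * x) = (?w ^ N) ^ (a * (x div N)) * ?w ^ (a * (x mod N))"
    by (metis power_add power_mult)
  then show ?thesis using root_unity_N[OF assms] by simp
qed

lemma norm_box_char: "cmod (box_char S N \<xi> v) = 1"
  by (simp add: box_char_def prod_norm[symmetric] norm_power norm_exp_eq_Re)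

lemma box_char_shift:
  assumes "N > 0"
  shows "box_char S N \<xi> (box_shift S N u v) = box_char S N \<xi> u * box_char S N \<xi> v"
proof -
  have "box_char S N \<xi> (box_shift S N u v)
      = (\<Prod>s\<in>S. exp (2 * of_real pi * \<i> / of_nat N) ^ (\<xi> s * (v s + u s)))"
    unfolding box_char_def box_shift_def by (intro prod.cong refl) (simp add: root_unity_mod[OF assms])
  then show ?thesis
    by (simp add: box_char_def prod.distrib[symmetric] distrib_left power_add mult.commute)
qed

lemma bij_box_shift:
  assumes "finite S" "N > 0" "u \<in> box S N"
  shows "bij_betw (box_shift S N u) (box S N) (box S N)"
proof -
  have "inj_on (box_shift S N u) (box S N)"
  proof (rule inj_onI)
    fix v w assume vw: "v \<in> box S N" "w \<in> box S N" "box_shift S N u v = box_shift S N u w"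
    show "v = w"
    proof (rule PiE_ext)
      show "v \<in> PiE S (\<lambda>_. {..<N})" "w \<in> PiE S (\<lambda>_. {..<N})" using vw by (auto simp: box_def)
      fix s assume s: "s \<in> S"
      have "(v s + u s) mod N = (w s + u s) mod N"
        using fun_cong[OF vw(3), of s] s by (simp add: box_shift_def)
      moreover have "v s < N" "w s < N" "u s < N" using vw(1,2) assms(3) s by (auto simp: box_def)
      moreover have "x mod N = (if x < N then x else x - N)" if "x < 2 * N" for x
        using that by (simp add: mod_if)
      ultimately show "v s = w s" by (simp split: if_splits)
    qed
  qed
  moreover have "box_shift S N u ` box S N \<subseteq> box S N"
    using assms(2) by (auto simp: box_shift_def box_def)
  ultimately show ?thesis
    using endo_inj_surj[OF finite_box[OF assms(1)]] by (auto simp: bij_betw_def)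
qed

text \<open>The sum over \<xi> factors into one geometric series per coordinate. A coordinate where
  v and w differ has as ratio an N-th root of unity other than 1, so its factor vanishes.\<close>

lemma box_char_orth:
  assumes S: "finite S" and N: "N > 0" and v: "v \<in> box S N" and w: "w \<in> box S N"
  shows "(\<Sum>\<xi>\<in>box S N. box_char S N \<xi> v * cnj (box_char S N \<xi> w))
    = (if v = w then of_real (card (box S N)) else 0)"
proof -
  define \<omega> where "\<omega> = exp (2 * of_real pi * \<i> / of_nat N)"
  define r where "r s = \<omega> ^ v s * cnj (\<omega> ^ w s)" for s
  have "(\<Sum>\<xi>\<in>box S N. box_char S N \<xi> v * cnj (box_char S N \<xi> w)) = (\<Sum>\<xi>\<in>box S N. \<Prod>s\<in>S. r s ^ \<xi> s)"
    unfolding box_char_def r_def \<omega>_def[symmetric]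
    by (intro sum.cong refl) (simp add: prod.distrib[symmetric] power_mult_distrib power_mult[symmetric] mult.commute)
  also have "\<dots> = (\<Prod>s\<in>S. \<Sum>j<N. r s ^ j)"
    unfolding box_def using S by (subst prod_sum_PiE) auto
  also have "\<dots> = (if v = w then of_real (card (box S N)) else 0)"
  proof (cases "v = w")
    case True
    have "r s = 1" for s
      unfolding r_def True complex_norm_square[symmetric] by (simp add: \<omega>_def norm_power norm_exp_eq_Re)
    then show ?thesis using True S by (simp add: card_box)
  next
    case False
    then obtain s where s: "s \<in> S" "v s \<noteq> w s"
      using v w unfolding box_def by (meson PiE_ext)
    have "cmod \<omega> = 1" by (simp add: \<omega>_def norm_exp_eq_Re)
    have "r s \<noteq> 1"
    proof
      assume "r s = 1"
      have "\<omega> ^ w s = r s * \<omega> ^ w s" using \<open>r s = 1\<close> by simp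
      also have "\<dots> = \<omega> ^ v s * (\<omega> ^ w s * cnj (\<omega> ^ w s))" by (simp add: r_def mult_ac)
      also have "\<omega> ^ w s * cnj (\<omega> ^ w s) = 1"
        unfolding complex_norm_square[symmetric] by (simp add: norm_power \<open>cmod \<omega> = 1\<close>)
      finally have "w s mod N = v s mod N"
        unfolding \<omega>_def root_unity_power[OF N] using N by (subst (asm) mult_1_right) (simp add: complex_root_unity_eq)
      moreover have "v s < N" "w s < N" using v w s by (auto simp: box_def)
      ultimately show False using s by simp
    qed
    moreover have "r s ^ N = 1"
    proof -
      have "\<omega> ^ N = 1" unfolding \<omega>_def by (rule root_unity_N[OF N])
      then have "(\<omega> ^ a) ^ N = 1" for a by (metis power_commutes power_mult mult.commute power_one)
      then show ?thesis unfolding r_def power_mult_distrib complex_cnj_power[symmetric] by simp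
    qed
    ultimately have "(\<Sum>j<N. r s ^ j) = 0"
      using geometric_sum[of "r s" N] by simp
    then show ?thesis using False s S by (auto simp: prod_zero_iff)
  qed
  finally show ?thesis .
qed

lemma box_map_add:
  assumes "finite S" "u \<in> box S N" "v \<in> box S N"
  obtains R where "R \<subseteq> S" "box_map S v + box_map S u = box_map S (box_shift S N u v) + (\<Sum>s\<in>R. nmul N s)"
proof -
  define R where "R = {s \<in> S. N \<le> v s + u s}"
  have "nmul (v s + u s) s = nmul ((v s + u s) mod N) s + (if N \<le> v s + u s then nmul N s else 0)"
    if "s \<in> S" for s
  proof (cases "N \<le> v s + u s")
    case True
    have "v s < N" "u s < N" using assms that by (auto simp: box_def)
    then have "(v s + u s) mod N = v s + u s - N" using True by (simp add: mod_if)
    then show ?thesis using True by (simp add: nmul_diff)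
  qed simp
  then have "box_map S v + box_map S u
      = (\<Sum>s\<in>S. nmul ((v s + u s) mod N) s + (if N \<le> v s + u s then nmul N s else 0))"
    unfolding box_map_def sum.distrib[symmetric] by (intro sum.cong refl) (simp add: nmul_add)
  also have "\<dots> = box_map S (box_shift S N u v) + (\<Sum>s\<in>R. nmul N s)"
    using assms(1) by (simp add: sum.distrib box_map_def box_shift_def R_def sum.If_cases Int_def)
  finally show ?thesis using that[of R] by (auto simp: R_def)
qed

lemma pigeonhole_cover:
  assumes "finite A" "finite I" "\<And>x. x \<in> A \<Longrightarrow> \<exists>i\<in>I. Q i x" "I \<noteq> {}"
  obtains i where "i \<in> I" "card A \<le> card I * card {x \<in> A. Q i x}"
proof -
  have "\<exists>i\<in>I. card A \<le> card I * card {x \<in> A. Q i x}"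
  proof (rule ccontr)
    assume "\<not> ?thesis"
    then have lt: "card I * card {x \<in> A. Q i x} < card A" if "i \<in> I" for i using that by force
    have "A \<subseteq> (\<Union>i\<in>I. {x \<in> A. Q i x})" using assms(3) by blast
    then have "card A \<le> card (\<Union>i\<in>I. {x \<in> A. Q i x})"
      using assms by (intro card_mono) auto
    also have "\<dots> \<le> (\<Sum>i\<in>I. card {x \<in> A. Q i x})" by (rule card_UN_le[OF assms(2)])
    finally have "card I * card A \<le> card I * (\<Sum>i\<in>I. card {x \<in> A. Q i x})" by simp
    also have "\<dots> = (\<Sum>i\<in>I. card I * card {x \<in> A. Q i x})" by (simp add: sum_distrib_left)
    also have "\<dots> < (\<Sum>i\<in>I. card A)"
      using assms lt by (intro sum_strict_mono) auto
    finally show False by simp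
  qed
  then show ?thesis using that by auto
qed


subsection \<open>Characters separate points\<close>

text \<open>\<psi> x is a Fourier coefficient of v \<mapsto> f (x + \<sigma> v - a1) on (Z/N)^S,
  hence an average of translates of f with unimodular weights. So it inherits the bound and the
  modulus of continuity of f, and replacing x by x + s amounts to shifting v by a unit vector, which
  multiplies \<psi> by a unimodular number up to carries. The constant c depends on f and x0 but not
  on S or \<epsilon>, so it survives a limit.\<close>

lemma approximate_eigenfunctions:
  fixes f :: "'a::topological_ab_group_add \<Rightarrow> real"
  assumes K: "compact (UNIV :: 'a set)" and f: "continuous_on UNIV f"
    and f01: "\<And>x. 0 \<le> f x" "\<And>x. f x \<le> 1" and f0: "f 0 = 1" and fx0: "f x0 = 0"
  obtains c where "c > 0"
    "\<And>S \<epsilon>. finite S \<Longrightarrow> \<epsilon> > 0 \<Longrightarrow> \<exists>\<psi> z. (\<forall>x. cmod (\<psi> x) \<le> 1)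
      \<and> (\<forall>x x' \<delta>. (\<forall>y. \<bar>f (x + y) - f (x' + y)\<bar> \<le> \<delta>) \<longrightarrow> cmod (\<psi> x - \<psi> x') \<le> \<delta>)
      \<and> (\<forall>s. cmod (z s) = 1) \<and> (\<forall>s\<in>S. \<forall>x. cmod (\<psi> (x + s) - z s * \<psi> x) \<le> \<epsilon>)
      \<and> cmod (\<psi> 0 - \<psi> x0) \<ge> c"
proof -
  \<comment> \<open>The coefficient of k is the difference \<psi> 0 - \<psi> x0, so a large
    coefficient of k separates 0 from x0.\<close>
  define k where "k x = f x - f (x + x0)" for x
  have k: "continuous_on UNIV k"
    unfolding k_def by (intro continuous_intros f continuous_on_compose2[OF f]) auto
  have k1: "\<bar>k x\<bar> \<le> 1" for x using f01[of x] f01[of "x + x0"] by (simp add: k_def abs_le_iff)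
  have k0: "k 0 = 1" by (simp add: k_def f0 fx0)
  obtain W1 where W1: "open W1" "0 \<in> W1" "\<And>x y. y - x \<in> W1 \<Longrightarrow> dist (k y) (k x) < 1/2"
    by (fact uniform_nhd[OF K k half_gt_zero[OF zero_less_one]])
  have W1k: "k w \<ge> 1/2" if "w \<in> W1" for w
  proof -
    have "\<bar>k w - k 0\<bar> < 1/2" using W1(3)[of w 0] that by (simp add: dist_real_def)
    then show ?thesis using k0 by linarith
  qed
  obtain A1 where A1: "finite A1" "A1 \<noteq> {}" "\<And>x. \<exists>a\<in>A1. x - a \<in> W1"
    by (fact finite_translates[OF K W1(1,2)])
  \<comment> \<open>Some translate of W1 catches at least a fraction 1 / card A1 of the digit
    vectors; after the shift by its centre a1, k is at least 1/2 there, so the squared modulus of h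
    is at least 1/4.\<close>
  define \<beta> where "\<beta> = 1 / (4 * real (card A1))"
  have A1pos: "card A1 > 0" using A1 by (simp add: card_gt_0_iff)
  have \<beta>: "0 < \<beta>" "\<beta> \<le> 1/4" using A1pos by (auto simp: \<beta>_def field_simps)
  obtain W2 where W2: "open W2" "0 \<in> W2" "\<And>x y. y - x \<in> W2 \<Longrightarrow> dist (k y) (k x) < \<beta>/2"
    by (fact uniform_nhd[OF K k half_gt_zero[OF \<beta>(1)]])
  obtain A2 where A2: "finite A2" "A2 \<noteq> {}" "\<And>x. \<exists>a\<in>A2. x - a \<in> W2"
    by (fact finite_translates[OF K W2(1,2)])
  define m where "m = card A2"
  have m: "m > 0" using A2 by (simp add: m_def card_gt_0_iff)
  \<comment> \<open>If all coefficients were at most c * card A,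
    \<open>large_fourier_coefficient\<close> with \<eta> = \<beta> would give \<beta> - \<beta>^2
    \<le> 2 * c * sqrt m = \<beta> / 4, impossible for 0 < \<beta> \<le> 1/4.\<close>
  define c where "c = \<beta> / (8 * sqrt m)"
  have c: "c > 0" using \<beta> m by (simp add: c_def)
  show ?thesis
  proof (rule that[OF c])
    fix S :: "'a set" and \<epsilon> :: real
    assume S: "finite S" and \<epsilon>: "\<epsilon> > 0"
    obtain W3 where W3: "open W3" "0 \<in> W3" "\<And>x y. y - x \<in> W3 \<Longrightarrow> dist (f y) (f x) < \<epsilon>"
      by (fact uniform_nhd[OF K f \<epsilon>])
    have "open (W2 \<inter> W3)" "0 \<in> W2 \<inter> W3" using W2(1,2) W3(1,2) by auto
    from nhd_sum[OF this, of "card S", where 'b = 'a]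
    obtain U where U: "open U" "0 \<in> U"
      "\<And>R (g::'a \<Rightarrow> 'a). finite R \<Longrightarrow> card R \<le> card S \<Longrightarrow> (\<forall>i\<in>R. g i \<in> U) \<Longrightarrow> sum g R \<in> W2 \<inter> W3"
      by blast
    obtain N where N: "N \<ge> 2" "\<And>s. s \<in> S \<Longrightarrow> nmul N s \<in> U"
      by (fact simultaneous_recurrence[OF K U(1,2) S])
    have N0: "N > 0" using N by simp
    define A where "A = box S N"
    define Q where "Q = real (card A)"
    have finA: "finite A" using finite_box[OF S] by (simp add: A_def)
    have Q: "Q > 0" using S N0 by (simp add: Q_def A_def card_box)
    have neA: "A \<noteq> {}" using Q by (auto simp: Q_def)
    define \<sigma> where "\<sigma> = box_map S"
    define \<tau> where "\<tau> = box_shift S N"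
    define e where "e = box_char S N"
    have norm_e: "cmod (e \<xi> v) = 1" for \<xi> v by (simp add: e_def norm_box_char)
    have e_shift: "e \<xi> (\<tau> u v) = e \<xi> u * e \<xi> v" for \<xi> u v
      by (simp add: e_def \<tau>_def box_char_shift N0)
    have bij: "bij_betw (\<tau> u) A A" if "u \<in> A" for u
      using bij_box_shift[OF S N0] that by (simp add: A_def \<tau>_def)
    have err: "\<exists>w\<in>W2 \<inter> W3. \<sigma> v + \<sigma> u = \<sigma> (\<tau> u v) + w" if uv: "u \<in> A" "v \<in> A" for u v
    proof -
      obtain R where R: "R \<subseteq> S" "box_map S v + box_map S u = box_map S (box_shift S N u v) + (\<Sum>s\<in>R. nmul N s)"
        using box_map_add[OF S, of u N v] uv by (auto simp: A_def)
      have "(\<Sum>s\<in>R. nmul N s) \<in> W2 \<inter> W3"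
        using R(1) S N(2) by (intro U(3)) (auto intro: finite_subset card_mono)
      then show ?thesis using R(2) by (auto simp: \<sigma>_def \<tau>_def)
    qed
    obtain a1 where a1: "a1 \<in> A1" "card A \<le> card A1 * card {v \<in> A. \<sigma> v - a1 \<in> W1}"
      by (rule pigeonhole_cover[OF finA A1(1), of "\<lambda>a v. \<sigma> v - a \<in> W1"]) (use A1 in auto)
    obtain a2 where a2: "a2 \<in> A2" "card A \<le> card A2 * card {v \<in> A. \<sigma> v - a2 \<in> W2}"
      by (rule pigeonhole_cover[OF finA A2(1), of "\<lambda>a v. \<sigma> v - a \<in> W2"]) (use A2 in auto)
    define h where "h v = complex_of_real (k (\<sigma> v - a1))" for v
    \<comment> \<open>All u in P have \<sigma> u close to a2, so this one function approximates
      every shift of h by such u: one \<beta>/2 pays for replacing \<sigma> u by a2, the other for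
      the carries.\<close>
    define h' where "h' v = complex_of_real (k (\<sigma> v + a2 - a1))" for v
    have large: "\<beta> * card A \<le> (\<Sum>v\<in>A. (cmod (h v))\<^sup>2)"
    proof -
      let ?P = "{v \<in> A. \<sigma> v - a1 \<in> W1}"
      have "real (card A) \<le> real (card A1) * real (card ?P)" using a1(2) by (metis of_nat_le_iff of_nat_mult)
      then have "\<beta> * card A \<le> card ?P * (1/4)"
        using A1pos by (simp add: \<beta>_def field_simps)
      also have "\<dots> = (\<Sum>v\<in>?P. 1/4)" by simp
      also have "\<dots> \<le> (\<Sum>v\<in>?P. (cmod (h v))\<^sup>2)"
      proof (rule sum_mono)
        fix v assume "v \<in> ?P"
        then have "1/2 \<le> cmod (h v)" using W1k by (force simp: h_def)
        then have "(1/2)\<^sup>2 \<le> (cmod (h v))\<^sup>2" by (intro power_mono) auto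
        then show "1/4 \<le> (cmod (h v))\<^sup>2" by (simp add: power2_eq_square)
      qed
      also have "\<dots> \<le> (\<Sum>v\<in>A. (cmod (h v))\<^sup>2)" using finA by (intro sum_mono2) auto
      finally show ?thesis .
    qed
    have near: "cmod (h' v - h (\<tau> u v)) \<le> \<beta>" if u: "u \<in> {v \<in> A. \<sigma> v - a2 \<in> W2}" and v: "v \<in> A" for u v
    proof -
      obtain w where w: "w \<in> W2" "\<sigma> v + \<sigma> u = \<sigma> (\<tau> u v) + w" using err u v by blast
      have "(\<sigma> v + \<sigma> u - a1) - (\<sigma> v + a2 - a1) \<in> W2" using u by simp
      then have 1: "dist (k (\<sigma> v + \<sigma> u - a1)) (k (\<sigma> v + a2 - a1)) < \<beta>/2" by (rule W2(3))
      have "(\<sigma> v + \<sigma> u - a1) - (\<sigma> (\<tau> u v) - a1) \<in> W2" using w by simp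
      then have 2: "dist (k (\<sigma> v + \<sigma> u - a1)) (k (\<sigma> (\<tau> u v) - a1)) < \<beta>/2" by (rule W2(3))
      have "cmod (h' v - h (\<tau> u v)) = \<bar>k (\<sigma> v + a2 - a1) - k (\<sigma> (\<tau> u v) - a1)\<bar>"
        unfolding h_def h'_def of_real_diff[symmetric] norm_of_real ..
      then show ?thesis using 1 2 unfolding dist_real_def by linarith
    qed
    have "\<exists>\<xi>\<in>A. cmod (\<Sum>v\<in>A. h v * cnj (e \<xi> v)) > c * card A"
    proof (rule ccontr)
      assume "\<not> ?thesis"
      then have small: "cmod (\<Sum>v\<in>A. h v * cnj (e \<xi> v)) \<le> c * card A" if "\<xi> \<in> A" for \<xi> using that by force
      have "\<beta> - \<beta>\<^sup>2 \<le> 2 * c * sqrt m"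
      proof (rule large_fourier_coefficient[where e = e and h = h and h' = h' and \<tau> = \<tau>, OF finA neA finA])
        show "{v \<in> A. \<sigma> v - a2 \<in> W2} \<subseteq> A" by auto
        show "card A \<le> m * card {v \<in> A. \<sigma> v - a2 \<in> W2}" using a2 by (simp add: m_def)
        fix v w assume "v \<in> A" "w \<in> A"
        then show "(\<Sum>\<xi>\<in>A. e \<xi> v * cnj (e \<xi> w)) = (if v = w then complex_of_real (card A) else 0)"
          using box_char_orth[OF S N0] by (simp add: A_def e_def)
      next
        fix v show "cmod (h' v) \<le> 1" using k1 by (simp add: h'_def)
      qed (use norm_e bij e_shift near large small c \<beta> in auto)
      also have "2 * c * sqrt m = \<beta> / 4" using m by (simp add: c_def)
      finally have "\<beta> * (3/4 - \<beta>) \<le> 0" by (simp add: power2_eq_square algebra_simps)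
      then show False using \<beta> by (simp add: mult_le_0_iff)
    qed
    then obtain \<xi> where \<xi>: "\<xi> \<in> A" "cmod (\<Sum>v\<in>A. h v * cnj (e \<xi> v)) > c * Q" by (auto simp: Q_def)
    define \<Psi> where "\<Psi> x = (\<Sum>v\<in>A. complex_of_real (f (x + (\<sigma> v - a1))) * cnj (e \<xi> v))" for x
    define \<psi> where "\<psi> x = \<Psi> x / Q" for x
    have avg: "cmod (\<Sum>v\<in>A. complex_of_real (g v) * d v) / Q \<le> \<delta>"
      if "\<And>v. v \<in> A \<Longrightarrow> \<bar>g v\<bar> \<le> \<delta>" "\<And>v. v \<in> A \<Longrightarrow> cmod (d v) = 1" for g d \<delta>
    proof -
      have "cmod (\<Sum>v\<in>A. complex_of_real (g v) * d v) \<le> (\<Sum>v\<in>A. \<delta>)"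
        using that by (intro order_trans[OF norm_sum] sum_mono) (simp add: norm_mult)
      then show ?thesis using Q by (simp add: Q_def field_simps)
    qed
    have bound: "cmod (\<psi> x) \<le> 1" for x
    proof -
      have "cmod (\<Psi> x) / Q \<le> 1"
        unfolding \<Psi>_def by (rule avg) (simp_all add: norm_e f01)
      then show ?thesis using Q by (simp add: \<psi>_def norm_divide)
    qed
    have modulus: "cmod (\<psi> x - \<psi> x') \<le> \<delta>" if "\<forall>y. \<bar>f (x + y) - f (x' + y)\<bar> \<le> \<delta>" for x x' \<delta>
    proof -
      have "\<psi> x - \<psi> x' = (\<Sum>v\<in>A. complex_of_real (f (x + (\<sigma> v - a1)) - f (x' + (\<sigma> v - a1))) * cnj (e \<xi> v)) / Q"
        by (simp add: \<psi>_def \<Psi>_def diff_divide_distrib sum_subtractf left_diff_distrib)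
      moreover have "cmod (\<Sum>v\<in>A. complex_of_real (f (x + (\<sigma> v - a1)) - f (x' + (\<sigma> v - a1))) * cnj (e \<xi> v)) / Q \<le> \<delta>"
        by (rule avg) (use that in \<open>simp_all add: norm_e\<close>)
      ultimately show ?thesis using Q by (simp only: norm_divide norm_of_real abs_of_pos)
    qed
    define unit where "unit s = (\<lambda>t\<in>S. if t = s then 1 else 0 :: nat)" for s
    define z where "z s = e \<xi> (unit s)" for s
    have equi: "cmod (\<psi> (x + s) - z s * \<psi> x) \<le> \<epsilon>" if s: "s \<in> S" for s x
    proof -
      have uA: "unit s \<in> A" using N(1) by (auto simp: unit_def A_def box_def)
      have us: "\<sigma> (unit s) = s"
      proof -
        have "\<sigma> (unit s) = (\<Sum>t\<in>S. if t = s then s else 0)"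
          unfolding \<sigma>_def box_map_def unit_def by (intro sum.cong) auto
        then show ?thesis using s S by simp
      qed
      have "z s * \<Psi> x = (\<Sum>v\<in>A. z s * (complex_of_real (f (x + (\<sigma> v - a1))) * cnj (e \<xi> v)))"
        by (simp add: \<Psi>_def sum_distrib_left)
      also have "\<dots> = (\<Sum>v\<in>A. z s * (complex_of_real (f (x + (\<sigma> (\<tau> (unit s) v) - a1))) * cnj (e \<xi> (\<tau> (unit s) v))))"
        by (rule sum.reindex_bij_betw[OF bij[OF uA], symmetric])
      also have "\<dots> = (\<Sum>v\<in>A. complex_of_real (f (x + (\<sigma> (\<tau> (unit s) v) - a1))) * cnj (e \<xi> v))"
      proof (rule sum.cong[OF refl])
        fix v
        have "z s * cnj (z s) = 1" using norm_e by (simp add: complex_norm_square[symmetric] z_def)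
        then show "z s * (complex_of_real (f (x + (\<sigma> (\<tau> (unit s) v) - a1))) * cnj (e \<xi> (\<tau> (unit s) v)))
          = complex_of_real (f (x + (\<sigma> (\<tau> (unit s) v) - a1))) * cnj (e \<xi> v)"
          unfolding e_shift z_def[symmetric]
          using arg_cong[where f = "\<lambda>d. d * (complex_of_real (f (x + (\<sigma> (\<tau> (unit s) v) - a1))) * cnj (e \<xi> v))",
              of "z s * cnj (z s)" 1]
          by (simp add: mult_ac)
      qed
      finally have "\<psi> (x + s) - z s * \<psi> x =
        (\<Sum>v\<in>A. complex_of_real (f (x + s + (\<sigma> v - a1)) - f (x + (\<sigma> (\<tau> (unit s) v) - a1))) * cnj (e \<xi> v)) / Q"
        by (simp add: \<psi>_def \<Psi>_def diff_divide_distrib sum_subtractf left_diff_distrib)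
      moreover have "\<bar>f (x + s + (\<sigma> v - a1)) - f (x + (\<sigma> (\<tau> (unit s) v) - a1))\<bar> \<le> \<epsilon>" if vA: "v \<in> A" for v
      proof -
        obtain w where w: "w \<in> W3" "\<sigma> v + \<sigma> (unit s) = \<sigma> (\<tau> (unit s) v) + w" using err[OF uA vA] by blast
        have "(x + s + (\<sigma> v - a1)) - (x + (\<sigma> (\<tau> (unit s) v) - a1)) = w"
          using w(2) us by (simp add: algebra_simps)
        then have "dist (f (x + s + (\<sigma> v - a1))) (f (x + (\<sigma> (\<tau> (unit s) v) - a1))) < \<epsilon>"
          using w(1) by (intro W3(3)) simp
        then show ?thesis by (simp add: dist_real_def)
      qed
      then have "cmod (\<Sum>v\<in>A. complex_of_real (f (x + s + (\<sigma> v - a1)) - f (x + (\<sigma> (\<tau> (unit s) v) - a1))) * cnj (e \<xi> v)) / Q \<le> \<epsilon>"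
        by (rule avg) (simp_all add: norm_e)
      ultimately show ?thesis using Q by (simp only: norm_divide norm_of_real abs_of_pos)
    qed
    have "\<psi> 0 - \<psi> x0 = (\<Sum>v\<in>A. h v * cnj (e \<xi> v)) / Q"
      by (simp add: \<psi>_def \<Psi>_def h_def k_def diff_divide_distrib[symmetric] sum_subtractf[symmetric]
          left_diff_distrib[symmetric] add.commute)
    then have "cmod (\<psi> 0 - \<psi> x0) = cmod (\<Sum>v\<in>A. h v * cnj (e \<xi> v)) / Q"
      using Q by (simp only: norm_divide norm_of_real abs_of_pos)
    then have sep: "cmod (\<psi> 0 - \<psi> x0) \<ge> c"
      using \<xi>(2) Q by (simp add: pos_le_divide_eq)
    show "\<exists>\<psi> z. (\<forall>x. cmod (\<psi> x) \<le> 1)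
      \<and> (\<forall>x x' \<delta>. (\<forall>y. \<bar>f (x + y) - f (x' + y)\<bar> \<le> \<delta>) \<longrightarrow> cmod (\<psi> x - \<psi> x') \<le> \<delta>)
      \<and> (\<forall>s. cmod (z s) = 1) \<and> (\<forall>s\<in>S. \<forall>x. cmod (\<psi> (x + s) - z s * \<psi> x) \<le> \<epsilon>)
      \<and> cmod (\<psi> 0 - \<psi> x0) \<ge> c"
      using bound modulus equi sep by (intro exI[of _ \<psi>] exI[of _ z]) (auto simp: z_def norm_e)
  qed
qed

definition character :: "('a::topological_ab_group_add \<Rightarrow> complex) \<Rightarrow> bool" where
  "character \<gamma> \<longleftrightarrow> continuous_on UNIV \<gamma> \<and> (\<forall>x y. \<gamma> (x + y) = \<gamma> x * \<gamma> y) \<and> (\<forall>x. cmod (\<gamma> x) = 1)"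

lemma compact_pointwise_bounded:
  "compact {F :: 'i \<Rightarrow> 'b::t2_space. \<forall>i. F i \<in> C i}" if "\<And>i. compact (C i)"
proof -
  have "compactin (product_topology (\<lambda>i. euclidean) UNIV) (PiE UNIV C)"
    using that by (simp add: compactin_PiE)
  moreover have "PiE UNIV C = {F. \<forall>i. F i \<in> C i}" by auto
  ultimately show ?thesis by (simp add: euclidean_product_topology)
qed

lemma closed_coordinate_le:
  fixes g :: "('i \<Rightarrow> 'b::topological_space) \<Rightarrow> real"
  assumes "continuous_on UNIV g" shows "closed {F. g F \<le> c}"
  by (rule closed_Collect_le[OF assms continuous_on_const])

text \<open>Pairs (\<psi>, z) of an approximate eigenfunction and its multipliers form closed
  subsets of a product of discs and circles. The finite intersection property yields an exact pair
  with \<psi> (x + s) = z s * \<psi> x, and the bound c keeps \<psi> 0 and \<psi> x0 apart. Then z =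
  \<psi> / \<psi> 0 is multiplicative. Its continuity comes from \<psi>, whose modulus of continuity
  is controlled by f throughout the limit.\<close>

theorem characters_separate_points:
  fixes x0 :: "'a::{topological_ab_group_add, t2_space}"
  assumes K: "compact (UNIV :: 'a set)" and x0: "x0 \<noteq> 0"
  obtains \<gamma> where "character \<gamma>" "\<gamma> x0 \<noteq> 1"
proof -
  have "normal_space (euclidean :: 'a topology)"
    using Hausdorff_euclidean_t2 K
    by (intro compact_Hausdorff_or_regular_imp_normal_space) (auto simp: compact_space_def)
  then obtain f :: "'a \<Rightarrow> real" where f: "continuous_map euclidean (top_of_set {0..1}) f"
      "f ` {x0} \<subseteq> {0}" "f ` {0} \<subseteq> {1}"
    by (rule Urysohn_lemma[of _ "{x0}" "{0}" 0 1]) (use x0 in auto)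
  have cf: "continuous_on UNIV f" and f01: "\<And>x. 0 \<le> f x" "\<And>x. f x \<le> 1" and f0: "f 0 = 1" "f x0 = 0"
    using f by (auto simp: continuous_map_in_subtopology image_subset_iff Pi_iff)
  obtain c where c: "c > 0"
    "\<And>S \<epsilon>. finite S \<Longrightarrow> \<epsilon> > 0 \<Longrightarrow> \<exists>\<psi> z. (\<forall>x. cmod (\<psi> x) \<le> 1)
      \<and> (\<forall>x x' \<delta>. (\<forall>y. \<bar>f (x + y) - f (x' + y)\<bar> \<le> \<delta>) \<longrightarrow> cmod (\<psi> x - \<psi> x') \<le> \<delta>)
      \<and> (\<forall>s. cmod (z s) = 1) \<and> (\<forall>s\<in>S. \<forall>x. cmod (\<psi> (x + s) - z s * \<psi> x) \<le> \<epsilon>)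
      \<and> cmod (\<psi> 0 - \<psi> x0) \<ge> c"
    by (fact approximate_eigenfunctions[OF K cf f01 f0])
  define \<C> where "\<C> = {F :: 'a \<Rightarrow> complex \<times> complex. \<forall>x. F x \<in> cball 0 1 \<times> sphere 0 1}"
  have comp: "compact \<C>"
    unfolding \<C>_def by (rule compact_pointwise_bounded) (intro compact_Times compact_cball compact_sphere)
  define B where "B = {F :: 'a \<Rightarrow> complex \<times> complex.
    (\<forall>x x' \<delta>. (\<forall>y. \<bar>f (x + y) - f (x' + y)\<bar> \<le> \<delta>) \<longrightarrow> cmod (fst (F x) - fst (F x')) \<le> \<delta>) \<and>
    cmod (fst (F 0) - fst (F x0)) \<ge> c}"
  define E where "E = (\<lambda>(s, n). {F :: 'a \<Rightarrow> complex \<times> complex.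
    \<forall>x. cmod (fst (F (x + s)) - snd (F s) * fst (F x)) \<le> inverse (Suc n)})"
  have coord: "continuous_on UNIV (\<lambda>F :: 'a \<Rightarrow> complex \<times> complex. F x)" for x
    by simp
  have clB: "closed B"
  proof -
    have "B = (\<Inter>p\<in>{(x, x', \<delta>). \<forall>y. \<bar>f (x + y) - f (x' + y)\<bar> \<le> \<delta>}.
        {F. cmod (fst (F (fst p)) - fst (F (fst (snd p)))) \<le> snd (snd p)})
        \<inter> {F. - cmod (fst (F 0) - fst (F x0)) \<le> - c}"
      unfolding B_def by force
    also have "closed \<dots>"
      by (intro closed_Int closed_INT ballI closed_coordinate_le continuous_intros coord)
    finally show ?thesis .
  qed
  have clE: "closed (E p)" for p
  proof (cases p)
    case (Pair s n)
    have "E p = (\<Inter>x. {F. cmod (fst (F (x + s)) - snd (F s) * fst (F x)) \<le> inverse (Suc n)})"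
      unfolding E_def Pair by auto
    also have "closed \<dots>"
      by (intro closed_INT ballI closed_coordinate_le continuous_intros coord)
    finally show ?thesis .
  qed
  have "(\<C> \<inter> B) \<inter> (\<Inter>p\<in>UNIV. E p) \<noteq> {}"
  proof (rule compact_imp_fip_image)
    show "compact (\<C> \<inter> B)" using comp clB by (rule compact_Int_closed)
    fix I :: "('a \<times> nat) set" assume I: "finite I" "I \<subseteq> UNIV"
    define n where "n = Max (insert 0 (snd ` I))"
    obtain \<psi> z where \<psi>: "\<forall>x. cmod (\<psi> x) \<le> 1"
        "\<forall>x x' \<delta>. (\<forall>y. \<bar>f (x + y) - f (x' + y)\<bar> \<le> \<delta>) \<longrightarrow> cmod (\<psi> x - \<psi> x') \<le> \<delta>"
        "\<forall>s. cmod (z s) = 1" "\<forall>s\<in>fst ` I. \<forall>x. cmod (\<psi> (x + s) - z s * \<psi> x) \<le> inverse (Suc n)"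
        "cmod (\<psi> 0 - \<psi> x0) \<ge> c"
      using c(2)[of "fst ` I" "inverse (Suc n)"] I(1) by auto
    have "(\<lambda>x. (\<psi> x, z x)) \<in> E p" if p: "p \<in> I" for p
    proof (cases p)
      case (Pair s k)
      have "k \<le> n" unfolding n_def using I(1) p Pair by (intro Max_ge) (auto intro!: image_eqI[of _ snd p])
      then have "inverse (real (Suc n)) \<le> inverse (real (Suc k))" by simp
      moreover have "\<forall>x. cmod (\<psi> (x + s) - z s * \<psi> x) \<le> inverse (Suc n)"
        using \<psi>(4) p Pair by force
      ultimately show ?thesis unfolding E_def Pair by (auto intro: order_trans)
    qed
    moreover have "(\<lambda>x. (\<psi> x, z x)) \<in> \<C>" using \<psi>(1,3) by (simp add: \<C>_def)
    moreover have "(\<lambda>x. (\<psi> x, z x)) \<in> B" using \<psi>(2,5) by (simp add: B_def)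
    ultimately show "(\<C> \<inter> B) \<inter> (\<Inter>p\<in>I. E p) \<noteq> {}" by blast
  qed (use clE in auto)
  then obtain F where F: "F \<in> \<C>" "F \<in> B" "\<And>p. F \<in> E p" by auto
  define \<psi> where "\<psi> x = fst (F x)" for x
  define z where "z x = snd (F x)" for x
  have norm_z: "cmod (z s) = 1" for s
  proof -
    have "F s \<in> cball 0 1 \<times> sphere 0 1" using F(1) unfolding \<C>_def by simp
    then show ?thesis by (simp add: z_def mem_Times_iff)
  qed
  have eig: "\<psi> (x + s) = z s * \<psi> x" for x s
  proof -
    have "cmod (\<psi> (x + s) - z s * \<psi> x) \<le> inverse (Suc n)" for n
      using F(3)[of "(s, n)"] by (simp add: E_def \<psi>_def z_def)
    then have "cmod (\<psi> (x + s) - z s * \<psi> x) \<le> 0"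
      by (meson not_le reals_Archimedean)
    then show ?thesis by simp
  qed
  have sep: "\<psi> 0 \<noteq> \<psi> x0" using F(2) c(1) by (auto simp: B_def \<psi>_def)
  have \<psi>z: "\<psi> s = z s * \<psi> 0" for s using eig[of 0 s] by simp
  have \<psi>0: "\<psi> 0 \<noteq> 0" using sep \<psi>z[of x0] by auto
  have "z (s + t) = z s * z t" for s t
    using eig[of s t] \<psi>z[of "s + t"] \<psi>z[of s] \<psi>0 by simp
  moreover have "continuous_on UNIV z"
  proof -
    have "continuous_on UNIV \<psi>"
      unfolding continuous_on_topological
    proof (intro ballI allI impI)
      fix x V assume V: "open V" "\<psi> x \<in> V"
      then obtain d where d: "d > 0" "ball (\<psi> x) d \<subseteq> V" by (meson open_contains_ball)
      obtain W where W: "open W" "0 \<in> W" "\<And>x y. y - x \<in> W \<Longrightarrow> dist (f y) (f x) < d/2"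
        by (fact uniform_nhd[OF K cf half_gt_zero[OF d(1)]])
      have "\<psi> y \<in> V" if y: "y - x \<in> W" for y
      proof -
        have "\<bar>f (y + u) - f (x + u)\<bar> \<le> d/2" for u
          using W(3)[of "y + u" "x + u"] y by (simp add: dist_real_def)
        then have "cmod (\<psi> y - \<psi> x) \<le> d/2" using F(2) unfolding B_def \<psi>_def by blast
        then have "\<psi> y \<in> ball (\<psi> x) d" using d(1) by (simp add: dist_norm norm_minus_commute)
        then show ?thesis using d(2) by auto
      qed
      then show "\<exists>A. open A \<and> x \<in> A \<and> (\<forall>y\<in>UNIV. y \<in> A \<longrightarrow> \<psi> y \<in> V)"
        using open_translate[OF W(1), of x] W(2) by (intro exI[of _ "{y. y - x \<in> W}"]) auto
    qed
    then have "continuous_on UNIV (\<lambda>x. \<psi> x / \<psi> 0)" using \<psi>0 by (intro continuous_intros) auto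
    moreover have "(\<lambda>x. \<psi> x / \<psi> 0) = z" 
    proof
      fix s show "\<psi> s / \<psi> 0 = z s"
        unfolding \<psi>z[of s] using \<psi>0 by (rule nonzero_mult_div_cancel_right)
    qed
    ultimately show ?thesis by (rule back_subst[where P = "continuous_on UNIV"])
  qed
  ultimately have "character z" using norm_z by (simp add: character_def)
  moreover have "z x0 \<noteq> 1" using sep \<psi>z[of x0] by auto
  ultimately show ?thesis by (rule that)
qed


subsection \<open>Annihilators and totally disconnected subgroups\<close>

lemma character_add: "character \<gamma> \<Longrightarrow> \<gamma> (x + y) = \<gamma> x * \<gamma> y"
  and character_norm: "character \<gamma> \<Longrightarrow> cmod (\<gamma> x) = 1"
  and character_cont: "character \<gamma> \<Longrightarrow> continuous_on UNIV \<gamma>"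
  by (auto simp: character_def)

lemma character_nz: "character \<gamma> \<Longrightarrow> \<gamma> x \<noteq> 0"
  using character_norm[of \<gamma> x] by auto

lemma character_0: "character \<gamma> \<Longrightarrow> \<gamma> 0 = 1"
  using character_add[of \<gamma> 0 0] character_nz[of \<gamma> 0] by simp

lemma character_minus: "character \<gamma> \<Longrightarrow> \<gamma> (- x) = inverse (\<gamma> x)"
  using character_add[of \<gamma> x "- x"] character_0[of \<gamma>] character_nz[of \<gamma> x]
  by (simp add: inverse_unique)

lemma character_diff: "character \<gamma> \<Longrightarrow> \<gamma> (x - y) = \<gamma> x / \<gamma> y"
  using character_add[of \<gamma> x "- y"] by (simp add: character_minus divide_inverse)

lemma character_nmul: "character \<gamma> \<Longrightarrow> \<gamma> (nmul n x) = \<gamma> x ^ n"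
  by (induction n) (simp_all add: character_0 character_add)

lemma character_power: "character \<gamma> \<Longrightarrow> character (\<lambda>x. \<gamma> x ^ n)"
  by (auto simp: character_def norm_power power_mult_distrib intro!: continuous_intros)

definition annih :: "('a::topological_ab_group_add \<Rightarrow> complex) set \<Rightarrow> 'a set" where
  "annih F = {x. \<forall>\<gamma>\<in>F. \<gamma> x = 1}"

lemma subgrp_annih: "(\<And>\<gamma>. \<gamma> \<in> F \<Longrightarrow> character \<gamma>) \<Longrightarrow> subgrp (annih F)"
  by (auto simp: subgrp_def annih_def character_0 character_add character_minus)

lemma annih_Un: "annih (F \<union> F') = annih F \<inter> annih F'"
  by (auto simp: annih_def)

lemma closed_character_eq: "character \<gamma> \<Longrightarrow> closed {x. \<gamma> x = c}"
  by (intro closed_Collect_eq character_cont continuous_on_const)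

lemma open_character_Re: "character \<gamma> \<Longrightarrow> open {x. 0 < Re (\<gamma> x)}"
  by (intro open_Collect_less continuous_intros character_cont)

lemma closed_annih:
  assumes "\<And>\<gamma>. \<gamma> \<in> F \<Longrightarrow> character \<gamma>" shows "closed (annih F)"
proof -
  have "annih F = (\<Inter>\<gamma>\<in>F. {x. \<gamma> x = 1})" by (auto simp: annih_def)
  then show ?thesis using assms by (auto intro!: closed_INT closed_character_eq)
qed

text \<open>The kernels of all characters meet only in 0, so finitely many of them already miss the
  compact complement of U.\<close>

lemma nhd_contains_annih:
  fixes U :: "'a::{topological_ab_group_add, t2_space} set"
  assumes K: "compact (UNIV :: 'a set)" and U: "open U" "0 \<in> U"
  obtains F where "finite F" "\<And>\<gamma>. \<gamma> \<in> F \<Longrightarrow> character \<gamma>" "annih F \<subseteq> U"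
proof -
  have comp: "compact (- U)"
    using compact_Int_closed[OF K, of "- U"] U(1) by (simp add: closed_def)
  have empty: "- U \<inter> (\<Inter>\<gamma>\<in>Collect character. {x. \<gamma> x = 1}) = {}"
  proof -
    have "x \<in> U" if "\<And>\<gamma>. character \<gamma> \<Longrightarrow> \<gamma> x = 1" for x
    proof (rule ccontr)
      assume "x \<notin> U"
      then have "x \<noteq> 0" using U by auto
      then obtain \<gamma> where "character \<gamma>" "\<gamma> x \<noteq> 1" by (rule characters_separate_points[OF K])
      then show False using that by simp
    qed
    then show ?thesis by auto
  qed
  have "\<exists>F. finite F \<and> F \<subseteq> Collect character \<and> - U \<inter> (\<Inter>\<gamma>\<in>F. {x. \<gamma> x = 1}) = {}"
  proof (rule ccontr)
    assume neg: "\<not> ?thesis"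
    have "- U \<inter> (\<Inter>\<gamma>\<in>Collect character. {x. \<gamma> x = 1}) \<noteq> {}"
      by (rule compact_imp_fip_image[OF comp]) (use neg closed_character_eq in blast)+
    then show False using empty by simp
  qed
  then obtain F where F: "finite F" "F \<subseteq> Collect character" "- U \<inter> (\<Inter>\<gamma>\<in>F. {x. \<gamma> x = 1}) = {}"
    by blast
  show ?thesis
  proof (rule that[OF F(1)])
    show "character \<gamma>" if "\<gamma> \<in> F" for \<gamma> using F(2) that by auto
    show "annih F \<subseteq> U" using F(3) by (auto simp: annih_def)
  qed
qed

text \<open>The open right half-plane contains no nontrivial subgroup of the circle: squaring
  multiplies 1 - Re w by 2 * (1 + Re w), which exceeds 2, so repeated squaring would push this
  quantity beyond 1.\<close>

lemma unit_powers_Re_pos: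
  fixes z :: complex
  assumes z: "cmod z = 1" and pos: "\<And>k. 0 < Re (z ^ k)"
  shows "z = 1"
proof (rule ccontr)
  assume "z \<noteq> 1"
  have sq: "Re (w\<^sup>2) = 2 * (Re w)\<^sup>2 - 1" if "cmod w = 1" for w
    using that cmod_power2[of w] by (simp add: power2_eq_square)
  have "Re z < 1"
  proof -
    have "(Re z)\<^sup>2 + (Im z)\<^sup>2 = 1" using z cmod_power2[of z] by simp
    moreover have "Re z \<le> 1" using complex_Re_le_cmod[of z] z by simp
    moreover have "Re z \<noteq> 1"
    proof
      assume "Re z = 1"
      then show False using calculation(1) \<open>z \<noteq> 1\<close> by (simp add: complex_eq_iff)
    qed
    ultimately show ?thesis by simp
  qed
  define d where "d = 1 - Re z"
  have d: "d > 0" using \<open>Re z < 1\<close> by (simp add: d_def)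
  have grow: "1 - Re (z ^ (2 ^ n)) \<ge> 2 ^ n * d" for n
  proof (induction n)
    case (Suc n)
    let ?w = "z ^ (2 ^ n)"
    have w: "cmod ?w = 1" using z by (simp add: norm_power)
    have "z ^ (2 ^ Suc n) = ?w\<^sup>2" by (simp add: power_mult[symmetric] mult.commute)
    then have "1 - Re (z ^ (2 ^ Suc n)) = 2 * (1 - Re ?w) * (1 + Re ?w)"
      using sq[OF w] by (simp add: power2_eq_square algebra_simps)
    also have "\<dots> \<ge> 2 * (1 - Re ?w) * 1"
      using pos[of "2 ^ n"] complex_Re_le_cmod[of ?w] w by (intro mult_left_mono) auto
    finally show ?case using Suc by simp
  qed (simp add: d_def)
  obtain n :: nat where "1 / d < 2 ^ n" using real_arch_pow[of 2 "1/d"] by auto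
  then have "1 < 2 ^ n * d" using d by (simp add: field_simps)
  then show False using grow[of n] pos[of "2 ^ n"] by simp
qed

lemma character_trivial_on_subgrp:
  assumes "character \<gamma>" "subgrp S" "\<And>x. x \<in> S \<Longrightarrow> 0 < Re (\<gamma> x)" "x \<in> S"
  shows "\<gamma> x = 1"
proof (rule unit_powers_Re_pos)
  fix k
  have "nmul k x \<in> S" using assms by (intro subgrp_nmul)
  then show "0 < Re (\<gamma> x ^ k)" using assms(3)[of "nmul k x"] by (simp add: character_nmul assms(1))
qed (use assms character_norm in auto)

section \<open>Closed subgroups of the circle\<close>

lemma cmod_cis_diff_le: "cmod (cis a - cis b) \<le> \<bar>a - b\<bar>"
proof -
  have "cis a - cis b = cis b * (cis (a - b) - 1)" by (simp add: algebra_simps cis_mult)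
  then have "cmod (cis a - cis b) = cmod (cis (a - b) - 1)" by (simp add: norm_mult)
  also have "\<dots> \<le> \<bar>a - b\<bar>"
  proof (rule power2_le_imp_le)
    define t where "t = (a - b) / 2"
    have ab: "a - b = 2 * t" by (simp add: t_def)
    have "(cmod (cis (2 * t) - 1))\<^sup>2 = (cos (2 * t) - 1)\<^sup>2 + (sin (2 * t))\<^sup>2"
      by (simp add: cmod_power2)
    also have "\<dots> = 2 - 2 * cos (2 * t)"
      using sin_cos_squared_add[of "2 * t"] by (simp add: power2_eq_square algebra_simps)
    also have "\<dots> = (2 * sin t)\<^sup>2" by (simp add: cos_double_sin power_mult_distrib)
    also have "\<dots> \<le> \<bar>2 * t\<bar>\<^sup>2"
      using abs_sin_x_le_abs_x[of t] by (intro power2_le_iff_abs_le[THEN iffD2]) (auto simp: abs_mult)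
    finally show "(cmod (cis (a - b) - 1))\<^sup>2 \<le> \<bar>a - b\<bar>\<^sup>2" by (simp add: ab)
  qed auto
  finally show ?thesis .
qed

lemma cis_Arg_unit: "cmod z = 1 \<Longrightarrow> cis (Arg z) = z"
  by (metis cis_Arg norm_zero sgn_div_norm inverse_1 scaleR_one zero_neq_one)

lemma cis_multiples_dense:
  assumes "\<theta> \<noteq> 0" "cmod t = 1"
  obtains n :: nat where "cmod (cis (of_nat n * \<theta>) - t) \<le> \<bar>\<theta>\<bar>"
proof -
  \<comment> \<open>Whole turns are added to Arg t until the angle a has the sign of \<theta>; then
    a / \<theta> \<ge> 0 and its floor is a natural number.\<close>
  define m where "m = sgn \<theta> * of_int \<lceil>\<bar>Arg t\<bar>\<rceil>"
  define a where "a = Arg t + 2 * pi * m"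
  obtain j :: int where j: "m = of_int j"
    by (cases "\<theta> > 0") (use assms in \<open>auto simp: m_def sgn_if intro: that[of "\<lceil>\<bar>Arg t\<bar>\<rceil>"] that[of "- \<lceil>\<bar>Arg t\<bar>\<rceil>"]\<close>)
  have t: "cis a = t"
  proof -
    have "cis (2 * pi * m) = 1" unfolding j by (rule cis_multiple_2pi) simp
    then have "cis a = cis (Arg t)" by (simp add: a_def cis_mult[symmetric])
    also have "\<dots> = t" using assms(2) by (rule cis_Arg_unit)
    finally show ?thesis .
  qed
  have "0 \<le> a / \<theta>"
  proof -
    have le: "\<bar>Arg t\<bar> \<le> 2 * pi * of_int \<lceil>\<bar>Arg t\<bar>\<rceil>"
    proof -
      have "\<bar>Arg t\<bar> \<le> of_int \<lceil>\<bar>Arg t\<bar>\<rceil>" by simp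
      also have "\<dots> \<le> 2 * pi * of_int \<lceil>\<bar>Arg t\<bar>\<rceil>"
        using pi_ge_two by (intro mult_le_cancel_right1[THEN iffD2]) auto
      finally show ?thesis .
    qed
    show ?thesis
    proof (cases "\<theta> > 0")
      case True
      then have "a \<ge> 0" using le by (simp add: a_def m_def)
      then show ?thesis using True by simp
    next
      case False
      then have "a \<le> 0" using le assms(1) by (simp add: a_def m_def)
      then show ?thesis using False by (simp add: divide_nonpos_nonpos)
    qed
  qed
  define n where "n = nat \<lfloor>a / \<theta>\<rfloor>"
  have n: "real n = of_int \<lfloor>a / \<theta>\<rfloor>" using \<open>0 \<le> a / \<theta>\<close> by (simp add: n_def)
  have "\<bar>of_nat n - a / \<theta>\<bar> \<le> 1" unfolding n by linarith
  then have "\<bar>\<theta>\<bar> * \<bar>of_nat n - a / \<theta>\<bar> \<le> \<bar>\<theta>\<bar> * 1" by (intro mult_left_mono) auto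
  moreover have "\<bar>\<theta>\<bar> * \<bar>of_nat n - a / \<theta>\<bar> = \<bar>of_nat n * \<theta> - a\<bar>"
    using assms(1) by (simp add: abs_mult[symmetric] algebra_simps)
  ultimately have "cmod (cis (of_nat n * \<theta>) - cis a) \<le> \<bar>\<theta>\<bar>"
    using cmod_cis_diff_le[of "of_nat n * \<theta>" a] by linarith
  then show ?thesis using that t by simp
qed

text \<open>A nonzero angle below \<delta> in D would have multiples within \<delta> of the missing
  point t. By Dirichlet approximation each z in D has a power z^k with 0 < k \<le> N and angle below
  2 * pi / N < \<delta>, so z^k = 1, and N! is a common exponent.\<close>

lemma circle_subgroup_exponent:
  fixes D :: "complex set"
  assumes D: "closed D" "D \<subseteq> sphere 0 1" "\<And>z w. z \<in> D \<Longrightarrow> w \<in> D \<Longrightarrow> z * w \<in> D"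
    and one: "1 \<in> D" and t: "t \<in> sphere 0 1" "t \<notin> D"
  obtains q :: nat where "q > 0" "\<And>z. z \<in> D \<Longrightarrow> z ^ q = 1"
proof -
  have pow: "z ^ k \<in> D" if "z \<in> D" for z k by (induction k) (use D(3) one that in auto)
  obtain \<delta> where \<delta>: "\<delta> > 0" "ball t \<delta> \<subseteq> - D"
    using D(1) t(2) open_contains_ball[of "- D"] by (auto simp: open_Compl)
  have far: "\<theta> = 0" if "cis \<theta> \<in> D" "\<bar>\<theta>\<bar> < \<delta>" for \<theta>
  proof (rule ccontr)
    assume "\<theta> \<noteq> 0"
    then obtain n :: nat where "cmod (cis (of_nat n * \<theta>) - t) \<le> \<bar>\<theta>\<bar>"
      by (rule cis_multiples_dense) (use t(1) in auto)
    then have "cis (of_nat n * \<theta>) \<in> ball t \<delta>" using that(2) by (simp add: dist_norm norm_minus_commute)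
    moreover have "cis (of_nat n * \<theta>) \<in> D" using pow[OF that(1), of n] unfolding Complex.DeMoivre .
    ultimately show False using \<delta>(2) by auto
  qed
  obtain N :: nat where N: "N > 0" "2 * pi / N < \<delta>"
  proof -
    obtain N :: nat where "2 * pi / \<delta> < N" using reals_Archimedean2 by blast
    moreover have "0 < 2 * pi / \<delta>" using \<delta> by simp
    ultimately have "0 < real N" by linarith
    then show ?thesis using that[of N] \<open>2 * pi / \<delta> < N\<close> \<delta>(1) by (simp add: field_simps)
  qed
  show ?thesis
  proof (rule that[of "fact N"])
    fix z assume z: "z \<in> D"
    define \<alpha> where "\<alpha> = Arg z / (2 * pi)"
    have "cmod z = 1" using z D(2) by auto
    then have zc: "z = cis (2 * pi * \<alpha>)" by (simp add: \<alpha>_def cis_Arg_unit)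
    obtain h k where hk: "0 < k" "k \<le> int N" "\<bar>of_int k * \<alpha> - of_int h\<bar> < 1 / N"
      using Dirichlet_approx[OF N(1)] by metis
    define \<theta> where "\<theta> = 2 * pi * (of_int k * \<alpha> - of_int h)"
    have "cis \<theta> = cis (2 * pi * of_int k * \<alpha>) * cis (2 * pi * of_int (- h))"
      by (simp add: \<theta>_def cis_mult algebra_simps)
    also have "cis (2 * pi * of_int (- h)) = 1" by (rule cis_multiple_2pi) simp
    also have "cis (2 * pi * of_int k * \<alpha>) * 1 = z ^ nat k"
      unfolding zc Complex.DeMoivre using hk(1) by (simp add: mult_ac)
    finally have cz: "cis \<theta> = z ^ nat k" .
    have "\<bar>\<theta>\<bar> = 2 * pi * \<bar>of_int k * \<alpha> - of_int h\<bar>" by (simp add: \<theta>_def abs_mult)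
    also have "\<dots> < 2 * pi * (1 / N)" using hk(3) by (intro mult_strict_left_mono) auto
    finally have "\<bar>\<theta>\<bar> < \<delta>" using N(2) by simp
    then have "\<theta> = 0" using far pow[OF z] cz by metis
    then have "z ^ nat k = 1" using cz by simp
    moreover have "nat k dvd fact N" using hk by (intro dvd_fact) auto
    ultimately show "z ^ fact N = 1" by (metis dvdE power_mult power_one)
  qed simp
qed

section \<open>Total disconnectedness in terms of characters\<close>

text \<open>Each character of K has finite order on N, with one exponent for all points of N. For
  compact subgroups this is equivalent to total disconnectedness, by the next two lemmas.\<close>

definition torsion_dual :: "'a::topological_ab_group_add set \<Rightarrow> bool" where
  "torsion_dual N \<longleftrightarrow> (\<forall>\<gamma>. character \<gamma> \<longrightarrow> (\<exists>q>0. \<forall>x\<in>N. \<gamma> x ^ q = 1))"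

text \<open>A character maps a connected subset of N to a connected set of roots of unity of bounded
  order, hence to a point; and characters separate points.\<close>

lemma torsion_dual_imp_totally_disconn:
  fixes N :: "'a::{topological_ab_group_add, t2_space} set"
  assumes K: "compact (UNIV :: 'a set)" and N: "torsion_dual N"
  shows "totally_disconn N"
proof -
  have eq: "x = y" if C: "C \<subseteq> N" "connected C" "x \<in> C" "y \<in> C" for C x y
  proof (rule ccontr)
    assume "x \<noteq> y"
    then have "x - y \<noteq> 0" by simp
    then obtain \<gamma> where \<gamma>: "character \<gamma>" "\<gamma> (x - y) \<noteq> 1"
      by (rule characters_separate_points[OF K])
    obtain q where q: "q > 0" "\<forall>x\<in>N. \<gamma> x ^ q = 1" using N \<gamma>(1) by (auto simp: torsion_dual_def)
    have "connected (\<gamma> ` C)"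
      using C(2) character_cont[OF \<gamma>(1)] continuous_on_subset by (blast intro: connected_continuous_image)
    moreover have "finite (\<gamma> ` C)"
      by (rule finite_subset[OF _ finite_roots_unity[of q]]) (use q C in auto)
    ultimately obtain c where "\<gamma> ` C \<subseteq> {c}"
      using connected_finite_iff_sing[of "\<gamma> ` C"] by auto
    then have "\<gamma> x = \<gamma> y" using C by auto
    then show False using \<gamma> by (simp add: character_diff character_nz)
  qed
  show ?thesis
    unfolding totally_disconn_def
  proof (intro allI impI)
    fix C assume "C \<subseteq> N \<and> connected C"
    then show "\<exists>x. C \<subseteq> {x}" using eq[of C] by (metis all_not_in_conv empty_subsetI insertI1 subsetI)
  qed
qed

text \<open>The component of 0 is trivial, so some clopen B around 0 in N has Re \<gamma> > 0. With
  W a Lebesgue neighbourhood for B and its complement B', the multiples of an element of W in N can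
  never step from B to B', so \<gamma> is 1 on it. By compactness \<gamma> takes finitely many
  values on N, and these form a proper closed subgroup of the circle.\<close>

lemma totally_disconn_imp_torsion_dual:
  fixes N :: "'a::{topological_ab_group_add, t2_space} set"
  assumes N: "subgrp N" "compact N" and td: "totally_disconn N"
  shows "torsion_dual N"
  unfolding torsion_dual_def
proof (intro allI impI)
  fix \<gamma> :: "'a \<Rightarrow> complex" assume \<gamma>: "character \<gamma>"
  let ?X = "top_of_set N"
  have hd: "Hausdorff_space ?X"
    by (rule Hausdorff_space_subtopology[OF Hausdorff_euclidean_t2])
  have cs: "compact_space ?X" using N(2) by (simp add: compact_space_subtopology)
  have zN: "0 \<in> N" using N(1) by (rule subgrp_0)
  have comp0: "connected_component_of_set ?X 0 = {0}"
  proof -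
    let ?C = "connected_component_of_set ?X 0"
    have "connectedin ?X ?C" by (rule connectedin_connected_component_of)
    then have "?C \<subseteq> N" "connected ?C" by (simp_all add: connectedin_subtopology)
    then obtain x where "?C \<subseteq> {x}"
      using td[unfolded totally_disconn_def, rule_format, of ?C] by metis
    moreover have "0 \<in> ?C" using zN by (simp add: connected_component_of_refl)
    ultimately show ?thesis by auto
  qed
  obtain B B' where B: "openin ?X B" "openin ?X B'" "disjnt B B'" "B \<union> B' = topspace ?X"
      "{0} \<subseteq> B" "B \<subseteq> N \<inter> {x. 0 < Re (\<gamma> x)}"
  proof (rule wilder_locally_compact_component_thm[of ?X "{0}" "N \<inter> {x. 0 < Re (\<gamma> x)}"])
    show "locally_compact_space ?X" by (simp add: cs compact_imp_locally_compact_space)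
    show "{0} \<in> connected_components_of ?X"
      using zN comp0 by (auto simp: connected_components_of_def)
    show "compactin ?X {0}" using zN by simp
    show "openin ?X (N \<inter> {x. 0 < Re (\<gamma> x)})" by (rule openin_open_Int[OF open_character_Re[OF \<gamma>]])
    show "{0} \<subseteq> N \<inter> {x. 0 < Re (\<gamma> x)}" using zN by (simp add: character_0[OF \<gamma>])
  qed (use hd in auto)
  obtain W where W: "open W" "0 \<in> W" "\<And>x. x \<in> N \<Longrightarrow> \<exists>V\<in>{B, B'}. \<forall>y\<in>N. y - x \<in> W \<longrightarrow> y \<in> V"
    by (rule lebesgue_nhd[OF N(2), of "{B, B'}"]) (use B in auto)
  have trivial: "\<gamma> w = 1" if w: "w \<in> N" "w \<in> W" for w
  proof (rule unit_powers_Re_pos)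
    fix k
    have "nmul k w \<in> B"
    proof (induction k)
      case (Suc k)
      have "nmul k w \<in> N" "nmul (Suc k) w \<in> N" using w(1) N(1) subgrp_nmul by blast+
      moreover obtain V where "V \<in> {B, B'}" "\<forall>y\<in>N. y - nmul k w \<in> W \<longrightarrow> y \<in> V"
        using W(3)[OF \<open>nmul k w \<in> N\<close>] by blast
      ultimately have V: "V \<in> {B, B'}" "nmul k w \<in> V" "nmul (Suc k) w \<in> V"
        using w(2) W(2) by auto
      then have "V = B" using Suc B(3) by (auto simp: disjnt_def)
      then show ?case using V by simp
    qed (use B in simp)
    then show "0 < Re (\<gamma> w ^ k)" using B(6) by (auto simp: character_nmul[OF \<gamma>])
  qed (rule character_norm[OF \<gamma>])
  let ?D = "\<gamma> ` N"
  have clD: "closed ?D"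
    using N(2) character_cont[OF \<gamma>] by (intro compact_imp_closed compact_continuous_image) (auto intro: continuous_on_subset)
  have "finite ?D"
  proof -
    have op: "open {y. y - x \<in> W}" for x by (rule open_translate[OF W(1)])
    have "N \<subseteq> (\<Union>x\<in>N. {y. y - x \<in> W})" using W(2) by auto
    then obtain E where E: "E \<subseteq> N" "finite E" "N \<subseteq> (\<Union>x\<in>E. {y. y - x \<in> W})"
      by (rule compactE_image[OF N(2) op])
    have "?D \<subseteq> \<gamma> ` E"
    proof
      fix c assume "c \<in> ?D"
      then obtain y where y: "y \<in> N" "c = \<gamma> y" by auto
      then obtain x where x: "x \<in> E" "y - x \<in> W" using E(3) by auto
      have "y - x \<in> N" using y x E(1) N(1) subgrp_diff by blast
      then have "\<gamma> (y - x) = 1" using trivial x by simp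
      then have "\<gamma> y = \<gamma> x" by (simp add: character_diff[OF \<gamma>] character_nz[OF \<gamma>])
      then show "c \<in> \<gamma> ` E" using y x by auto
    qed
    then show ?thesis using E(2) finite_surj by blast
  qed
  moreover have "infinite (sphere (0::complex) 1)"
  proof
    assume fin: "finite (sphere (0::complex) 1)"
    have "connected (sphere (0::complex) 1)" by (rule connected_sphere) simp
    then obtain a where a: "sphere (0::complex) 1 = {} \<or> sphere (0::complex) 1 = {a}"
      using connected_finite_iff_sing[of "sphere (0::complex) 1"] fin by auto
    have "1 \<in> sphere (0::complex) 1" "-1 \<in> sphere (0::complex) 1" by auto
    then have "1 = a" "-1 = a" using a by blast+
    then show False by simp
  qed
  ultimately have "\<not> sphere 0 1 \<subseteq> ?D" using finite_subset by blast
  then obtain t where t: "t \<in> sphere 0 1" "t \<notin> ?D" by blast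
  obtain q :: nat where "q > 0" "\<And>z. z \<in> ?D \<Longrightarrow> z ^ q = 1"
  proof (rule circle_subgroup_exponent[OF clD _ _ _ t])
    show "?D \<subseteq> sphere 0 1" using character_norm[OF \<gamma>] by auto
    show "1 \<in> ?D" using zN character_0[OF \<gamma>] by (metis image_eqI)
    fix z w assume "z \<in> ?D" "w \<in> ?D"
    then obtain x y where "x \<in> N" "y \<in> N" "z = \<gamma> x" "w = \<gamma> y" by auto
    then show "z * w \<in> ?D"
      using subgrp_add[OF N(1)] character_add[OF \<gamma>] by (metis image_eqI)
  qed blast
  then show "\<exists>q>0. \<forall>x\<in>N. \<gamma> x ^ q = 1" by auto
qed


subsection \<open>Existence of \<open>\<delta>\<close>-subgroups\<close>

text \<open>Surjectivity of L onto the torus with coordinates J. For characters on a compact L this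
  says dually that their restrictions to L are independent; a maximal independent set leaves a
  torsion quotient of the dual.\<close>

definition torus_onto :: "'a::ab_group_add set \<Rightarrow> ('a \<Rightarrow> complex) set \<Rightarrow> bool" where
  "torus_onto L J \<longleftrightarrow> (\<forall>t. (\<forall>\<gamma>\<in>J. cmod (t \<gamma>) = 1) \<longrightarrow> (\<exists>x\<in>L. \<forall>\<gamma>\<in>J. \<gamma> x = t \<gamma>))"

text \<open>Zorn's lemma. For the union of a chain, finitely many prescribed coordinates lie in one
  member of the chain and can be realised there; compactness of L realises all of them
  together.\<close>

lemma maximal_torus_onto:
  fixes L :: "'a::{topological_ab_group_add, t2_space} set"
  assumes L: "subgrp L" "compact L" and Y: "\<And>\<gamma>. \<gamma> \<in> Y \<Longrightarrow> character \<gamma>"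
  obtains J where "J \<subseteq> Y" "torus_onto L J" "\<And>J'. J \<subseteq> J' \<Longrightarrow> J' \<subseteq> Y \<Longrightarrow> torus_onto L J' \<Longrightarrow> J' = J"
proof -
  let ?\<A> = "{J. J \<subseteq> Y \<and> torus_onto L J}"
  have "\<exists>M\<in>?\<A>. \<forall>X\<in>?\<A>. M \<subseteq> X \<longrightarrow> X = M"
  proof (rule subset_Zorn_nonempty)
    have "{} \<in> ?\<A>" using subgrp_0[OF L(1)] by (auto simp: torus_onto_def)
    then show "?\<A> \<noteq> {}" by blast
    fix \<C> assume \<C>: "\<C> \<noteq> {}" "subset.chain ?\<A> \<C>"
    have sub: "\<C> \<subseteq> ?\<A>" using \<C>(2) by (simp add: subset.chain_def)
    have "torus_onto L (\<Union>\<C>)"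
      unfolding torus_onto_def
    proof (intro allI impI)
      fix t assume t: "\<forall>\<gamma>\<in>\<Union>\<C>. cmod (t \<gamma>) = 1"
      have "L \<inter> (\<Inter>\<gamma>\<in>\<Union>\<C>. {x. \<gamma> x = t \<gamma>}) \<noteq> {}"
      proof (rule compact_imp_fip_image[OF L(2)])
        fix \<gamma> assume "\<gamma> \<in> \<Union>\<C>"
        then obtain J where "J \<in> \<C>" "\<gamma> \<in> J" by (rule UnionE)
        then have "\<gamma> \<in> Y" using sub by auto
        then show "closed {x. \<gamma> x = t \<gamma>}" by (intro closed_character_eq Y)
      next
        fix I' assume I': "finite I'" "I' \<subseteq> \<Union>\<C>"
        obtain J where J: "J \<in> \<C>" "I' \<subseteq> J"
          by (rule finite_subset_Union_chain[OF I' \<C>])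
        have onto: "torus_onto L J" using sub J(1) by auto
        have tJ: "\<forall>\<gamma>\<in>J. cmod (t \<gamma>) = 1" using t J(1) by auto
        from onto[unfolded torus_onto_def, THEN spec, THEN mp, OF tJ]
        obtain x where x: "x \<in> L" "\<forall>\<gamma>\<in>J. \<gamma> x = t \<gamma>" by (rule bexE)
        have "\<gamma> x = t \<gamma>" if "\<gamma> \<in> I'" for \<gamma> by (rule bspec[OF x(2) subsetD[OF J(2) that]])
        then have "x \<in> L \<inter> (\<Inter>\<gamma>\<in>I'. {x. \<gamma> x = t \<gamma>})" using x(1) by blast
        then show "L \<inter> (\<Inter>\<gamma>\<in>I'. {x. \<gamma> x = t \<gamma>}) \<noteq> {}" by (metis empty_iff)
      qed
      then obtain x where "x \<in> L \<inter> (\<Inter>\<gamma>\<in>\<Union>\<C>. {x. \<gamma> x = t \<gamma>})" unfolding ex_in_conv[symmetric] by (elim exE)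
      then have "x \<in> L" "\<And>\<gamma>. \<gamma> \<in> \<Union>\<C> \<Longrightarrow> \<gamma> x = t \<gamma>" by blast+
      then show "\<exists>x\<in>L. \<forall>\<gamma>\<in>\<Union>\<C>. \<gamma> x = t \<gamma>" by (intro bexI[of _ x] ballI)
    qed
    moreover have "\<Union>\<C> \<subseteq> Y" using sub by (intro Union_least) auto
    ultimately show "\<Union>\<C> \<in> ?\<A>" by simp
  qed
  then obtain J where J: "J \<in> ?\<A>" "\<forall>X\<in>?\<A>. J \<subseteq> X \<longrightarrow> X = J" by (rule bexE)
  have "J \<subseteq> Y" "torus_onto L J" using J(1) by blast+
  moreover have "J' = J" if "J \<subseteq> J'" "J' \<subseteq> Y" "torus_onto L J'" for J'
  proof -
    have "J' \<in> ?\<A>" using that(2,3) by simp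
    from bspec[OF J(2) this] that(1) show ?thesis by (rule mp)
  qed
  ultimately show ?thesis by (rule that)
qed

lemma subgrp_Int_annih:
  "subgrp L \<Longrightarrow> (\<And>\<gamma>. \<gamma> \<in> J \<Longrightarrow> character \<gamma>) \<Longrightarrow> subgrp (L \<inter> annih J)"
  by (intro subgrp_Int subgrp_annih)

text \<open>If \<gamma> took every circle value on the kernel of J, adding a kernel element could
  correct the \<gamma>-coordinate without changing those in J, and \<gamma> could be adjoined to J.
  By maximality its image of the kernel is a proper closed subgroup of the circle.\<close>

lemma maximal_torus_onto_exponent:
  fixes L :: "'a::{topological_ab_group_add, t2_space} set"
  assumes L: "subgrp L" "compact L" and Y: "\<And>\<gamma>. \<gamma> \<in> Y \<Longrightarrow> character \<gamma>"
    and J: "J \<subseteq> Y" "torus_onto L J" "\<And>J'. J \<subseteq> J' \<Longrightarrow> J' \<subseteq> Y \<Longrightarrow> torus_onto L J' \<Longrightarrow> J' = J"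
    and \<gamma>: "\<gamma> \<in> Y"
  obtains q :: nat where "q > 0" "\<And>x. x \<in> L \<inter> annih J \<Longrightarrow> \<gamma> x ^ q = 1"
proof (cases "\<gamma> \<in> J")
  case True
  then show ?thesis using that[of 1] by (auto simp: annih_def)
next
  case False
  let ?N = "L \<inter> annih J"
  have N: "subgrp ?N" using J(1) Y by (intro subgrp_Int_annih L) auto
  have ch: "character \<gamma>" by (rule Y[OF \<gamma>])
  have "compact ?N" using J(1) Y by (intro compact_Int_closed L closed_annih) auto
  moreover have "continuous_on ?N \<gamma>" using character_cont[OF ch] by (rule continuous_on_subset) simp
  ultimately have cl: "closed (\<gamma> ` ?N)"
    by (intro compact_imp_closed compact_continuous_image)
  have "\<not> sphere 0 1 \<subseteq> \<gamma> ` ?N"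
  proof
    assume full: "sphere 0 1 \<subseteq> \<gamma> ` ?N"
    have "torus_onto L (insert \<gamma> J)"
      unfolding torus_onto_def
    proof (intro allI impI)
      fix t assume t: "\<forall>\<eta>\<in>insert \<gamma> J. cmod (t \<eta>) = 1"
      then obtain x where x: "x \<in> L" "\<forall>\<eta>\<in>J. \<eta> x = t \<eta>" using J(2) unfolding torus_onto_def by blast
      have "t \<gamma> / \<gamma> x \<in> sphere 0 1" using t by (simp add: norm_divide character_norm[OF ch])
      then obtain y where y: "y \<in> ?N" "\<gamma> y = t \<gamma> / \<gamma> x" using full by (metis imageE subsetD)
      have "x + y \<in> L" using x y subgrp_add[OF L(1)] by blast
      moreover have "\<gamma> (x + y) = t \<gamma>" using y by (simp add: character_add[OF ch] character_nz[OF ch])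
      moreover have "\<eta> (x + y) = t \<eta>" if "\<eta> \<in> J" for \<eta>
        using x(2) y(1) that J(1) Y by (auto simp: character_add annih_def)
      ultimately show "\<exists>x\<in>L. \<forall>\<eta>\<in>insert \<gamma> J. \<eta> x = t \<eta>" by blast
    qed
    then have "insert \<gamma> J = J" using J(1) \<gamma> by (intro J(3)) auto
    then show False using False by blast
  qed
  then obtain t where t: "t \<in> sphere 0 1" "t \<notin> \<gamma> ` ?N" by blast
  obtain q :: nat where "q > 0" "\<And>z. z \<in> \<gamma> ` ?N \<Longrightarrow> z ^ q = 1"
  proof (rule circle_subgroup_exponent[OF cl _ _ _ t])
    show "\<gamma> ` ?N \<subseteq> sphere 0 1" using character_norm[OF ch] by auto
    show "1 \<in> \<gamma> ` ?N" using subgrp_0[OF N] character_0[OF ch] by (metis image_eqI)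
    fix z w assume "z \<in> \<gamma> ` ?N" "w \<in> \<gamma> ` ?N"
    then obtain x y where "x \<in> ?N" "y \<in> ?N" "z = \<gamma> x" "w = \<gamma> y" by blast
    then show "z * w \<in> \<gamma> ` ?N"
      using subgrp_add[OF N] character_add[OF ch] by (metis image_eqI)
  qed blast
  then show ?thesis using that by blast
qed

text \<open>Taking J among the characters trivial on N0 keeps N0 inside the kernel. A general
  \<gamma> need not be trivial on N0, but a power of it is, and maximality of J is applied to that
  power.\<close>

lemma torsion_dual_kernel_exists:
  fixes L :: "'a::{topological_ab_group_add, t2_space} set"
  assumes L: "subgrp L" "compact L" and N0: "torsion_dual N0"
  obtains J where "\<And>\<gamma>. \<gamma> \<in> J \<Longrightarrow> character \<gamma>" "N0 \<subseteq> annih J" "torus_onto L J" "torsion_dual (L \<inter> annih J)"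
proof -
  define Y where "Y = {\<gamma>. character \<gamma> \<and> (\<forall>x\<in>N0. \<gamma> x = 1)}"
  have Y: "character \<gamma>" if "\<gamma> \<in> Y" for \<gamma> using that by (simp add: Y_def)
  obtain J where J: "J \<subseteq> Y" "torus_onto L J"
      "\<And>J'. J \<subseteq> J' \<Longrightarrow> J' \<subseteq> Y \<Longrightarrow> torus_onto L J' \<Longrightarrow> J' = J"
    by (rule maximal_torus_onto[OF L, of Y]) (use Y in blast)+
  have "torsion_dual (L \<inter> annih J)"
    unfolding torsion_dual_def
  proof (intro allI impI)
    fix \<gamma> :: "'a \<Rightarrow> complex" assume \<gamma>: "character \<gamma>"
    then obtain q0 :: nat where q0: "q0 > 0" "\<forall>x\<in>N0. \<gamma> x ^ q0 = 1" using N0 unfolding torsion_dual_def by blast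
    have \<gamma>Y: "(\<lambda>x. \<gamma> x ^ q0) \<in> Y" using q0 by (simp add: Y_def character_power[OF \<gamma>])
    obtain q :: nat where q: "q > 0" "\<And>x. x \<in> L \<inter> annih J \<Longrightarrow> (\<gamma> x ^ q0) ^ q = 1"
      by (rule maximal_torus_onto_exponent[OF L, of Y J "\<lambda>x. \<gamma> x ^ q0"]) (use Y J \<gamma>Y in blast)+
    show "\<exists>q>0. \<forall>x\<in>L \<inter> annih J. \<gamma> x ^ q = 1"
      using q q0(1) by (intro exI[of _ "q0 * q"]) (auto simp: power_mult)
  qed
  moreover have "N0 \<subseteq> annih J" using J(1) by (auto simp: Y_def annih_def)
  ultimately show ?thesis using that[of J] J(1,2) Y by blast
qed

section \<open>Quotients that are tori\<close>

lemma Hausdorff_circle_pow_top: "Hausdorff_space (circle_pow_top I)"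
proof -
  have "Hausdorff_space (top_of_set (sphere (0::complex) 1))"
    by (rule Hausdorff_space_subtopology) (rule Hausdorff_space_euclidean)
  then show ?thesis unfolding circle_pow_top_def Hausdorff_space_product_topology by blast
qed

lemma topspace_circle_pow_top: "topspace (circle_pow_top I) = circle_pow I"
  by (simp add: circle_pow_top_def circle_pow_def)

text \<open>A continuous map of a compact space onto a Hausdorff one is a quotient map, and the
  saturation of an open set is a union of its translates by N.\<close>

lemma open_map_of_fibres:
  fixes L :: "'a::topological_ab_group_add set"
  assumes L: "subgrp L" "compact L" and N: "N \<subseteq> L"
    and cont: "continuous_map (top_of_set L) Y \<phi>" and Y: "Hausdorff_space Y" and onto: "\<phi> ` L = topspace Y"
    and fib: "\<And>x y. x \<in> L \<Longrightarrow> y \<in> L \<Longrightarrow> \<phi> x = \<phi> y \<longleftrightarrow> x - y \<in> N"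
  shows "open_map (top_of_set L) Y \<phi>"
proof -
  have cs: "compact_space (top_of_set L)" using L(2) by (simp add: compact_space_subtopology)
  have "quotient_map (top_of_set L) Y \<phi>"
    by (intro continuous_closed_imp_quotient_map continuous_imp_closed_map cs cont Y) (use onto in simp)
  show ?thesis
    unfolding open_map_def
  proof (intro allI impI)
    fix U assume U: "openin (top_of_set L) U"
    then obtain T where T: "open T" "U = L \<inter> T" by (auto simp: openin_open)
    have "{x \<in> L. \<phi> x \<in> \<phi> ` U} = (\<Union>n\<in>N. L \<inter> {x. x - n \<in> T})"
    proof safe
      fix x u assume "x \<in> L" "u \<in> U" "\<phi> x = \<phi> u"
      then have "x - u \<in> N" using fib T(2) by auto
      then show "x \<in> (\<Union>n\<in>N. L \<inter> {x. x - n \<in> T})"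
        using \<open>x \<in> L\<close> \<open>u \<in> U\<close> T(2) by (intro UN_I[of "x - u"]) auto
    next
      fix x n assume "x \<in> L" "n \<in> N" "x - n \<in> T"
      moreover have "x - n \<in> L" using calculation N subgrp_diff[OF L(1)] by blast
      ultimately have "x - n \<in> U" "\<phi> x = \<phi> (x - n)" using T(2) fib[of x "x - n"] by auto
      then show "\<phi> x \<in> \<phi> ` U" by blast
    qed
    also have "openin (top_of_set L) \<dots>"
      by (intro openin_Union ballI) (auto intro!: openin_open_Int open_translate T(1))
    finally have "openin (top_of_set L) {x \<in> topspace (top_of_set L). \<phi> x \<in> \<phi> ` U}" by simp
    moreover have "\<phi> ` U \<subseteq> topspace Y" using onto T(2) by blast
    ultimately show "openin Y (\<phi> ` U)"
      using \<open>quotient_map (top_of_set L) Y \<phi>\<close> unfolding quotient_map_def by blast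
  qed
qed

text \<open>The index set of the torus is moved into the group by choosing, for each
  \<open>\<gamma> \<in> J\<close>, a point with coordinate \<open>- 1\<close> at \<open>\<gamma>\<close> and \<open>1\<close> elsewhere.\<close>

lemma torus_onto_quotient:
  fixes L :: "'a::{topological_ab_group_add, t2_space} set"
  assumes L: "subgrp L" "compact L" and J: "\<And>\<gamma>. \<gamma> \<in> J \<Longrightarrow> character \<gamma>" "torus_onto L J"
  shows "\<exists>I::'a set. quotient_is_torus I L (L \<inter> annih J)"
proof -
  have "\<exists>a\<in>L. \<forall>\<eta>\<in>J. \<eta> a = (if \<eta> = \<gamma> then - 1 else 1)" for \<gamma>
    using J(2)[unfolded torus_onto_def, rule_format, of "\<lambda>\<eta>. if \<eta> = \<gamma> then - 1 else 1"] by simp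
  then obtain pt where pt: "\<And>\<gamma>. pt \<gamma> \<in> L" "\<And>\<gamma> \<eta>. \<eta> \<in> J \<Longrightarrow> \<eta> (pt \<gamma>) = (if \<eta> = \<gamma> then - 1 else 1)"
    by metis
  have inj: "inj_on pt J"
  proof (rule inj_onI)
    fix \<gamma> \<eta> assume "\<gamma> \<in> J" "\<eta> \<in> J" "pt \<gamma> = pt \<eta>"
    then show "\<gamma> = \<eta>" using pt(2)[of \<gamma> \<gamma>] pt(2)[of \<gamma> \<eta>] by (auto split: if_splits)
  qed
  define I where "I = pt ` J"
  define ch where "ch = inv_into J pt"
  have ch: "ch i \<in> J" if "i \<in> I" for i using that by (auto simp: I_def ch_def inv_into_into)
  have ch_pt: "ch (pt \<gamma>) = \<gamma>" if "\<gamma> \<in> J" for \<gamma> using inj that by (simp add: ch_def)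
  define \<phi> where "\<phi> x = (\<lambda>i\<in>I. ch i x)" for x
  have cont: "continuous_map (top_of_set L) (circle_pow_top I) \<phi>"
    unfolding circle_pow_top_def continuous_map_componentwise
  proof (intro conjI ballI)
    show "\<phi> ` topspace (top_of_set L) \<subseteq> extensional I" by (auto simp: \<phi>_def)
    fix i assume i: "i \<in> I"
    have "continuous_on L (ch i)"
      using character_cont[OF J(1)[OF ch[OF i]]] by (rule continuous_on_subset) simp
    then show "continuous_map (top_of_set L) (top_of_set (sphere 0 1)) (\<lambda>x. \<phi> x i)"
      using i character_norm[OF J(1)[OF ch[OF i]]] by (auto simp: continuous_map_in_subtopology \<phi>_def)
  qed
  have onto: "\<phi> ` L = circle_pow I"
  proof
    show "\<phi> ` L \<subseteq> circle_pow I"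
      using character_norm[OF J(1)[OF ch]] by (auto simp: \<phi>_def circle_pow_def)
    show "circle_pow I \<subseteq> \<phi> ` L"
    proof
      fix t assume t: "t \<in> circle_pow I"
      then have "\<forall>\<gamma>\<in>J. cmod (t (pt \<gamma>)) = 1" by (auto simp: circle_pow_def I_def PiE_iff)
      then obtain x where x: "x \<in> L" "\<forall>\<gamma>\<in>J. \<gamma> x = t (pt \<gamma>)"
        using J(2)[unfolded torus_onto_def, rule_format, of "\<lambda>\<gamma>. t (pt \<gamma>)"] by blast
      have "t = \<phi> x"
      proof (rule PiE_ext[where s = "\<lambda>_. sphere 0 1" and k = I])
        show "t \<in> PiE I (\<lambda>_. sphere 0 1)" using t by (simp add: circle_pow_def)
        show "\<phi> x \<in> PiE I (\<lambda>_. sphere 0 1)"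
          using character_norm[OF J(1)[OF ch]] by (auto simp: \<phi>_def)
        fix i assume "i \<in> I"
        then obtain \<gamma> where "\<gamma> \<in> J" "i = pt \<gamma>" by (auto simp: I_def)
        then show "t i = \<phi> x i" using x(2) by (simp add: \<phi>_def I_def ch_pt)
      qed
      then show "t \<in> \<phi> ` L" using x(1) by blast
    qed
  qed
  have eq: "\<phi> x = \<phi> y \<longleftrightarrow> (\<forall>\<gamma>\<in>J. \<gamma> x = \<gamma> y)" for x y
  proof
    assume e: "\<phi> x = \<phi> y"
    show "\<forall>\<gamma>\<in>J. \<gamma> x = \<gamma> y"
    proof
      fix \<gamma> assume "\<gamma> \<in> J"
      then show "\<gamma> x = \<gamma> y" using fun_cong[OF e, of "pt \<gamma>"] by (simp add: \<phi>_def I_def ch_pt)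
    qed
  next
    assume "\<forall>\<gamma>\<in>J. \<gamma> x = \<gamma> y"
    then show "\<phi> x = \<phi> y" using ch by (auto simp: \<phi>_def restrict_def)
  qed
  have one: "circle_pow_one I = \<phi> 0"
    using character_0[OF J(1)[OF ch]] by (auto simp: circle_pow_one_def \<phi>_def restrict_def)
  have ker: "{x \<in> L. \<phi> x = circle_pow_one I} = L \<inter> annih J"
    unfolding one eq using character_0[OF J(1)] by (auto simp: annih_def)
  have "open_map (top_of_set L) (circle_pow_top I) \<phi>"
  proof (rule open_map_of_fibres[OF L _ cont Hausdorff_circle_pow_top])
    show "\<phi> ` L = topspace (circle_pow_top I)" by (simp add: onto topspace_circle_pow_top)
    fix x y assume "x \<in> L" "y \<in> L"
    moreover have "\<gamma> x = \<gamma> y \<longleftrightarrow> \<gamma> (x - y) = 1" if "\<gamma> \<in> J" for \<gamma>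
      using character_nz[OF J(1)[OF that]] by (simp add: character_diff[OF J(1)[OF that]])
    ultimately show "\<phi> x = \<phi> y \<longleftrightarrow> x - y \<in> L \<inter> annih J"
      using subgrp_diff[OF L(1)] by (auto simp: eq annih_def)
  qed simp
  moreover have "\<phi> (x + y) = circle_pow_mult I (\<phi> x) (\<phi> y)" for x y
    using character_add[OF J(1)[OF ch]] by (auto simp: \<phi>_def circle_pow_mult_def restrict_def)
  ultimately have "quotient_is_torus I L (L \<inter> annih J)"
    unfolding quotient_is_torus_def using cont onto ker by blast
  then show ?thesis by blast
qed

text \<open>N0 = {0} gives plain existence; taking for N0 a \<delta>-subgroup of K1 gives a
  \<delta>-subgroup of K above it.\<close>

lemma delta_subgroup_exists:
  fixes L :: "'a::{topological_ab_group_add, t2_space} set"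
  assumes K: "compact (UNIV :: 'a set)" and L: "subgrp L" "closed L"
    and N0: "N0 \<subseteq> L" "torsion_dual N0"
  obtains M where "delta_subgroup L M" "N0 \<subseteq> M"
proof -
  have cL: "compact L" using compact_Int_closed[OF K L(2)] by simp
  obtain J where J: "\<And>\<gamma>. \<gamma> \<in> J \<Longrightarrow> character \<gamma>" "N0 \<subseteq> annih J" "torus_onto L J" "torsion_dual (L \<inter> annih J)"
    by (fact torsion_dual_kernel_exists[OF L(1) cL N0(2)])
  have "subgrp (L \<inter> annih J)" using J(1) by (intro subgrp_Int_annih L(1))
  moreover have "closed (L \<inter> annih J)" using J(1) by (intro closed_Int closed_annih L(2))
  moreover have "totally_disconn (L \<inter> annih J)" by (rule torsion_dual_imp_totally_disconn[OF K J(4)])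
  moreover have "\<exists>I::'a set. quotient_is_torus I L (L \<inter> annih J)"
    using J(1,3) by (intro torus_onto_quotient L(1) cL)
  ultimately have "delta_subgroup L (L \<inter> annih J)" unfolding delta_subgroup_def by blast
  then show ?thesis using that[of "L \<inter> annih J"] N0(1) J(2) by blast
qed

lemma torsion_dual_singleton: "torsion_dual {0}"
  unfolding torsion_dual_def
proof (intro allI impI)
  fix \<gamma> :: "'a \<Rightarrow> complex" assume "character \<gamma>"
  then show "\<exists>q>0. \<forall>x\<in>{0}. \<gamma> x ^ q = 1" by (intro exI[of _ "Suc 0"]) (simp add: character_0)
qed


subsection \<open>\<open>p\<close>-monothetic subgroups\<close>

text \<open>The closed subgroup generated by x; multipliers of \<open>nmul\<close> are natural
  numbers, hence the separate range of negatives.\<close>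

definition nmul_closure :: "'a::topological_ab_group_add \<Rightarrow> 'a set" where
  "nmul_closure x = closure (range (\<lambda>n. nmul n x) \<union> range (\<lambda>n. - nmul n x))"

lemma subgrp_closure:
  fixes S :: "'a::topological_ab_group_add set"
  assumes S: "subgrp S" shows "subgrp (closure S)"
proof -
  have cont_add: "continuous_on UNIV (\<lambda>x. a + x)" for a :: 'a by (intro continuous_intros)
  have 1: "a + y \<in> closure S" if "a \<in> S" "y \<in> closure S" for a y
  proof -
    have "(\<lambda>x. a + x) ` closure S \<subseteq> closure S"
    proof (rule image_closure_subset)
      show "continuous_on (closure S) (\<lambda>x. a + x)" using cont_add by (rule continuous_on_subset) simp
      show "(\<lambda>x. a + x) ` S \<subseteq> closure S" using subgrp_add[OF S that(1)] closure_subset by blast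
    qed simp
    then show ?thesis using that(2) by blast
  qed
  have 2: "x + y \<in> closure S" if "x \<in> closure S" "y \<in> closure S" for x y
  proof -
    have "(\<lambda>x. y + x) ` closure S \<subseteq> closure S"
    proof (rule image_closure_subset)
      show "continuous_on (closure S) (\<lambda>x. y + x)" using cont_add by (rule continuous_on_subset) simp
      show "(\<lambda>x. y + x) ` S \<subseteq> closure S" using 1[OF _ that(2)] by (auto simp: add.commute)
    qed simp
    then show ?thesis using that(1) by (metis add.commute image_subset_iff)
  qed
  have "uminus ` closure S \<subseteq> closure S"
  proof (rule image_closure_subset)
    show "continuous_on (closure S) uminus"
      by (rule continuous_on_subset[of UNIV]) (auto intro: continuous_on_minus continuous_on_id)
    show "uminus ` S \<subseteq> closure S" using subgrp_minus[OF S] closure_subset by blast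
  qed simp
  moreover have "0 \<in> closure S" using subgrp_0[OF S] closure_subset by blast
  ultimately show ?thesis using 2 unfolding subgrp_def by blast
qed

lemma subgrp_multiples: "subgrp (range (\<lambda>n. nmul n x) \<union> range (\<lambda>n. - nmul n x))" (is "subgrp ?S")
proof -
  have diff: "nmul m x - nmul n x \<in> ?S" for m n
  proof (cases "n \<le> m")
    case True
    then have "nmul m x - nmul n x = nmul (m - n) x" by (simp add: nmul_diff)
    then show ?thesis by blast
  next
    case False
    then have "nmul m x - nmul n x = - nmul (n - m) x" by (simp add: nmul_diff)
    then show ?thesis by blast
  qed
  have "a + b \<in> ?S" if ab: "a \<in> ?S" "b \<in> ?S" for a b
  proof -
    consider m n where "a = nmul m x" "b = nmul n x" | m n where "a = nmul m x" "b = - nmul n x"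
      | m n where "a = - nmul m x" "b = nmul n x" | m n where "a = - nmul m x" "b = - nmul n x"
      using ab by blast
    then show ?thesis
    proof cases
      case 1
      then have "a + b = nmul (m + n) x" by (simp add: nmul_add)
      then show ?thesis by blast
    next
      case 2 then show ?thesis using diff[of m n] by simp
    next
      case 3 then show ?thesis using diff[of n m] by simp
    next
      case 4
      then have "a + b = - nmul (m + n) x" by (simp add: nmul_add)
      then show ?thesis by blast
    qed
  qed
  moreover have "0 \<in> ?S" using rangeI[of "\<lambda>n. nmul n x" 0] by simp
  moreover have "- a \<in> ?S" if a: "a \<in> ?S" for a
  proof -
    consider m where "a = nmul m x" | m where "a = - nmul m x" using a by blast
    then show ?thesis
    proof cases
      case 1 then show ?thesis by blast
    next
      case 2 then show ?thesis by simp
    qed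
  qed
  ultimately show ?thesis unfolding subgrp_def by (intro conjI ballI)
qed

lemma nmul_closure_subgrp: "subgrp (nmul_closure x)"
  unfolding nmul_closure_def by (intro subgrp_closure subgrp_multiples)

lemma nmul_closure_self: "x \<in> nmul_closure x"
proof -
  have "x = nmul 1 x" by simp
  then have "x \<in> range (\<lambda>n. nmul n x)" by (rule range_eqI)
  then show ?thesis unfolding nmul_closure_def by (intro subsetD[OF closure_subset] UnI1)
qed

lemma nmul_closure_least:
  assumes "subgrp C" "closed C" "x \<in> C" shows "nmul_closure x \<subseteq> C"
  unfolding nmul_closure_def
proof (rule closure_minimal[OF _ assms(2)], rule Un_least; rule image_subsetI)
  fix n
  show "nmul n x \<in> C" by (rule subgrp_nmul[OF assms(1,3)])
  then show "- nmul n x \<in> C" by (rule subgrp_minus[OF assms(1)])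
qed

text \<open>For \<open>x\<close> all of whose character values have \<open>p\<close>-power order, the digits of
  \<open>c \<in> Q = nmul_closure x\<close> modulo \<open>p\<^sup>n\<close> are read off from
  \<open>c \<in> j x + p\<^sup>n Q\<close>; this identifies \<open>Q\<close> with a subgroup of the \<open>p\<close>-adic integers.\<close>

lemma p_monothetic_nmul_closure:
  fixes x :: "'a::{topological_ab_group_add, t2_space}"
  assumes K: "compact (UNIV :: 'a set)" and p: "prime p"
    and tf: "\<And>c. c \<in> nmul_closure x \<Longrightarrow> nmul p c = 0 \<Longrightarrow> c = 0"
    and x0: "x \<noteq> 0"
    and px: "\<And>\<gamma>. character \<gamma> \<Longrightarrow> \<exists>k. \<gamma> x ^ (p ^ k) = 1"
  shows "p_monothetic p (nmul_closure x)" "infinite (nmul_closure x)"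
proof -
  define Q where "Q = nmul_closure x"
  define R where "R n = nmul (p ^ n) ` Q" for n
  have p1: "p > 1" using p by (rule prime_gt_1_nat)
  have Q: "subgrp Q" by (simp add: Q_def nmul_closure_subgrp)
  have clQ: "closed Q" unfolding Q_def nmul_closure_def by (rule closed_closure)
  have cQ: "compact Q" using compact_Int_closed[OF K clQ] by simp
  have xQ: "x \<in> Q" by (simp add: Q_def nmul_closure_self)
  have tfn: "c = 0" if "c \<in> Q" "nmul (p ^ n) c = 0" for c n
    using that
  proof (induction n arbitrary: c)
    case (Suc n)
    have "nmul (p ^ n) (nmul p c) = 0" using Suc.prems(2) by (simp add: nmul_mult[symmetric] mult.commute)
    then have "nmul p c = 0" using Suc.IH subgrp_nmul[OF Q Suc.prems(1)] by blast
    then show ?case using tf Suc.prems(1) by (simp add: Q_def)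
  qed simp
  have R: "subgrp (R n)" for n
    unfolding subgrp_def
  proof (intro conjI ballI)
    show "0 \<in> R n" unfolding R_def using subgrp_0[OF Q] by (metis image_eqI nmul_0_right)
    fix a b assume "a \<in> R n" "b \<in> R n"
    then obtain a' b' where ab: "a' \<in> Q" "b' \<in> Q" "a = nmul (p ^ n) a'" "b = nmul (p ^ n) b'" by (auto simp: R_def)
    show "a + b \<in> R n" unfolding R_def ab nmul_add_right[symmetric] using subgrp_add[OF Q ab(1,2)] by (rule imageI)
  next
    fix a assume "a \<in> R n"
    then obtain a' where a: "a' \<in> Q" "a = nmul (p ^ n) a'" by (auto simp: R_def)
    show "- a \<in> R n" unfolding R_def a nmul_minus[symmetric] using subgrp_minus[OF Q a(1)] by (rule imageI)
  qed
  have RQ: "R n \<subseteq> Q" for n unfolding R_def using subgrp_nmul[OF Q] by blast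
  have R_Suc: "R (Suc n) \<subseteq> R n" for n
  proof
    fix a assume "a \<in> R (Suc n)"
    then obtain c where "c \<in> Q" "a = nmul (p ^ n) (nmul p c)"
      by (auto simp: R_def nmul_mult[symmetric] mult.commute)
    then show "a \<in> R n" using subgrp_nmul[OF Q] by (auto simp: R_def)
  qed
  have clR: "closed (R n)" for n
    unfolding R_def using cQ continuous_on_subset[OF continuous_nmul]
    by (intro compact_imp_closed compact_continuous_image) auto
  have char_values: "\<gamma> c ^ (p ^ k) = 1" if \<gamma>: "character \<gamma>" and k: "\<gamma> x ^ (p ^ k) = 1" and c: "c \<in> Q" for \<gamma> c k
  proof -
    let ?C = "annih {\<lambda>y. \<gamma> y ^ (p ^ k)}"
    have ch: "character \<eta>" if "\<eta> \<in> {\<lambda>y. \<gamma> y ^ (p ^ k)}" for \<eta> using that character_power[OF \<gamma>] by simp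
    have "subgrp ?C" by (rule subgrp_annih) (rule ch)
    moreover have "closed ?C" by (rule closed_annih) (rule ch)
    moreover have "x \<in> ?C" using k by (simp add: annih_def)
    ultimately have "Q \<subseteq> ?C" unfolding Q_def by (rule nmul_closure_least)
    then show ?thesis using c by (auto simp: annih_def)
  qed
  \<comment> \<open>Every character has p-power order on Q, so it is trivial on p^k Q for some k; an
    element of all R n is killed by all characters.\<close>
  have R_trivial: "c = 0" if c: "\<And>n. c \<in> R n" for c
  proof (rule ccontr)
    assume "c \<noteq> 0"
    then obtain \<gamma> where \<gamma>: "character \<gamma>" "\<gamma> c \<noteq> 1" by (rule characters_separate_points[OF K])
    obtain k where k: "\<gamma> x ^ (p ^ k) = 1" using px[OF \<gamma>(1)] by blast
    obtain d where "d \<in> Q" "c = nmul (p ^ k) d" using c[of k] by (auto simp: R_def)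
    then show False using char_values[OF \<gamma>(1) k, of d] \<gamma>(2) by (simp add: character_nmul[OF \<gamma>(1)])
  qed
  \<comment> \<open>Otherwise p Q = Q, hence R n = Q for all n, and x would lie in their trivial
    intersection.\<close>
  have x_notin: "x \<notin> R 1"
  proof
    assume "x \<in> R 1"
    then have "Q \<subseteq> R 1" unfolding Q_def using R[of 1] clR[of 1] by (intro nmul_closure_least)
    then have "Q = R 1" using RQ by blast
    have all: "R n = Q" for n
    proof (induction n)
      case (Suc n)
      have "R (Suc n) = nmul (p ^ n) ` R 1"
        by (simp add: R_def image_image nmul_mult[symmetric] mult.commute)
      also have "\<dots> = R n" unfolding \<open>Q = R 1\<close>[symmetric] by (simp add: R_def)
      finally show ?case using Suc by simp
    qed (simp add: R_def)
    show False using R_trivial[of x] x0 xQ unfolding all by blast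
  qed
  \<comment> \<open>Write j = p^a * u with u prime to p, so a < n. Torsion-freeness cancels p^a and
    puts u x into p Q; as p x is also there, Bezout gives x in p Q.\<close>
  have distinct: "j = 0" if j: "nmul j x \<in> R n" "j < p ^ n" for j n
  proof (rule ccontr)
    assume "j \<noteq> 0"
    obtain u where u: "j = p ^ multiplicity p j * u" "\<not> p dvd u"
      using multiplicity_decompose'[of j p] \<open>j \<noteq> 0\<close> p by (metis not_prime_unit)
    define a where "a = multiplicity p j"
    have "a < n"
    proof (rule ccontr)
      assume "\<not> a < n"
      then have "p ^ n \<le> p ^ a" using p1 by (intro power_increasing) auto
      also have "\<dots> \<le> j" using u \<open>j \<noteq> 0\<close> by (metis a_def dvd_imp_le dvd_triv_left gr0I)
      finally show False using j(2) by simp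
    qed
    obtain c where c: "c \<in> Q" "nmul j x = nmul (p ^ n) c" using j(1) by (auto simp: R_def)
    have n: "p ^ n = p ^ a * (p ^ (n - a))" using \<open>a < n\<close> by (simp add: power_add[symmetric])
    have "nmul (p ^ a) (nmul u x - nmul (p ^ (n - a)) c) = 0"
      using c(2) u(1) n by (simp add: nmul_diff_right nmul_mult[symmetric] a_def[symmetric])
    then have ux: "nmul u x = nmul (p ^ (n - a)) c"
      using tfn subgrp_diff[OF Q subgrp_nmul[OF Q xQ] subgrp_nmul[OF Q c(1)]] by (metis eq_iff_diff_eq_0)
    have "nmul u x \<in> R 1"
    proof -
      obtain d where "n = Suc (a + d)" using less_imp_Suc_add[OF \<open>a < n\<close>] by blast
      then have "p ^ (n - a) = p ^ 1 * p ^ (n - a - 1)" by (simp add: Suc_diff_le)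
      then have "nmul u x = nmul (p ^ 1) (nmul (p ^ (n - a - 1)) c)" unfolding ux by (simp add: nmul_mult[symmetric])
      then show ?thesis unfolding R_def using subgrp_nmul[OF Q c(1)] by blast
    qed
    have "coprime u p" using p u(2) by (simp add: prime_imp_coprime coprime_commute)
    obtain v w where vw: "v * u = 1 + w * p"
    proof -
      have "u \<noteq> 0" using u \<open>j \<noteq> 0\<close> by (metis mult_0_right)
      then obtain v w where "u * v = p * w + gcd u p" using bezout_nat[of u p] by auto
      then show ?thesis using that[of v w] \<open>coprime u p\<close> by (simp add: mult.commute)
    qed
    have "x = nmul v (nmul u x) - nmul w (nmul p x)"
      unfolding nmul_mult[symmetric] vw nmul_add by simp
    moreover have "nmul p x \<in> R 1" unfolding R_def using xQ by (intro image_eqI[of _ _ x]) simp_all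
    then have "nmul w (nmul p x) \<in> R 1" by (rule subgrp_nmul[OF R])
    ultimately have "x \<in> R 1" using subgrp_diff[OF R subgrp_nmul[OF R \<open>nmul u x \<in> R 1\<close>]] by metis
    then show False using x_notin by simp
  qed
  have exist: "\<exists>j<p ^ n. c - nmul j x \<in> R n" if c: "c \<in> Q" for c n
  proof -
    \<comment> \<open>The finite union of the cosets j x + R n is closed and contains all multiples
      of x, hence also their closure.\<close>
    let ?D = "\<Union>j<p ^ n. {c. c - nmul j x \<in> R n}"
    have pn: "p ^ n > 0" using p1 by simp
    have red: "\<exists>j<p ^ n. nmul m x - nmul j x \<in> R n" for m
    proof (intro exI conjI)
      show "m mod p ^ n < p ^ n" using pn by simp
      have "nmul m x = nmul (p ^ n * (m div p ^ n) + m mod p ^ n) x" by simp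
      then have "nmul m x - nmul (m mod p ^ n) x = nmul (p ^ n) (nmul (m div p ^ n) x)"
        unfolding nmul_add nmul_mult by simp
      then show "nmul m x - nmul (m mod p ^ n) x \<in> R n" unfolding R_def using subgrp_nmul[OF Q xQ] by blast
    qed
    have "closed {c. c - nmul j x \<in> R n}" for j
      using closed_vimage[OF clR[of n], of "\<lambda>c. c - nmul j x"] by (simp add: vimage_def continuous_intros)
    then have "closed ?D" by (intro closed_UN) auto
    moreover have "range (\<lambda>n. nmul n x) \<union> range (\<lambda>n. - nmul n x) \<subseteq> ?D"
    proof safe
      fix m show "nmul m x \<in> ?D" using red[of m] by auto
      show "- nmul m x \<in> ?D"
      proof -
        \<comment> \<open>A negative multiple reduces to a nonnegative one: - m x = l x - p^n m x
          with l = p^n m - m.\<close>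
        have "1 * m \<le> p ^ n * m" using pn by (intro mult_le_mono1) linarith
        then obtain l where l: "p ^ n * m = m + l" unfolding mult_1 by (rule less_eqE)
        have e: "- nmul m x = nmul l x - nmul (p ^ n) (nmul m x)"
          unfolding nmul_mult[symmetric] l nmul_add by simp
        obtain j where j: "j < p ^ n" "nmul l x - nmul j x \<in> R n" using red by blast
        have "nmul (p ^ n) (nmul m x) \<in> R n" unfolding R_def using subgrp_nmul[OF Q xQ] by blast
        then have "(nmul l x - nmul j x) - nmul (p ^ n) (nmul m x) \<in> R n" by (rule subgrp_diff[OF R j(2)])
        also have "(nmul l x - nmul j x) - nmul (p ^ n) (nmul m x) = - nmul m x - nmul j x"
          unfolding e by (simp add: algebra_simps)
        finally have "- nmul m x \<in> {c. c - nmul j x \<in> R n}" by simp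
        then show ?thesis using j(1) by blast
      qed
    qed
    ultimately have "Q \<subseteq> ?D" unfolding Q_def nmul_closure_def by (intro closure_minimal)
    then show ?thesis using c by blast
  qed
  have unique: "i = j" if c: "c - nmul i x \<in> R n" "c - nmul j x \<in> R n" and ij: "i < p ^ n" "j < p ^ n" for c i j n
  proof -
    have aux: "i' = j'" if "c - nmul i' x \<in> R n" "c - nmul j' x \<in> R n" "i' < p ^ n" "j' \<le> i'" for i' j'
    proof -
      have "(c - nmul j' x) - (c - nmul i' x) \<in> R n" by (rule subgrp_diff[OF R that(2,1)])
      then have "nmul (i' - j') x \<in> R n" using that(4) by (simp add: nmul_diff)
      then have "i' - j' = 0" using that(3) by (intro distinct) auto
      then show ?thesis using that(4) by simp
    qed
    show ?thesis
    proof (cases "j \<le> i")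
      case True then show ?thesis by (rule aux[OF c ij(1)])
    next
      case False
      then have "i \<le> j" by simp
      then show ?thesis by (rule aux[OF c(2,1) ij(2), symmetric])
    qed
  qed
  define dig where "dig c n = (THE j. j < p ^ n \<and> c - nmul j x \<in> R n)" for c n
  have dig: "dig c n < p ^ n" "c - nmul (dig c n) x \<in> R n" if "c \<in> Q" for c n
  proof -
    have "\<exists>!j. j < p ^ n \<and> c - nmul j x \<in> R n" 
    proof (rule ex_ex1I)
      show "\<exists>j. j < p ^ n \<and> c - nmul j x \<in> R n" using exist[OF that] by auto
      fix i j assume "i < p ^ n \<and> c - nmul i x \<in> R n" "j < p ^ n \<and> c - nmul j x \<in> R n"
      then show "i = j" using unique[of c i n j] by simp
    qed
    then have "dig c n < p ^ n \<and> c - nmul (dig c n) x \<in> R n" unfolding dig_def by (rule theI')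
    then show "dig c n < p ^ n" "c - nmul (dig c n) x \<in> R n" by auto
  qed
  have dig_eq: "dig c n = m mod p ^ n" if "c \<in> Q" "c - nmul m x \<in> R n" for c m n
  proof (rule unique[OF dig(2)[OF that(1)] _ dig(1)[OF that(1)]])
    show "m mod p ^ n < p ^ n" using p1 by simp
    have "nmul m x = nmul (p ^ n * (m div p ^ n) + m mod p ^ n) x" by simp
    then have "nmul m x = nmul (p ^ n) (nmul (m div p ^ n) x) + nmul (m mod p ^ n) x"
      unfolding nmul_add nmul_mult .
    moreover have "nmul (p ^ n) (nmul (m div p ^ n) x) \<in> R n" unfolding R_def using subgrp_nmul[OF Q xQ] by blast
    then have "(c - nmul m x) + nmul (p ^ n) (nmul (m div p ^ n) x) \<in> R n" by (rule subgrp_add[OF R that(2)])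
    ultimately show "c - nmul (m mod p ^ n) x \<in> R n" by (simp add: algebra_simps)
  qed
  define f where "f c n = int (dig c n)" for c n
  have f_lt: "f c n < int p ^ n" if "c \<in> Q" for c n
    unfolding f_def of_nat_power[symmetric] of_nat_less_iff by (rule dig(1)[OF that])
  have f_add: "f (c + d) = padic_add p (f c) (f d)" if "c \<in> Q" "d \<in> Q" for c d
  proof
    fix n
    have "c + d - nmul (dig c n + dig d n) x = (c - nmul (dig c n) x) + (d - nmul (dig d n) x)"
      by (simp add: nmul_add)
    also have "\<dots> \<in> R n" using dig(2) that by (intro subgrp_add[OF R])
    finally have "dig (c + d) n = (dig c n + dig d n) mod p ^ n" using that by (intro dig_eq subgrp_add[OF Q])
    then show "f (c + d) n = padic_add p (f c) (f d) n" by (simp add: f_def padic_add_def zmod_int)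
  qed
  have f_0: "f 0 = (\<lambda>n. 0)"
  proof
    fix n have "dig 0 n = 0 mod p ^ n" using subgrp_0[OF Q] subgrp_0[OF R] by (intro dig_eq) auto
    then show "f 0 n = 0" by (simp add: f_def)
  qed
  have f_neg: "f (- c) = padic_neg p (f c)" if "c \<in> Q" for c
  proof
    fix n
    have "padic_add p (f c) (f (- c)) = f (c + - c)" by (rule f_add[OF that subgrp_minus[OF Q that], symmetric])
    also have "\<dots> = (\<lambda>n. 0)" unfolding f_0[symmetric] by simp
    finally have "padic_add p (f c) (f (- c)) n = 0" by (rule fun_cong)
    then have "int p ^ n dvd f c n + f (- c) n" by (simp add: padic_add_def mod_eq_0_iff_dvd)
    then have "int p ^ n dvd - (f c n + f (- c) n)" by (simp only: dvd_minus_iff)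
    then have "int p ^ n dvd - f c n - f (- c) n" by simp
    then have "(- f c n) mod int p ^ n = f (- c) n mod int p ^ n" by (simp only: mod_eq_dvd_iff)
    moreover have "f (- c) n mod int p ^ n = f (- c) n"
      using f_lt[OF subgrp_minus[OF Q that], of n] by (intro mod_pos_pos_trivial) (simp_all add: f_def)
    ultimately show "f (- c) n = padic_neg p (f c) n" by (simp add: padic_neg_def)
  qed
  have f_padic: "f c \<in> padic_int p" if "c \<in> Q" for c
    unfolding padic_int_def
  proof (safe)
    fix n
    show "0 \<le> f c n" by (simp add: f_def)
    show "f c n < int p ^ n" by (rule f_lt[OF that])
    have "c - nmul (dig c (Suc n)) x \<in> R n" using dig(2)[OF that] R_Suc by blast
    then have "dig c n = dig c (Suc n) mod p ^ n" by (rule dig_eq[OF that])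
    then show "f c n = f c (Suc n) mod int p ^ n" by (simp add: f_def zmod_int)
  qed
  have inj: "inj_on f Q"
  proof (rule inj_onI)
    fix c d assume cd: "c \<in> Q" "d \<in> Q" "f c = f d"
    have "c - d \<in> R n" for n
    proof -
      have "dig c n = dig d n" using fun_cong[OF cd(3), of n] by (simp add: f_def)
      then have "c - nmul (dig c n) x \<in> R n" "d - nmul (dig c n) x \<in> R n"
        using dig(2)[OF cd(1), of n] dig(2)[OF cd(2), of n] by simp_all
      then have "(c - nmul (dig c n) x) - (d - nmul (dig c n) x) \<in> R n" by (rule subgrp_diff[OF R])
      then show ?thesis by simp
    qed
    then have "c - d = 0" by (rule R_trivial)
    then show "c = d" by simp
  qed
  have padic: "padic_subgrp p (f ` Q)"
    unfolding padic_subgrp_def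
  proof (intro conjI ballI)
    show "f ` Q \<subseteq> padic_int p" using f_padic by blast
    show "(\<lambda>n. 0) \<in> f ` Q" using f_0 subgrp_0[OF Q] by (metis image_eqI)
  next
    fix a b assume "a \<in> f ` Q" "b \<in> f ` Q"
    then obtain c d where "c \<in> Q" "d \<in> Q" "a = f c" "b = f d" by blast
    then show "padic_add p a b \<in> f ` Q" using f_add[of c d] subgrp_add[OF Q] by (metis image_eqI)
  next
    fix a assume "a \<in> f ` Q"
    then obtain c where "c \<in> Q" "a = f c" by blast
    then show "padic_neg p a \<in> f ` Q" using f_neg[of c] subgrp_minus[OF Q] by (metis image_eqI)
  qed
  have homeo: "homeomorphic_map (top_of_set Q) (top_of_set (f ` Q)) f"
  proof (rule continuous_imp_homeomorphic_map)
    have "continuous_on Q (\<lambda>c. f c n)" for n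
    proof -
      \<comment> \<open>The n-th digit is constant on each coset of R n in Q. The finitely many
        cosets are closed, so the preimage of any set of integers is closed.\<close>
      let ?P = "\<lambda>j. {c \<in> Q. dig c n = j}"
      have P: "?P j = Q \<inter> {c. c - nmul j x \<in> R n}" if "j < p ^ n" for j
        using dig dig_eq[of _ j n] that by auto
      have cl: "closed (?P j)" for j
      proof (cases "j < p ^ n")
        case True
        then show ?thesis unfolding P[OF True]
          using closed_vimage[OF clR[of n], of "\<lambda>c. c - nmul j x"] clQ by (simp add: vimage_def continuous_intros closed_Int)
      next
        case False
        then have e: "?P j = {}" using dig(1)[of _ n] by auto
        show ?thesis unfolding e by (rule closed_empty)
      qed
      show ?thesis
        unfolding continuous_on_closed_invariant
      proof (intro allI impI)
        fix B :: "int set"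
        have "closed (\<Union>j\<in>{j. j < p ^ n \<and> int j \<in> B}. ?P j)" using cl by (intro closed_UN) auto
        moreover have "(\<Union>j\<in>{j. j < p ^ n \<and> int j \<in> B}. ?P j) \<inter> Q = (\<lambda>c. f c n) -` B \<inter> Q"
          using dig(1) by (auto simp: f_def)
        ultimately show "\<exists>A. closed A \<and> A \<inter> Q = (\<lambda>c. f c n) -` B \<inter> Q" by blast
      qed
    qed
    then have "continuous_on Q f" by (rule continuous_on_coordinatewise_then_product)
    then show "continuous_map (top_of_set Q) (top_of_set (f ` Q)) f"
      by (simp add: continuous_map_in_subtopology)
    show "compact_space (top_of_set Q)" using cQ by (simp add: compact_space_subtopology)
    have "Hausdorff_space (product_topology (\<lambda>_ :: nat. euclidean :: int topology) UNIV)"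
      unfolding Hausdorff_space_product_topology using Hausdorff_euclidean_t2 by blast
    then show "Hausdorff_space (top_of_set (f ` Q))"
      unfolding euclidean_product_topology by (rule Hausdorff_space_subtopology)
  qed (use inj in auto)
  have "bij_betw f Q (f ` Q)" using inj by (simp add: bij_betw_def)
  then have "\<exists>H f. padic_subgrp p H \<and> bij_betw f Q H \<and>
        (\<forall>x\<in>Q. \<forall>y\<in>Q. f (x + y) = padic_add p (f x) (f y)) \<and>
        homeomorphic_map (top_of_set Q) (top_of_set H) f"
    using padic homeo f_add by (intro exI[of _ "f ` Q"] exI[of _ f] conjI ballI)
  then show "p_monothetic p (nmul_closure x)"
    unfolding p_monothetic_def Q_def[symmetric] using Q by simp
  have "inj (\<lambda>n. nmul (p ^ n) x)"
  proof (rule injI)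
    have aux: False if "nmul (p ^ m) x = nmul (p ^ n) x" "m < n" for m n
    proof -
      have lt: "p ^ m < p ^ n" using that(2) p1 by (simp add: power_strict_increasing)
      have "nmul (p ^ m) x \<in> R n" unfolding that(1) R_def using xQ by blast
      then have "p ^ m = 0" using lt by (rule distinct)
      then show False using p1 by simp
    qed
    fix m n assume "nmul (p ^ m) x = nmul (p ^ n) x"
    then show "m = n" using aux[of m n] aux[of n m] by (metis linorder_neqE_nat)
  qed
  then have "infinite (range (\<lambda>n. nmul (p ^ n) x))" using finite_imageD infinite_UNIV_nat by blast
  moreover have "range (\<lambda>n. nmul (p ^ n) x) \<subseteq> nmul_closure x"
    using subgrp_nmul[OF Q xQ] unfolding Q_def by blast
  ultimately show "infinite (nmul_closure x)" by (rule infinite_super[rotated])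
qed


subsection \<open>Tori and covering dimension\<close>

lemma quotient_is_torus_coordinates:
  fixes L :: "'a::topological_ab_group_add set"
  assumes "quotient_is_torus I L N" and L: "subgrp L"
  obtains \<phi> where
    "continuous_map (top_of_set L) (circle_pow_top I) \<phi>"
    "open_map (top_of_set L) (circle_pow_top I) \<phi>"
    "\<phi> ` L = circle_pow I"
    "{x \<in> L. \<phi> x = circle_pow_one I} = N"
    "\<phi> 0 = circle_pow_one I"
    "\<And>x y j. x \<in> L \<Longrightarrow> y \<in> L \<Longrightarrow> j \<in> I \<Longrightarrow> \<phi> (x + y) j = \<phi> x j * \<phi> y j"
    "\<And>j. j \<in> I \<Longrightarrow> continuous_on L (\<lambda>x. \<phi> x j)"
    "\<And>x j. x \<in> L \<Longrightarrow> j \<in> I \<Longrightarrow> cmod (\<phi> x j) = 1"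
proof -
  obtain \<phi> where \<phi>: "continuous_map (top_of_set L) (circle_pow_top I) \<phi>"
    "open_map (top_of_set L) (circle_pow_top I) \<phi>"
    "\<phi> ` L = circle_pow I"
    "\<And>x y. x \<in> L \<Longrightarrow> y \<in> L \<Longrightarrow> \<phi> (x + y) = circle_pow_mult I (\<phi> x) (\<phi> y)"
    "{x \<in> L. \<phi> x = circle_pow_one I} = N"
    using assms(1) unfolding quotient_is_torus_def by blast
  have mult: "\<phi> (x + y) j = \<phi> x j * \<phi> y j" if "x \<in> L" "y \<in> L" "j \<in> I" for x y j
    using \<phi>(4)[OF that(1,2)] that(3) by (simp add: circle_pow_mult_def)
  have in_pow: "\<phi> x \<in> circle_pow I" if "x \<in> L" for x using \<phi>(3) that by auto
  have norm: "cmod (\<phi> x j) = 1" if "x \<in> L" "j \<in> I" for x j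
    using PiE_mem[OF in_pow[OF that(1), unfolded circle_pow_def] that(2)] by simp
  have zL: "0 \<in> L" by (rule subgrp_0[OF L])
  have one: "\<phi> 0 = circle_pow_one I"
    unfolding circle_pow_one_def
  proof (rule PiE_ext[where s = "\<lambda>_. sphere 0 1" and k = I])
    show "\<phi> 0 \<in> PiE I (\<lambda>_. sphere 0 1)" using in_pow[OF zL] by (simp add: circle_pow_def)
    fix j assume j: "j \<in> I"
    have "\<phi> 0 j \<noteq> 0" using norm[OF zL j] by auto
    then show "\<phi> 0 j = restrict (\<lambda>_. 1) I j" using mult[OF zL zL j] j by simp
  qed auto
  have cont: "continuous_on L (\<lambda>x. \<phi> x j)" if "j \<in> I" for j
  proof -
    have "continuous_map (top_of_set L) (top_of_set (sphere 0 1)) ((\<lambda>f. f j) \<circ> \<phi>)"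
      using \<phi>(1) continuous_map_product_projection[OF that, of "\<lambda>_. top_of_set (sphere 0 1)"]
      unfolding circle_pow_top_def by (rule continuous_map_compose)
    then show ?thesis by (simp add: continuous_map_in_subtopology o_def)
  qed
  show ?thesis using that[OF \<phi>(1,2,3,5) one mult cont norm] .
qed

text \<open>A cover of \<open>L\<close> is pulled back to a grid in a cube; Kuhn's labelling lemma then finds
  a cell whose vertices lie in more than \<open>n + 1\<close> different members of the cover. Unlike a map of
  the whole cube, the grid exists because \<open>\<phi>\<close> is open: it is spanned by small
  elements of \<open>L\<close> lying over small rotations of the coordinate circles.\<close>

lemma quotient_torus_finite_index:
  fixes L :: "'a::topological_ab_group_add set"
  assumes L: "subgrp L" "compact L" and q: "quotient_is_torus I L N" and dim: "covering_dim_le L n"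
  shows "finite I"
proof (rule ccontr)
  assume inf: "infinite I"
  obtain \<phi> where \<phi>: "continuous_map (top_of_set L) (circle_pow_top I) \<phi>"
    "open_map (top_of_set L) (circle_pow_top I) \<phi>"
    "\<phi> ` L = circle_pow I"
    "{x \<in> L. \<phi> x = circle_pow_one I} = N"
    "\<phi> 0 = circle_pow_one I"
    and mult: "\<And>x y j. x \<in> L \<Longrightarrow> y \<in> L \<Longrightarrow> j \<in> I \<Longrightarrow> \<phi> (x + y) j = \<phi> x j * \<phi> y j"
    and cont: "\<And>j. j \<in> I \<Longrightarrow> continuous_on L (\<lambda>x. \<phi> x j)"
    and norm1: "\<And>x j. x \<in> L \<Longrightarrow> j \<in> I \<Longrightarrow> cmod (\<phi> x j) = 1"
    by (fact quotient_is_torus_coordinates[OF q L(1)])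
  have zL: "0 \<in> L" by (rule subgrp_0[OF L(1)])
  have zero: "\<phi> 0 j = 1" if "j \<in> I" for j using \<phi>(5) that by (simp add: circle_pow_one_def)
  \<comment> \<open>In dimension m = n + 1, Kuhn's lemma produces m + 1 different members of the
    refinement through one point, one more than the order n + 1 allows.\<close>
  define m where "m = Suc n"
  obtain T where T: "T \<subseteq> I" "finite T" "card T = m"
    using infinite_arbitrarily_large[OF inf] by metis
  obtain \<iota> where \<iota>: "bij_betw \<iota> {0..<m} T" using ex_bij_betw_nat_finite[OF T(2)] T(3) by auto
  have \<iota>I: "\<iota> i \<in> I" if "i < m" for i using \<iota> T(1) that by (auto simp: bij_betw_def)
  have \<iota>inj: "\<iota> i = \<iota> j \<longleftrightarrow> i = j" if "i < m" "j < m" for i j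
    using \<iota> that by (auto simp: bij_betw_def inj_on_def)
  \<comment> \<open>At each of the m coordinates a member omits one of the values 1 and -1, so no
    set of a refinement joins opposite faces of the cube.\<close>
  define U where "U b = (\<Inter>i\<in>{..<m}. {x \<in> L. \<phi> x (\<iota> i) \<noteq> (if i \<in> b then 1 else - 1)}) \<inter> topspace (top_of_set L)" for b
  have opU: "openin (top_of_set L) (U b)" for b
    unfolding U_def
  proof (rule openin_INT)
    fix i assume "i \<in> {..<m}"
    then have "openin (top_of_set L) (L \<inter> (\<lambda>x. \<phi> x (\<iota> i)) -` (- {if i \<in> b then 1 else - 1}))"
      using cont[OF \<iota>I[of i]] by (intro continuous_openin_preimage_gen) auto
    moreover have "L \<inter> (\<lambda>x. \<phi> x (\<iota> i)) -` (- {if i \<in> b then 1 else - 1})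
        = {x \<in> L. \<phi> x (\<iota> i) \<noteq> (if i \<in> b then 1 else - 1)}" by auto
    ultimately show "openin (top_of_set L) {x \<in> L. \<phi> x (\<iota> i) \<noteq> (if i \<in> b then 1 else - 1)}"
      by simp
  qed simp
  have "L \<subseteq> \<Union>(U ` Pow {..<m})"
  proof
    fix x assume x: "x \<in> L"
    define b where "b = {i\<in>{..<m}. \<phi> x (\<iota> i) \<noteq> 1}"
    have "x \<in> U b" using x by (auto simp: U_def b_def)
    moreover have "b \<in> Pow {..<m}" by (auto simp: b_def)
    ultimately show "x \<in> \<Union>(U ` Pow {..<m})" by (meson UnionI imageI)
  qed
  note cov = this
  have fin: "finite (U ` Pow {..<m})" by simp
  have op: "\<forall>V\<in>U ` Pow {..<m}. openin (top_of_set L) V" using opU by blast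
  obtain \<V> where \<V>0: "finite \<V> \<and> (\<forall>V\<in>\<V>. openin (top_of_set L) V) \<and> L \<subseteq> \<Union>\<V> \<and>
      (\<forall>V\<in>\<V>. \<exists>X\<in>U ` Pow {..<m}. V \<subseteq> X) \<and> (\<forall>x\<in>L. card {V\<in>\<V>. x \<in> V} \<le> n + 1)"
    using dim[unfolded covering_dim_le_def, THEN spec, THEN mp, OF conjI[OF fin conjI[OF op cov]]]
    by (elim exE)
  then have \<V>: "finite \<V>" "\<And>V. V \<in> \<V> \<Longrightarrow> openin (top_of_set L) V" "L \<subseteq> \<Union>\<V>"
    "\<And>x. x \<in> L \<Longrightarrow> card {V\<in>\<V>. x \<in> V} \<le> n + 1" by simp_all
  have \<V>U: "\<exists>b. V \<subseteq> U b" if V: "V \<in> \<V>" for V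
  proof -
    have "\<forall>V\<in>\<V>. \<exists>b\<in>Pow {..<m}. V \<subseteq> U b" using \<V>0 by simp
    then show ?thesis using V by (meson bspec)
  qed
  obtain W where W: "open W" "0 \<in> W" "\<And>x. x \<in> L \<Longrightarrow> \<exists>V\<in>\<V>. \<forall>y\<in>L. y - x \<in> W \<longrightarrow> y \<in> V"
    by (rule lebesgue_nhd[OF L(2) _ \<V>(3)]) (use \<V>(2) in blast)+
  obtain U0 where U0: "open U0" "0 \<in> U0"
    "\<And>R (g::nat \<Rightarrow> 'a). finite R \<Longrightarrow> card R \<le> m \<Longrightarrow> (\<forall>i\<in>R. g i \<in> U0) \<Longrightarrow> sum g R \<in> W"
    using nhd_sum[OF W(1,2), of m, where 'b = nat] by blast
  \<comment> \<open>The torus element turning coordinate \<iota> i by the angle s. For s = pi / p, p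
    steps lead from 1 to -1, from one face of the cube to the opposite one.\<close>
  define rot where "rot i s = (\<lambda>j\<in>I. if j = \<iota> i then cis s else 1)" for i s
  have "\<exists>P. \<forall>p::nat. P \<le> p \<longrightarrow> (\<exists>g\<in>L \<inter> U0. \<phi> g = rot i (pi / real p))" if i: "i < m" for i
  proof -
    have "openin (circle_pow_top I) (\<phi> ` (L \<inter> U0))"
      using \<phi>(2) U0(1) by (auto simp: open_map_def openin_open)
    moreover have "continuous_map euclidean (circle_pow_top I) (rot i)"
      unfolding circle_pow_top_def continuous_map_componentwise
    proof (intro conjI ballI)
      show "rot i ` topspace euclidean \<subseteq> extensional I" by (auto simp: rot_def)
      fix j assume j: "j \<in> I"
      have "continuous_on UNIV (\<lambda>s. rot i s j)"
        using j by (cases "j = \<iota> i") (auto simp: rot_def intro!: continuous_intros)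
      then show "continuous_map euclidean (top_of_set (sphere 0 1)) (\<lambda>s. rot i s j)"
        using j by (auto simp: continuous_map_in_subtopology rot_def)
    qed
    ultimately have "open {s. rot i s \<in> \<phi> ` (L \<inter> U0)}"
      by (auto simp: continuous_map_def)
    moreover have "rot i 0 = \<phi> 0" unfolding \<phi>(5) by (auto simp: rot_def circle_pow_one_def)
    then have "0 \<in> {s. rot i s \<in> \<phi> ` (L \<inter> U0)}" using zL U0(2) by auto
    ultimately obtain d where d: "d > 0" "ball 0 d \<subseteq> {s. rot i s \<in> \<phi> ` (L \<inter> U0)}"
      using open_contains_ball by blast
    obtain P :: nat where P: "pi / d < P" using reals_Archimedean2 by blast
    have "\<exists>g\<in>L \<inter> U0. \<phi> g = rot i (pi / p)" if p: "p \<ge> P" for p :: nat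
    proof -
      have "0 < pi / d" using d(1) by simp
      then have "pi / d < p" "0 < real p" using P p by linarith+
      then have "pi / p < d" using d(1) by (simp add: field_simps)
      then have "pi / p \<in> ball 0 d" by simp
      then have "rot i (pi / p) \<in> \<phi> ` (L \<inter> U0)" using d(2) by blast
      then show ?thesis by auto
    qed
    then show ?thesis by blast
  qed
  then obtain P :: "nat \<Rightarrow> nat" where P: "\<And>i p. i < m \<Longrightarrow> P i \<le> p \<Longrightarrow> \<exists>g\<in>L \<inter> U0. \<phi> g = rot i (pi / real p)"
    by metis
  \<comment> \<open>Fine enough for all m coordinates at once, and positive because of
    \<open>Suc\<close>.\<close>
  define p where "p = Suc (\<Sum>i<m. P i)"
  have "P i \<le> p" if "i < m" for i
    unfolding p_def using that member_le_sum[of i "{..<m}" P] by simp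
  then have "\<exists>g. \<forall>i<m. g i \<in> L \<inter> U0 \<and> \<phi> (g i) = rot i (pi / p)"
    using P by (intro choice) (metis (full_types))
  then obtain g where g: "\<And>i. i < m \<Longrightarrow> g i \<in> L" "\<And>i. i < m \<Longrightarrow> g i \<in> U0"
    "\<And>i. i < m \<Longrightarrow> \<phi> (g i) = rot i (pi / p)" by blast
  define s where "s r = (\<Sum>i<m. nmul (r i) (g i))" for r
  have sL: "s r \<in> L" for r
    unfolding s_def using g(1) by (intro subgrp_sum[OF L(1)] subgrp_nmul[OF L(1)]) auto
  have power: "\<phi> (nmul k x) j = \<phi> x j ^ k" if "x \<in> L" "j \<in> I" for k x j
    by (induction k) (use that zero mult subgrp_nmul[OF L(1)] in auto)
  have prod: "\<phi> (\<Sum>i\<in>R. h i) j = (\<Prod>i\<in>R. \<phi> (h i) j)" if "j \<in> I" "finite R" "\<And>i. i \<in> R \<Longrightarrow> h i \<in> L"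
    for R :: "nat set" and h j
    using that(2,3)
  proof (induction R rule: finite_induct)
    case (insert x F)
    have "sum h F \<in> L" using insert.prems by (intro subgrp_sum[OF L(1)]) auto
    then show ?case using insert by (simp add: mult that(1))
  qed (simp add: zero that(1))
  have \<phi>s: "\<phi> (s r) (\<iota> i) = cis (pi / p) ^ r i" if i: "i < m" for r i
  proof -
    have "\<phi> (s r) (\<iota> i) = (\<Prod>k<m. \<phi> (nmul (r k) (g k)) (\<iota> i))"
      unfolding s_def using g(1) by (intro prod \<iota>I[OF i] subgrp_nmul[OF L(1)]) auto
    also have "\<dots> = (\<Prod>k<m. if k = i then cis (pi / p) ^ r i else 1)"
      using g \<iota>I[OF i] \<iota>inj i by (intro prod.cong refl) (auto simp: power rot_def)
    also have "\<dots> = cis (pi / p) ^ r i" using i by simp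
    finally show ?thesis .
  qed
  obtain vv where vv: "\<And>x. x \<in> L \<Longrightarrow> vv x \<in> \<V>" "\<And>x y. x \<in> L \<Longrightarrow> y \<in> L \<Longrightarrow> y - x \<in> W \<Longrightarrow> y \<in> vv x"
    using W(3) by metis
  \<comment> \<open>The label depends only on the chosen member V of the cover: 0 if V meets the
    face with value 1. Vertices with different labels therefore have different members.\<close>
  define lab' where "lab' V i = (if \<exists>x\<in>V. \<phi> x (\<iota> i) = 1 then 0 else 1 :: nat)" for V i
  define lab where "lab r = lab' (vv (s r))" for r
  have self: "s r \<in> vv (s r)" for r using vv(2)[OF sL sL] W(2) by simp
  have "odd (card {S. ksimplex p m S \<and> (reduced m \<circ> lab) ` S = {..m}})"
  proof (rule kuhn_combinatorial)
    show "0 < p" by (simp add: p_def)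
    show "\<forall>r j. (\<forall>j. r j \<le> p) \<and> j < m \<and> r j = 0 \<longrightarrow> lab r j = 0"
    proof (intro allI impI)
      fix r j assume "(\<forall>j. r j \<le> p) \<and> j < m \<and> r j = 0"
      then have "\<phi> (s r) (\<iota> j) = 1" by (simp add: \<phi>s)
      then show "lab r j = 0" using self[of r] by (auto simp: lab_def lab'_def)
    qed
    show "\<forall>r j. (\<forall>j. r j \<le> p) \<and> j < m \<and> r j = p \<longrightarrow> lab r j = 1"
    proof (intro allI impI)
      fix r j assume r: "(\<forall>j. r j \<le> p) \<and> j < m \<and> r j = p"
      have "p \<noteq> 0" by (simp add: p_def)
      then have "cis (pi / p) ^ p = -1" unfolding Complex.DeMoivre by simp
      then have m1: "\<phi> (s r) (\<iota> j) = -1" using r by (simp add: \<phi>s)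
      obtain b where "vv (s r) \<subseteq> U b" using \<V>U[OF vv(1)[OF sL]] by blast
      then have b: "\<phi> x (\<iota> j) \<noteq> (if j \<in> b then 1 else - 1)" if "x \<in> vv (s r)" for x
      proof -
        have "x \<in> U b" using that \<open>vv (s r) \<subseteq> U b\<close> by blast
        then show ?thesis using r by (simp add: U_def)
      qed
      have "\<phi> x (\<iota> j) \<noteq> 1" if "x \<in> vv (s r)" for x
        using b[OF that] b[OF self] m1 by (cases "j \<in> b") auto
      then show "lab r j = 1" by (auto simp: lab_def lab'_def)
    qed
  qed
  then have "{S. ksimplex p m S \<and> (reduced m \<circ> lab) ` S = {..m}} \<noteq> {}" by (metis card.empty even_zero)
  then obtain S where S: "ksimplex p m S" "(reduced m \<circ> lab) ` S = {..m}" by blast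
  obtain base upd where "kuhn_simplex p m base upd S" using S(1) by (auto elim: ksimplex.cases)
  then interpret kuhn_simplex p m base upd S .
  \<comment> \<open>In the last vertex every coordinate has been raised. Any vertex r of the cell is
    at most one step below it in each coordinate, so \<open>s top - s r\<close> is a sum of at most
    m of the small elements g i and lies in W; thus \<open>s top\<close> lies in the member chosen
    for r.\<close>
  define top where "top = enum m"
  have "top j = Suc (base j)" if "j < m" for j
    using upd that by (simp add: top_def enum_def bij_betw_def)
  have common: "s top \<in> vv (s r)" if r: "r \<in> S" for r
  proof -
    obtain k where k: "r = enum k" using r s_eq by auto
    have "s top - s r = (\<Sum>i<m. nmul (top i) (g i) - nmul (r i) (g i))"
      by (simp add: s_def sum_subtractf)
    also have "\<dots> = (\<Sum>i<m. if r i = base i then g i else 0)"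
      using \<open>\<And>j. j < m \<Longrightarrow> top j = Suc (base j)\<close>
      by (intro sum.cong refl) (auto simp: k enum_def)
    also have "\<dots> = sum g {i \<in> {..<m}. r i = base i}" by (simp add: sum.If_cases Int_def)
    also have "\<dots> \<in> W"
    proof (rule U0(3))
      show "card {i \<in> {..<m}. r i = base i} \<le> m"
        by (rule order_trans[OF card_mono[of "{..<m}"]]) auto
    qed (use g(2) in auto)
    finally show ?thesis by (intro vv(2) sL)
  qed
  have "finite S" using s_eq by simp
  have "Suc m = card ((reduced m \<circ> lab) ` S)" unfolding S(2) by simp
  also have "(reduced m \<circ> lab) ` S = (reduced m \<circ> lab') ` ((\<lambda>r. vv (s r)) ` S)"
    by (simp add: image_image lab_def)
  also have "card \<dots> \<le> card ((\<lambda>r. vv (s r)) ` S)" using \<open>finite S\<close> by (intro card_image_le) simp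
  also have "\<dots> \<le> card {V\<in>\<V>. s top \<in> V}"
    using common vv(1)[OF sL] \<V>(1) by (intro card_mono) auto
  also have "\<dots> \<le> m" using \<V>(4)[OF sL] by (simp add: m_def)
  finally show False by simp
qed


subsection \<open>Criteria for local essentiality\<close>

lemma prime_exponent_multiple:
  fixes w :: complex
  assumes "w \<noteq> 1" "w ^ q = 1" "q > 0"
  obtains m p where "prime p" "w ^ m \<noteq> 1" "(w ^ m) ^ p = 1"
proof -
  have "\<exists>m p. prime p \<and> w ^ m \<noteq> 1 \<and> (w ^ m) ^ p = 1"
    using assms(2,3)
  proof (induction q rule: less_induct)
    case (less q)
    have "q \<noteq> 1" using less.prems assms(1) by auto
    then obtain p where p: "prime p" "p dvd q" using prime_factor_nat by blast
    then obtain k where k: "q = k * p" by (metis dvd_def mult.commute)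
    show ?case
    proof (cases "w ^ k = 1")
      case True
      have "k > 0" using k less.prems(2) by (cases k) auto
      moreover have "k < q" using k \<open>k > 0\<close> prime_gt_1_nat[OF p(1)] by simp
      ultimately show ?thesis using less.IH True by blast
    next
      case False
      then show ?thesis using p(1) less.prems(1) unfolding k power_mult by blast
    qed
  qed
  then show ?thesis using that by blast
qed

lemma coprime_exponents_trivial:
  fixes w :: complex
  assumes "w ^ a = 1" "w ^ b = 1" "coprime a b"
  shows "w = 1"
proof (cases "a = 0")
  case True
  then have "b = 1" using assms(3) by simp
  then show ?thesis using assms(2) by simp
next
  case False
  then obtain x y where "a * x = b * y + gcd a b" using bezout_nat[of a b] by auto
  then have "a * x = b * y + 1" using assms(3) by simp
  then have "(w ^ a) ^ x = (w ^ b) ^ y * w" by (metis power_add power_mult power_one_right)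
  then show ?thesis using assms by simp
qed

lemma closed_character_finite: "character \<gamma> \<Longrightarrow> finite A \<Longrightarrow> closed {x. \<gamma> x \<in> A}"
  using closed_vimage[OF finite_imp_closed character_cont, of A \<gamma>] by (simp add: vimage_def)

text \<open>C has a nonzero totally disconnected closed subgroup N. A nonzero element of N all of
  whose character values have p-power order is found by compactness: for finitely many characters,
  multiply by the prime-to-p part of the product of their exponents on N. Its closed cyclic group is
  torsion-free, hence of p-adic type.\<close>

lemma torsion_free_contains_p_monothetic:
  fixes C :: "'a::{topological_ab_group_add, t2_space} set"
  assumes K: "compact (UNIV :: 'a set)" and C: "subgrp C" "closed C" "C \<noteq> {0}"
    and tf: "\<And>p c. prime p \<Longrightarrow> c \<in> C \<Longrightarrow> nmul p c = 0 \<Longrightarrow> c = 0"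
  obtains p Q where "prime p" "subgrp Q" "Q \<subseteq> C" "closed Q" "infinite Q" "p_monothetic p Q"
proof -
  have cC: "compact C" using compact_Int_closed[OF K C(2)] by simp
  obtain J where J: "\<And>\<gamma>. \<gamma> \<in> J \<Longrightarrow> character \<gamma>" "{0} \<subseteq> annih J" "torus_onto C J" "torsion_dual (C \<inter> annih J)"
    by (fact torsion_dual_kernel_exists[OF C(1) cC torsion_dual_singleton])
  define N where "N = C \<inter> annih J"
  have N: "subgrp N" unfolding N_def using C(1) J(1) by (rule subgrp_Int_annih)
  have "closed (annih J)" using J(1) by (rule closed_annih)
  then have cN: "compact N" unfolding N_def using cC by (intro compact_Int_closed)
  \<comment> \<open>If J is empty, N is C. Otherwise some x in C has value -1 at one member of J and
    1 at the others; then 2 x lies in N, and N = {0} would force x = 0 by torsion-freeness.\<close>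
  have "N \<noteq> {0}"
  proof
    assume N0: "N = {0}"
    show False
    proof (cases "J = {}")
      case True
      then have "N = C" by (simp add: N_def annih_def)
      then show False using N0 C(3) by simp
    next
      case False
      then obtain \<gamma> where \<gamma>: "\<gamma> \<in> J" by blast
      have "\<forall>\<eta>\<in>J. cmod (if \<eta> = \<gamma> then - 1 else 1) = 1" by simp
      from J(3)[unfolded torus_onto_def, THEN spec, THEN mp, OF this]
      obtain x where x: "x \<in> C" "\<forall>\<eta>\<in>J. \<eta> x = (if \<eta> = \<gamma> then - 1 else 1)" by (rule bexE)
      have "\<eta> (nmul 2 x) = 1" if "\<eta> \<in> J" for \<eta>
        using bspec[OF x(2) that] by (simp add: character_nmul[OF J(1)[OF that]] del: nmul.simps)
      then have "nmul 2 x \<in> N" using subgrp_nmul[OF C(1) x(1)] by (simp add: N_def annih_def del: nmul.simps)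
      then have "nmul 2 x = 0" using N0 by blast
      then have "x = 0" by (rule tf[OF two_is_prime_nat x(1)])
      then have "\<gamma> x = 1" using character_0[OF J(1)[OF \<gamma>]] by simp
      then show False using bspec[OF x(2) \<gamma>] by simp
    qed
  qed
  then obtain z where z: "z \<in> N" "z \<noteq> 0" using subgrp_0[OF N] by blast
  obtain \<gamma>0 where \<gamma>0: "character \<gamma>0" "\<gamma>0 z \<noteq> 1" using z(2) by (rule characters_separate_points[OF K])
  have "\<exists>q::nat. character \<gamma> \<longrightarrow> q > 0 \<and> (\<forall>x\<in>N. \<gamma> x ^ q = 1)" for \<gamma>
    using J(4) unfolding torsion_dual_def N_def by blast
  then obtain q :: "('a \<Rightarrow> complex) \<Rightarrow> nat"
    where q: "\<And>\<gamma>. character \<gamma> \<Longrightarrow> q \<gamma> > 0" "\<And>\<gamma> x. character \<gamma> \<Longrightarrow> x \<in> N \<Longrightarrow> \<gamma> x ^ q \<gamma> = 1"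
    by metis
  obtain m p where p: "prime p" "\<gamma>0 z ^ m \<noteq> 1" "(\<gamma>0 z ^ m) ^ p = 1"
    using prime_exponent_multiple[OF \<gamma>0(2) q(2)[OF \<gamma>0(1) z(1)] q(1)[OF \<gamma>0(1)]] by blast
  \<comment> \<open>\<gamma>0 y has order exactly p, so it stays different from 1 under
    multiplication of y by any number prime to p.\<close>
  define y where "y = nmul m z"
  have y: "y \<in> N" "\<gamma>0 y \<noteq> 1" "\<gamma>0 y ^ p = 1"
    using subgrp_nmul[OF N z(1)] p(2,3) by (simp_all add: y_def character_nmul[OF \<gamma>0(1)])
  \<comment> \<open>The roots of unity of p-power order are not closed in the circle; bounding the
    order by q \<gamma> makes the set finite and B \<gamma> closed.\<close>
  define B where "B \<gamma> = {x. \<gamma> x \<in> {c. c ^ q \<gamma> = 1 \<and> (\<exists>k. c ^ (p ^ k) = 1)}}" for \<gamma> :: "'a \<Rightarrow> complex"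
  define B0 where "B0 = {x. \<gamma>0 x \<in> {c. c ^ q \<gamma>0 = 1} - {1}}"
  have "closed B0" unfolding B0_def
    using q(1)[OF \<gamma>0(1)] by (intro closed_character_finite[OF \<gamma>0(1)] finite_Diff finite_roots_unity) simp
  then have cNB: "compact (N \<inter> B0)" by (rule compact_Int_closed[OF cN])
  have "(N \<inter> B0) \<inter> (\<Inter>\<gamma>\<in>Collect character. B \<gamma>) \<noteq> {}"
  proof (rule compact_imp_fip_image[OF cNB])
    fix \<gamma> :: "'a \<Rightarrow> complex" assume "\<gamma> \<in> Collect character"
    then have \<gamma>: "character \<gamma>" by simp
    have "finite {c::complex. c ^ q \<gamma> = 1}" using q(1)[OF \<gamma>] by (intro finite_roots_unity) simp
    then have "finite {c::complex. c ^ q \<gamma> = 1 \<and> (\<exists>k. c ^ (p ^ k) = 1)}" by (rule rev_finite_subset) auto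
    then show "closed (B \<gamma>)" unfolding B_def by (rule closed_character_finite[OF \<gamma>])
  next
    fix F assume F: "finite F" "F \<subseteq> Collect (character :: ('a \<Rightarrow> complex) \<Rightarrow> bool)"
    define t where "t = (\<Prod>\<gamma>\<in>F. q \<gamma>)"
    have "t \<noteq> 0" using F q(1) by (force simp: t_def)
    then obtain t' where t': "t = p ^ multiplicity p t * t'" "\<not> p dvd t'"
      using multiplicity_decompose'[of t p] p(1) by (metis not_prime_unit)
    define x where "x = nmul t' y"
    have x: "x \<in> N" unfolding x_def by (rule subgrp_nmul[OF N y(1)])
    have "\<gamma>0 x \<noteq> 1"
    proof
      assume "\<gamma>0 x = 1"
      then have "\<gamma>0 y ^ t' = 1" by (simp add: x_def character_nmul[OF \<gamma>0(1)])
      moreover have "coprime t' p" using p(1) t'(2) by (simp add: prime_imp_coprime coprime_commute)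
      ultimately have "\<gamma>0 y = 1" using y(3) coprime_exponents_trivial by blast
      then show False using y(2) by simp
    qed
    then have "x \<in> N \<inter> B0" using x q(2)[OF \<gamma>0(1) x] by (simp add: B0_def)
    moreover have "x \<in> B \<gamma>" if "\<gamma> \<in> F" for \<gamma>
    proof -
      have \<gamma>: "character \<gamma>" using F(2) that by blast
      have "q \<gamma> dvd t" unfolding t_def using F(1) that by (rule dvd_prodI)
      then have "\<gamma> y ^ t = 1" using q(2)[OF \<gamma> y(1)] by (metis dvdE power_mult power_one)
      then have "\<gamma> x ^ (p ^ multiplicity p t) = 1"
        using t'(1) by (metis x_def character_nmul[OF \<gamma>] power_mult mult.commute)
      then show ?thesis using q(2)[OF \<gamma> x] by (auto simp: B_def)
    qed
    ultimately show "(N \<inter> B0) \<inter> (\<Inter>\<gamma>\<in>F. B \<gamma>) \<noteq> {}" by blast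
  qed
  then obtain x where "x \<in> (N \<inter> B0) \<inter> (\<Inter>\<gamma>\<in>Collect character. B \<gamma>)" unfolding ex_in_conv[symmetric] by (rule exE)
  then have x: "x \<in> N" "x \<in> B0" "\<And>\<gamma>. character \<gamma> \<Longrightarrow> x \<in> B \<gamma>" by blast+
  have "x \<in> C" using x(1) by (simp add: N_def)
  then have QC: "nmul_closure x \<subseteq> C" using C by (intro nmul_closure_least)
  have x0: "x \<noteq> 0" using x(2) character_0[OF \<gamma>0(1)] by (auto simp: B0_def)
  have tf': "c = 0" if "c \<in> nmul_closure x" "nmul p c = 0" for c
    using tf[OF p(1)] QC that by blast
  have px: "\<exists>k. \<gamma> x ^ (p ^ k) = 1" if "character \<gamma>" for \<gamma>
    using x(3)[OF that] by (simp add: B_def)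
  have "p_monothetic p (nmul_closure x)" "infinite (nmul_closure x)"
    using p_monothetic_nmul_closure[OF K p(1) _ x0] tf' px by blast+
  moreover have "closed (nmul_closure x)" unfolding nmul_closure_def by (rule closed_closure)
  ultimately show ?thesis using that[OF p(1) nmul_closure_subgrp QC] by blast
qed

text \<open>Since p x = 0 but k x is nonzero, k is prime to p, and Bezout recovers x as a multiple
  of k x.\<close>

lemma prime_multiple_in_subgrp:
  assumes H: "subgrp H" and p: "prime p" and x: "nmul p x = 0" and k: "nmul k x \<in> H" "nmul k x \<noteq> 0"
  shows "x \<in> H"
proof -
  have "\<not> p dvd k"
  proof
    assume "p dvd k"
    then obtain d where "k = d * p" by (metis dvd_def mult.commute)
    then show False using k(2) x by (simp add: nmul_mult)
  qed
  then have "coprime p k" by (rule prime_imp_coprime[OF p])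
  then have "gcd k p = 1" by (simp add: coprime_iff_gcd_eq_1 gcd.commute)
  moreover have "k \<noteq> 0" using k(2) by (metis nmul.simps(1))
  ultimately obtain v w where "k * v = p * w + 1" using bezout_nat[of k p] by metis
  then have "v * k = w * p + 1" by (simp add: mult.commute)
  then have "nmul v (nmul k x) = nmul w (nmul p x) + x" unfolding nmul_mult[symmetric] by (simp add: nmul_add)
  then have "x = nmul v (nmul k x)" using x by simp
  then show ?thesis using subgrp_nmul[OF H k(1)] by metis
qed

lemma cyclic_prime_subgrp:
  fixes x :: "'a::ab_group_add"
  assumes p: "prime p" and x: "nmul p x = 0"
  shows "subgrp (range (\<lambda>k. nmul k x))" "finite (range (\<lambda>k. nmul k x))"
proof -
  have red: "nmul k x = nmul (k mod p) x" for k
  proof -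
    have "nmul k x = nmul ((k div p) * p + k mod p) x" by simp
    then show ?thesis unfolding nmul_add nmul_mult using x by simp
  qed
  have "- nmul k x = nmul ((p - 1) * k) x" for k
  proof -
    have "p = Suc (p - 1)" using prime_gt_0_nat[OF p] by simp
    then have "nmul k (nmul p x) = nmul (k + (p - 1) * k) x"
      unfolding nmul_mult[symmetric] by (metis mult.commute mult_Suc)
    then show ?thesis using x by (simp add: nmul_add eq_neg_iff_add_eq_0 add.commute minus_unique)
  qed
  moreover have "0 \<in> range (\<lambda>k. nmul k x)" using rangeI[of "\<lambda>k. nmul k x" 0] by simp
  moreover have "nmul k x + nmul l x \<in> range (\<lambda>k. nmul k x)" for k l
    unfolding nmul_add[symmetric] by blast
  ultimately show "subgrp (range (\<lambda>k. nmul k x))" unfolding subgrp_def by auto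
  have "range (\<lambda>k. nmul k x) \<subseteq> (\<lambda>k. nmul k x) ` {..<p}"
  proof (rule image_subsetI)
    fix k show "nmul k x \<in> (\<lambda>k. nmul k x) ` {..<p}"
      unfolding red[of k] using prime_gt_0_nat[OF p] by (intro imageI) simp
  qed
  then show "finite (range (\<lambda>k. nmul k x))" by (rule finite_subset) simp
qed

text \<open>The neighbourhood V contains some L \<inter> annih F. A cyclic group of prime order in
  it is finite, hence closed, so it meets H nontrivially and then lies in H.\<close>

lemma locally_essentialD:
  fixes L :: "'a::{topological_ab_group_add, t2_space} set"
  assumes K: "compact (UNIV :: 'a set)" and L: "subgrp L" and H: "subgrp H" and le: "locally_essential L H"
  obtains F where "finite F" "\<And>\<gamma>. \<gamma> \<in> F \<Longrightarrow> character \<gamma>"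
    "\<And>p. prime p \<Longrightarrow> tors p (L \<inter> annih F) \<subseteq> H"
proof -
  obtain V U where V0: "V \<subseteq> L" "openin (top_of_set L) U" "0 \<in> U" "U \<subseteq> V"
    "\<forall>C. subgrp C \<and> C \<subseteq> V \<and> closedin (top_of_set L) C \<and> C \<noteq> {0} \<longrightarrow> H \<inter> C \<noteq> {0}"
    using le unfolding locally_essential_def by (elim exE conjE)
  note V = V0(1-4) V0(5)[rule_format, OF conjI[OF _ conjI[OF _ conjI]]]
  obtain T where T: "open T" "U = L \<inter> T" using V(2) by (auto simp: openin_open)
  have "0 \<in> T" using V(3) T(2) by simp
  obtain F where F: "finite F" "\<And>\<gamma>. \<gamma> \<in> F \<Longrightarrow> character \<gamma>" "annih F \<subseteq> T"
    by (fact nhd_contains_annih[OF K T(1) \<open>0 \<in> T\<close>])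
  have sub: "subgrp (L \<inter> annih F)" using L F(2) by (rule subgrp_Int_annih)
  have "tors p (L \<inter> annih F) \<subseteq> H" if p: "prime p" for p
  proof
    fix x assume "x \<in> tors p (L \<inter> annih F)"
    then have x: "x \<in> L \<inter> annih F" "nmul p x = 0" by (auto simp: tors_def)
    show "x \<in> H"
    proof (cases "x = 0")
      case True then show ?thesis using subgrp_0[OF H] by simp
    next
      case False
      let ?C = "range (\<lambda>k. nmul k x)"
      have CL: "?C \<subseteq> L \<inter> annih F" using subgrp_nmul[OF sub x(1)] by blast
      then have "?C \<subseteq> V" using F(3) T(2) V(4) by blast
      moreover have "closedin (top_of_set L) ?C"
        using CL finite_imp_closed[OF cyclic_prime_subgrp(2)[OF p x(2)]] by (intro closed_subset) auto
      moreover have "x \<in> ?C" using rangeI[of "\<lambda>k. nmul k x" 1] by simp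
      then have "?C \<noteq> {0}" using False by blast
      ultimately have "H \<inter> ?C \<noteq> {0}" by (rule V(5)[OF cyclic_prime_subgrp(1)[OF p x(2)]])
      moreover have "0 \<in> H \<inter> ?C" using subgrp_0[OF H] subgrp_0[OF cyclic_prime_subgrp(1)[OF p x(2)]] by blast
      ultimately obtain y where "y \<in> H" "y \<in> ?C" "y \<noteq> 0" by blast
      then obtain k where "nmul k x \<in> H" "nmul k x \<noteq> 0" by blast
      then show ?thesis by (rule prime_multiple_in_subgrp[OF H p x(2)])
    qed
  qed
  then show ?thesis using that[of F] F(1,2) by blast
qed

text \<open>The half-planes defining V force every subgroup inside V into \<open>annih F\<close>. If
  a closed one contains an element of prime order, that element is in G; otherwise it is
  torsion-free, and weak essentiality applies to a p-monothetic subgroup of it.\<close>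

lemma locally_essentialI:
  fixes G :: "'a::{topological_ab_group_add, t2_space} set"
  assumes K: "compact (UNIV :: 'a set)" and G: "subgrp G" and we: "weakly_essential UNIV G"
    and F: "finite F" "\<And>\<gamma>. \<gamma> \<in> F \<Longrightarrow> character \<gamma>" "\<And>p. prime p \<Longrightarrow> tors p (annih F) \<subseteq> G"
  shows "locally_essential UNIV G"
proof -
  define V where "V = (\<Inter>\<gamma>\<in>F. {x. 0 < Re (\<gamma> x)})"
  have "open V" unfolding V_def using F(1) open_character_Re[OF F(2)] by (intro open_INT) auto
  moreover have "0 < Re (\<gamma> 0)" if "\<gamma> \<in> F" for \<gamma> using character_0[OF F(2)[OF that]] by simp
  then have "0 \<in> V" by (simp add: V_def)
  moreover have "G \<inter> C \<noteq> {0}" if C: "subgrp C" "C \<subseteq> V" "closed C" "C \<noteq> {0}" for C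
  proof -
    have CF: "C \<subseteq> annih F"
    proof
      fix x assume x: "x \<in> C"
      have "\<gamma> x = 1" if "\<gamma> \<in> F" for \<gamma>
        using C(2) that x by (intro character_trivial_on_subgrp[OF F(2)[OF that] C(1)]) (auto simp: V_def)
      then show "x \<in> annih F" by (simp add: annih_def)
    qed
    have "\<exists>c. c \<in> G \<inter> C \<and> c \<noteq> 0"
    proof (cases "\<exists>p c. prime p \<and> c \<in> C \<and> nmul p c = 0 \<and> c \<noteq> 0")
      case True
      then obtain p c where c: "prime p" "c \<in> C" "nmul p c = 0" "c \<noteq> 0" by blast
      then have "c \<in> tors p (annih F)" using CF by (auto simp: tors_def)
      then show ?thesis using F(3)[OF c(1)] c by blast
    next
      case False
      then have tf: "c = 0" if "prime p" "c \<in> C" "nmul p c = 0" for p c using that by blast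
      obtain p Q where Q: "prime p" "subgrp Q" "Q \<subseteq> C" "closed Q" "infinite Q" "p_monothetic p Q"
        by (rule torsion_free_contains_p_monothetic[OF K C(1,3,4)]) (use tf in blast)+
      have "G \<inter> Q \<noteq> {0}" using we Q unfolding weakly_essential_def by (metis closed_closedin subset_UNIV subtopology_UNIV)
      moreover have "0 \<in> G \<inter> Q" using subgrp_0[OF G] subgrp_0[OF Q(2)] by blast
      ultimately show ?thesis using Q(3) by blast
    qed
    then show ?thesis by blast
  qed
  ultimately show ?thesis
    unfolding locally_essential_def by (intro exI[of _ V]) (auto simp: closed_closedin[symmetric])
qed

section \<open>Openness and corank of G[p]\<close>

lemma gen_subgrp_subgrp: "subgrp (gen_subgrp S)"
  unfolding gen_subgrp_def subgrp_def by auto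

lemma gen_subgrp_superset: "S \<subseteq> gen_subgrp S"
  unfolding gen_subgrp_def by auto

lemma gen_subgrp_mono: "S \<subseteq> T \<Longrightarrow> gen_subgrp S \<subseteq> gen_subgrp T"
  unfolding gen_subgrp_def by auto

text \<open>On K[p] a character has only p-th roots of unity as values, so avoiding the finitely
  many nontrivial ones is an open condition equivalent to being 1. G[p] is then a union of cosets of
  an open subgroup of K[p].\<close>

lemma tors_openI:
  fixes G :: "'a::{topological_ab_group_add, t2_space} set"
  assumes G: "subgrp G" and p: "prime p"
    and F: "finite F" "\<And>\<gamma>. \<gamma> \<in> F \<Longrightarrow> character \<gamma>" "tors p (annih F) \<subseteq> G"
  shows "openin (top_of_set (tors p UNIV)) (tors p G)"
proof -
  define A where "A = {c::complex. c ^ p = 1} - {1}"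
  have "finite {c::complex. c ^ p = 1}" using prime_gt_0_nat[OF p] by (intro finite_roots_unity) simp
  then have finA: "finite A" by (simp add: A_def)
  define U where "U = (\<Inter>\<gamma>\<in>F. - {x. \<gamma> x \<in> A})"
  have U: "open U"
    unfolding U_def using F(1) closed_character_finite[OF F(2) finA] by (intro open_INT) auto
  have in_annih: "x \<in> annih F" if x: "x \<in> U" "nmul p x = 0" for x
  proof -
    have "\<gamma> x = 1" if \<gamma>: "\<gamma> \<in> F" for \<gamma>
    proof -
      have "\<gamma> x ^ p = 1"
        unfolding character_nmul[OF F(2)[OF \<gamma>], symmetric] x(2) by (rule character_0[OF F(2)[OF \<gamma>]])
      moreover have "\<gamma> x \<notin> A" using x(1) \<gamma> by (simp add: U_def)
      ultimately show ?thesis by (simp add: A_def)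
    qed
    then show ?thesis by (simp add: annih_def)
  qed
  have "0 \<in> U"
  proof -
    have "\<gamma> 0 \<notin> A" if "\<gamma> \<in> F" for \<gamma> using character_0[OF F(2)[OF that]] by (simp add: A_def)
    then show ?thesis by (simp add: U_def)
  qed
  have "tors p G = tors p UNIV \<inter> (\<Union>g\<in>tors p G. {x. x - g \<in> U})"
  proof
    show "tors p G \<subseteq> tors p UNIV \<inter> (\<Union>g\<in>tors p G. {x. x - g \<in> U})"
      using \<open>0 \<in> U\<close> by (auto simp: tors_def)
    show "tors p UNIV \<inter> (\<Union>g\<in>tors p G. {x. x - g \<in> U}) \<subseteq> tors p G"
    proof
      fix x assume "x \<in> tors p UNIV \<inter> (\<Union>g\<in>tors p G. {x. x - g \<in> U})"
      then obtain g where g: "nmul p x = 0" "g \<in> G" "nmul p g = 0" "x - g \<in> U" by (auto simp: tors_def)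
      then have "nmul p (x - g) = 0" by (simp add: nmul_diff_right)
      then have "x - g \<in> tors p (annih F)" using in_annih[OF g(4)] by (simp add: tors_def)
      then have "x - g + g \<in> G" using F(3) g(2) by (intro subgrp_add[OF G]) auto
      then show "x \<in> tors p G" using g(1) by (simp add: tors_def)
    qed
  qed
  moreover have "open (\<Union>g\<in>tors p G. {x. x - g \<in> U})"
    by (intro open_UN ballI open_translate[OF U])
  ultimately show ?thesis by (metis openin_open_Int)
qed

lemma tors_openD:
  fixes G :: "'a::{topological_ab_group_add, t2_space} set"
  assumes K: "compact (UNIV :: 'a set)" and G: "subgrp G"
    and op: "openin (top_of_set (tors p UNIV)) (tors p G)"
  shows "\<exists>F. finite F \<and> (\<forall>\<gamma>\<in>F. character \<gamma>) \<and> tors p (annih F) \<subseteq> G"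
proof -
  obtain T where T: "open T" "tors p G = tors p UNIV \<inter> T" using op by (auto simp: openin_open)
  have "0 \<in> tors p G" using subgrp_0[OF G] by (simp add: tors_def)
  then have "0 \<in> T" using T(2) by blast
  obtain F where F: "finite F" "\<And>\<gamma>. \<gamma> \<in> F \<Longrightarrow> character \<gamma>" "annih F \<subseteq> T"
    by (fact nhd_contains_annih[OF K T(1) \<open>0 \<in> T\<close>])
  have "tors p (annih F) \<subseteq> tors p G" unfolding T(2) using F(3) by (auto simp: tors_def)
  then show ?thesis using F(1,2) by (intro exI[of _ F]) (auto simp: tors_def)
qed

lemma prime_roots_unity_powers:
  fixes w c :: complex
  assumes p: "prime p" and w: "w ^ p = 1" "w \<noteq> 1" and c: "c ^ p = 1"
  obtains k where "c = w ^ k"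
proof -
  have w0: "w \<noteq> 0" using w(1) prime_gt_0_nat[OF p] by (metis power_0_left less_numeral_extra(3) zero_neq_one)
  have aux: "i = j" if "w ^ i = w ^ j" "i \<le> j" "j < p" for i j
  proof (rule ccontr)
    assume "i \<noteq> j"
    have "w ^ j = w ^ i * w ^ (j - i)" using that(2) by (simp add: power_add[symmetric])
    then have "w ^ (j - i) = 1" using that(1) w0 by simp
    moreover have "\<not> p dvd (j - i)" using \<open>i \<noteq> j\<close> that(2,3) by (auto dest!: dvd_imp_le)
    then have "coprime p (j - i)" by (rule prime_imp_coprime[OF p])
    ultimately have "w = 1" using coprime_exponents_trivial[OF w(1)] by blast
    then show False using w(2) by simp
  qed
  have "inj_on (\<lambda>k. w ^ k) {..<p}"
  proof (rule inj_onI)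
    fix i j assume "i \<in> {..<p}" "j \<in> {..<p}" "w ^ i = w ^ j"
    then show "i = j" using aux[of i j] aux[of j i] by (cases "i \<le> j") auto
  qed
  then have "card ((\<lambda>k. w ^ k) ` {..<p}) = p" by (simp add: card_image)
  moreover have "(\<lambda>k. w ^ k) ` {..<p} \<subseteq> {z. z ^ p = 1}"
  proof (rule image_subsetI)
    fix k
    have "(w ^ k) ^ p = (w ^ p) ^ k" by (metis power_mult mult.commute)
    then show "w ^ k \<in> {z. z ^ p = 1}" using w(1) by simp
  qed
  moreover have "finite {z::complex. z ^ p = 1}" "card {z::complex. z ^ p = 1} = p"
    using prime_gt_0_nat[OF p] by (auto intro!: finite_roots_unity simp: card_roots_unity_eq)
  ultimately have "(\<lambda>k. w ^ k) ` {..<p} = {z. z ^ p = 1}" by (intro card_subset_eq) auto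
  then show ?thesis using c that by blast
qed

text \<open>Adding \<gamma> to F costs at most one generator: if \<gamma> b0 is nontrivial for some
  b0 in \<open>tors p (annih F)\<close>, its powers exhaust the p-th roots of unity, so subtracting
  a multiple of b0 makes any other value trivial. The bound is the same for all p.\<close>

lemma tors_quot_rank:
  fixes G :: "'a::topological_ab_group_add set"
  assumes p: "prime p" and F: "finite F" "\<And>\<gamma>. \<gamma> \<in> F \<Longrightarrow> character \<gamma>"
  shows "\<exists>S. finite S \<and> card S \<le> card F \<and> S \<subseteq> tors p UNIV \<and>
    (\<forall>x \<in> tors p (UNIV :: 'a set). \<exists>b\<in>tors p (annih F). \<exists>s\<in>gen_subgrp S. x = b + s)"
  using F
proof (induction F rule: finite_induct)
  case empty
  have "\<exists>b\<in>tors p (annih {}). \<exists>s\<in>gen_subgrp {}. x = b + s" if x: "x \<in> tors p UNIV" for x :: 'a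
  proof (intro bexI)
    show "x = x + 0" by simp
    show "0 \<in> gen_subgrp ({} :: 'a set)" by (rule subgrp_0[OF gen_subgrp_subgrp])
    show "x \<in> tors p (annih {})" using x by (simp add: tors_def annih_def)
  qed
  then show ?case by (intro exI[of _ "{}"]) simp
next
  case (insert \<gamma> F)
  have \<gamma>: "character \<gamma>" using insert.prems by simp
  obtain S where S: "finite S" "card S \<le> card F" "S \<subseteq> tors p UNIV"
    "\<And>x. x \<in> tors p (UNIV :: 'a set) \<Longrightarrow> \<exists>b\<in>tors p (annih F). \<exists>s\<in>gen_subgrp S. x = b + s"
    using insert.IH insert.prems by blast
  have root: "\<gamma> b ^ p = 1" if "nmul p b = 0" for b
    unfolding character_nmul[OF \<gamma>, symmetric] that by (rule character_0[OF \<gamma>])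
  show ?case
  proof (cases "\<forall>b\<in>tors p (annih F). \<gamma> b = 1")
    case True
    then have "tors p (annih (insert \<gamma> F)) = tors p (annih F)" by (auto simp: tors_def annih_def)
    then show ?thesis using S insert.hyps by (intro exI[of _ S]) auto
  next
    case False
    then obtain b0 where b0: "b0 \<in> annih F" "nmul p b0 = 0" "\<gamma> b0 \<noteq> 1" by (auto simp: tors_def)
    have gen: "gen_subgrp S \<subseteq> gen_subgrp (insert b0 S)" by (intro gen_subgrp_mono) auto
    have b0gen: "b0 \<in> gen_subgrp (insert b0 S)" using gen_subgrp_superset by blast
    have "\<exists>b\<in>tors p (annih (insert \<gamma> F)). \<exists>s\<in>gen_subgrp (insert b0 S). x = b + s"
      if x: "x \<in> tors p UNIV" for x
    proof -
      obtain b s where bs: "b \<in> annih F" "nmul p b = 0" "s \<in> gen_subgrp S" "x = b + s"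
        using S(4)[OF x] by (auto simp: tors_def)
      obtain k where k: "\<gamma> b = \<gamma> b0 ^ k"
        using prime_roots_unity_powers[OF p root[OF b0(2)] b0(3) root[OF bs(2)]] by blast
      have "\<eta> (b - nmul k b0) = 1" if \<eta>: "\<eta> \<in> insert \<gamma> F" for \<eta>
      proof -
        have ch: "character \<eta>" using insert.prems \<eta> by blast
        show ?thesis
        proof (cases "\<eta> = \<gamma>")
          case True
          then show ?thesis using k character_nz[OF \<gamma>, of b0]
            by (simp add: character_diff[OF \<gamma>] character_nmul[OF \<gamma>])
        next
          case False
          then have "\<eta> b = 1" "\<eta> b0 = 1" using \<eta> bs(1) b0(1) by (auto simp: annih_def)
          then show ?thesis by (simp add: character_diff[OF ch] character_nmul[OF ch])
        qed
      qed
      moreover have "nmul p (b - nmul k b0) = 0"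
      proof -
        have "nmul p (nmul k b0) = nmul k (nmul p b0)" by (simp only: nmul_mult[symmetric] mult.commute)
        then show ?thesis using bs(2) b0(2) by (simp add: nmul_diff_right)
      qed
      ultimately have "b - nmul k b0 \<in> tors p (annih (insert \<gamma> F))" unfolding tors_def annih_def by blast
      moreover have "nmul k b0 + s \<in> gen_subgrp (insert b0 S)"
        using gen bs(3) by (intro subgrp_add subgrp_nmul gen_subgrp_subgrp b0gen) auto
      moreover have "x = (b - nmul k b0) + (nmul k b0 + s)" using bs(4) by simp
      ultimately show ?thesis by blast
    qed
    moreover have "card (insert b0 S) \<le> card (insert \<gamma> F)"
      using S(1,2) insert.hyps card_insert_le_m1[of "Suc (card F)" S b0] by simp
    moreover have "insert b0 S \<subseteq> tors p UNIV" using S(3) b0(2) by (auto simp: tors_def)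
    ultimately show ?thesis using S(1) by (intro exI[of _ "insert b0 S"]) auto
  qed
qed

lemma locally_essential_imp_star_cond:
  fixes G :: "'a::{topological_ab_group_add, t2_space} set"
  assumes K: "compact (UNIV :: 'a set)" and G: "subgrp G" and le: "locally_essential UNIV G"
  shows "star_cond UNIV G"
proof -
  have "subgrp (UNIV :: 'a set)" by (simp add: subgrp_def)
  then obtain F where F: "finite F" "\<And>\<gamma>. \<gamma> \<in> F \<Longrightarrow> character \<gamma>"
    "\<And>p. prime p \<Longrightarrow> tors p (UNIV \<inter> annih F) \<subseteq> G"
    by (rule locally_essentialD[OF K _ G le]) blast
  have F3: "tors p (annih F) \<subseteq> G" if "prime p" for p using F(3)[OF that] by simp
  have "openin (top_of_set (tors p UNIV)) (tors p G)" if p: "prime p" for p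
    using F(2) by (intro tors_openI[OF G p F(1) _ F3[OF p]])
  moreover have "quot_rank_le (tors p UNIV) (tors p G) (card F)" if p: "prime p" for p
  proof -
    obtain S where S: "finite S" "card S \<le> card F" "S \<subseteq> tors p UNIV"
      "\<And>x. x \<in> tors p (UNIV :: 'a set) \<Longrightarrow> \<exists>b\<in>tors p (annih F). \<exists>s\<in>gen_subgrp S. x = b + s"
      using tors_quot_rank[OF p F(1,2)] by blast
    have "tors p (annih F) \<subseteq> tors p G" using F3[OF p] by (auto simp: tors_def)
    then have "tors p UNIV \<subseteq> {b + s |b s. b \<in> tors p G \<and> s \<in> gen_subgrp S}"
      using S(4) by (force simp: subset_iff)
    then show ?thesis unfolding quot_rank_le_def using S(1-3) by blast
  qed
  ultimately show ?thesis unfolding star_cond_def by blast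
qed

text \<open>The product t of the exponents on M kills all values of characters in F. If p exceeds t,
  an element of M[p] has character values killed by both p and t, so it lies in
  \<open>annih F\<close> and hence in G.\<close>

lemma finite_pi_set_torsion_dual:
  fixes G :: "'a::{topological_ab_group_add, t2_space} set"
  assumes K: "compact (UNIV :: 'a set)" and G: "subgrp G" and le: "locally_essential UNIV G"
    and M: "torsion_dual M"
  shows "finite (pi_set M G)"
proof -
  have "subgrp (UNIV :: 'a set)" by (simp add: subgrp_def)
  then obtain F where F: "finite F" "\<And>\<gamma>. \<gamma> \<in> F \<Longrightarrow> character \<gamma>"
    "\<And>p. prime p \<Longrightarrow> tors p (UNIV \<inter> annih F) \<subseteq> G"
    by (rule locally_essentialD[OF K _ G le]) blast
  have "\<exists>q::nat. character \<gamma> \<longrightarrow> q > 0 \<and> (\<forall>x\<in>M. \<gamma> x ^ q = 1)" for \<gamma>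
    using M unfolding torsion_dual_def by blast
  then obtain q :: "('a \<Rightarrow> complex) \<Rightarrow> nat"
    where q: "\<And>\<gamma>. character \<gamma> \<Longrightarrow> q \<gamma> > 0" "\<And>\<gamma> x. character \<gamma> \<Longrightarrow> x \<in> M \<Longrightarrow> \<gamma> x ^ q \<gamma> = 1"
    by metis
  define t where "t = (\<Prod>\<gamma>\<in>F. q \<gamma>)"
  have t: "t > 0" unfolding t_def using q(1) F(2) by (intro prod_pos) auto
  have "p \<le> t" if p: "p \<in> pi_set M G" for p
  proof (rule ccontr)
    assume "\<not> p \<le> t"
    have pr: "prime p" using p by (simp add: pi_set_def)
    have "\<not> p dvd t" using \<open>\<not> p \<le> t\<close> t by (auto dest: dvd_imp_le)
    then have cop: "coprime p t" by (rule prime_imp_coprime[OF pr])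
    have "tors p M \<subseteq> tors p (UNIV \<inter> annih F)"
    proof
      fix x assume "x \<in> tors p M"
      then have x: "x \<in> M" "nmul p x = 0" by (auto simp: tors_def)
      have "\<gamma> x = 1" if \<gamma>: "\<gamma> \<in> F" for \<gamma>
      proof (rule coprime_exponents_trivial[OF _ _ cop])
        show "\<gamma> x ^ p = 1"
          unfolding character_nmul[OF F(2)[OF \<gamma>], symmetric] x(2) by (rule character_0[OF F(2)[OF \<gamma>]])
        have "q \<gamma> dvd t" unfolding t_def using F(1) \<gamma> by (rule dvd_prodI)
        then show "\<gamma> x ^ t = 1" using q(2)[OF F(2)[OF \<gamma>] x(1)] by (metis dvdE power_mult power_one)
      qed
      then show "x \<in> tors p (UNIV \<inter> annih F)" using x(2) by (simp add: tors_def annih_def)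
    qed
    then show False using F(3)[OF pr] p by (auto simp: pi_set_def)
  qed
  then have "pi_set M G \<subseteq> {..t}" by auto
  then show ?thesis by (rule finite_subset) simp
qed

text \<open>F0 confines the elements of order p to N. Outside \<open>pi_set N G\<close> this already
  puts them into G; for each of the finitely many remaining primes, openness of G[p] supplies a
  finite set \<open>Fp p\<close> of further characters.\<close>

lemma locally_essential_of_finite_pi_set:
  fixes G :: "'a::{topological_ab_group_add, t2_space} set"
  assumes K: "compact (UNIV :: 'a set)" and G: "subgrp G" and we: "weakly_essential UNIV G"
    and op: "\<And>p. prime p \<Longrightarrow> openin (top_of_set (tors p UNIV)) (tors p G)"
    and F0: "finite F0" "\<And>\<gamma>. \<gamma> \<in> F0 \<Longrightarrow> character \<gamma>" "\<And>p. prime p \<Longrightarrow> tors p (annih F0) \<subseteq> N"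
    and fin: "finite (pi_set N G)"
  shows "locally_essential UNIV G"
proof -
  have "\<exists>F. prime p \<longrightarrow> finite F \<and> (\<forall>\<gamma>\<in>F. character \<gamma>) \<and> tors p (annih F) \<subseteq> G" for p
    using tors_openD[OF K G op] by blast
  then obtain Fp where Fp: "\<And>p. prime p \<Longrightarrow> finite (Fp p)"
      "\<And>p. prime p \<Longrightarrow> \<forall>\<gamma>\<in>Fp p. character \<gamma>" "\<And>p. prime p \<Longrightarrow> tors p (annih (Fp p)) \<subseteq> G"
    by metis
  define F where "F = F0 \<union> (\<Union>p\<in>pi_set N G. Fp p)"
  have prime_pi: "prime p" if "p \<in> pi_set N G" for p using that by (simp add: pi_set_def)
  show ?thesis
  proof (rule locally_essentialI[OF K G we, of F])
    show "finite F" unfolding F_def using F0(1) fin Fp(1) prime_pi by auto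
    show "character \<gamma>" if "\<gamma> \<in> F" for \<gamma> using that F0(2) Fp(2) prime_pi unfolding F_def by blast
    fix p :: nat assume p: "prime p"
    show "tors p (annih F) \<subseteq> G"
    proof (cases "p \<in> pi_set N G")
      case True
      then have "tors p (annih F) \<subseteq> tors p (annih (Fp p))" by (auto simp: F_def tors_def annih_def)
      then show ?thesis using Fp(3)[OF p] by blast
    next
      case False
      then have "tors p N \<subseteq> G" using p by (simp add: pi_set_def)
      moreover have "tors p (annih F) \<subseteq> tors p (annih F0)" by (auto simp: F_def tors_def annih_def)
      then have "tors p (annih F) \<subseteq> tors p N" using F0(3)[OF p] by (auto simp: tors_def)
      ultimately show ?thesis by blast
    qed
  qed
qed

text \<open>As I is finite, positivity of the real parts of all coordinates of \<phi> describes a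
  neighbourhood of 0 in L. A subgroup L \<inter> annih F inside it has trivial image, since the
  circle has no small subgroups. F consists of characters of K although the coordinates are defined
  on L only.\<close>

lemma delta_subgroup_contains_annih:
  fixes L :: "'a::{topological_ab_group_add, t2_space} set"
  assumes K: "compact (UNIV :: 'a set)" and L: "subgrp L" "compact L"
    and fd: "finite_dimensional L" and N: "delta_subgroup L N"
  obtains F where "finite F" "\<And>\<gamma>. \<gamma> \<in> F \<Longrightarrow> character \<gamma>" "L \<inter> annih F \<subseteq> N"
proof -
  obtain I :: "'a set" where I: "quotient_is_torus I L N" using N unfolding delta_subgroup_def by blast
  obtain n where "covering_dim_le L n" using fd unfolding finite_dimensional_def by blast
  then have finI: "finite I" by (rule quotient_torus_finite_index[OF L I])
  obtain \<phi> where \<phi>: "continuous_map (top_of_set L) (circle_pow_top I) \<phi>"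
    "open_map (top_of_set L) (circle_pow_top I) \<phi>"
    "\<phi> ` L = circle_pow I"
    "{x \<in> L. \<phi> x = circle_pow_one I} = N"
    "\<phi> 0 = circle_pow_one I"
    and mult: "\<And>x y j. x \<in> L \<Longrightarrow> y \<in> L \<Longrightarrow> j \<in> I \<Longrightarrow> \<phi> (x + y) j = \<phi> x j * \<phi> y j"
    and cont: "\<And>j. j \<in> I \<Longrightarrow> continuous_on L (\<lambda>x. \<phi> x j)"
    and norm1: "\<And>x j. x \<in> L \<Longrightarrow> j \<in> I \<Longrightarrow> cmod (\<phi> x j) = 1"
    by (fact quotient_is_torus_coordinates[OF I L(1)])
  have zL: "0 \<in> L" by (rule subgrp_0[OF L(1)])
  have zero: "\<phi> 0 j = 1" if "j \<in> I" for j using \<phi>(5) that by (simp add: circle_pow_one_def)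
  have "\<exists>T. open T \<and> L \<inter> (\<lambda>x. \<phi> x j) -` {z. 0 < Re z} = L \<inter> T" if "j \<in> I" for j
  proof -
    have "open {z. 0 < Re z}" by (intro open_Collect_less continuous_intros)
    then have "openin (top_of_set L) (L \<inter> (\<lambda>x. \<phi> x j) -` {z. 0 < Re z})"
      by (rule continuous_openin_preimage_gen[OF cont[OF that]])
    then show ?thesis by (auto simp: openin_open)
  qed
  then obtain T where T: "\<And>j. j \<in> I \<Longrightarrow> open (T j)"
    "\<And>j. j \<in> I \<Longrightarrow> L \<inter> (\<lambda>x. \<phi> x j) -` {z. 0 < Re z} = L \<inter> T j" by metis
  have opT: "open (\<Inter>j\<in>I. T j)" using finI T(1) by (intro open_INT) auto
  have zT: "0 \<in> (\<Inter>j\<in>I. T j)"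
  proof
    fix j assume j: "j \<in> I"
    have "0 \<in> L \<inter> (\<lambda>x. \<phi> x j) -` {z. 0 < Re z}" using zL zero[OF j] by simp
    then show "0 \<in> T j" unfolding T(2)[OF j] by blast
  qed
  obtain F where F: "finite F" "\<And>\<gamma>. \<gamma> \<in> F \<Longrightarrow> character \<gamma>" "annih F \<subseteq> (\<Inter>j\<in>I. T j)"
    by (fact nhd_contains_annih[OF K opT zT])
  have sub: "subgrp (L \<inter> annih F)" using L(1) F(2) by (rule subgrp_Int_annih)
  have "L \<inter> annih F \<subseteq> N"
  proof
    fix x assume x: "x \<in> L \<inter> annih F"
    have xL: "x \<in> L" using x by simp
    have "\<phi> x = circle_pow_one I"
      unfolding circle_pow_one_def
    proof (rule PiE_ext[where s = "\<lambda>_. sphere 0 1" and k = I])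
      show "\<phi> x \<in> PiE I (\<lambda>_. sphere 0 1)" using \<phi>(3) xL by (auto simp: circle_pow_def)
      fix j assume j: "j \<in> I"
      have power: "\<phi> (nmul k x) j = \<phi> x j ^ k" for k
        by (induction k) (simp_all add: zero[OF j] mult[OF xL subgrp_nmul[OF L(1) xL] j])
      have "\<phi> x j = 1"
      proof (rule unit_powers_Re_pos[OF norm1[OF xL j]])
        fix k
        have "nmul k x \<in> L \<inter> annih F" by (rule subgrp_nmul[OF sub x])
        then have "nmul k x \<in> L \<inter> T j" using F(3) j by blast
        then have "nmul k x \<in> L \<inter> (\<lambda>x. \<phi> x j) -` {z. 0 < Re z}" unfolding T(2)[OF j] .
        then show "0 < Re (\<phi> x j ^ k)" by (simp add: power)
      qed
      then show "\<phi> x j = restrict (\<lambda>_. 1) I j" using j by simp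
    qed auto
    then show "x \<in> N" using \<phi>(4) xL by blast
  qed
  then show ?thesis using that[of F] F(1,2) by blast
qed

lemma locally_essential_Int:
  fixes N :: "'a::{topological_ab_group_add, t2_space} set"
  assumes le: "locally_essential UNIV G" and N: "subgrp N" "closed N"
  shows "locally_essential N (G \<inter> N)"
proof -
  obtain V U where V: "open U" "0 \<in> U" "U \<subseteq> V"
    "\<forall>C. subgrp C \<and> C \<subseteq> V \<and> closed C \<and> C \<noteq> {0} \<longrightarrow> G \<inter> C \<noteq> {0}"
    using le unfolding locally_essential_def by (auto simp: closed_closedin[symmetric])
  have "G \<inter> N \<inter> C \<noteq> {0}" if "subgrp C" "C \<subseteq> N \<inter> V" "closedin (top_of_set N) C" "C \<noteq> {0}" for C
  proof -
    have "closed C" using closedin_closed_trans[OF that(3) N(2)] .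
    then have "G \<inter> C \<noteq> {0}" using V(4) that by blast
    moreover have "G \<inter> N \<inter> C = G \<inter> C" using that(2) by blast
    ultimately show ?thesis by simp
  qed
  moreover have "openin (top_of_set N) (N \<inter> U)" "0 \<in> N \<inter> U" "N \<inter> U \<subseteq> N \<inter> V"
    using V subgrp_0[OF N(1)] by (auto simp: openin_open_Int)
  ultimately show ?thesis unfolding locally_essential_def
    by (intro exI[of _ "N \<inter> V"] conjI exI[of _ "N \<inter> U"]) auto
qed

lemma subgrp_socle_closure: "subgrp (closure (socle (UNIV :: 'a::topological_ab_group_add set)))"
  unfolding socle_def by (intro subgrp_closure gen_subgrp_subgrp)

lemma tors_subset_socle_closure:
  assumes "prime p" shows "tors p (UNIV :: 'a::topological_ab_group_add set) \<subseteq> closure (socle UNIV)"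
proof -
  have "tors p (UNIV :: 'a set) \<subseteq> (\<Union>p\<in>{p. prime p}. tors p UNIV)" using assms by blast
  also have "\<dots> \<subseteq> socle UNIV" unfolding socle_def by (rule gen_subgrp_superset)
  also have "\<dots> \<subseteq> closure (socle UNIV)" by (rule closure_subset)
  finally show ?thesis .
qed

theorem theorem3p10:
  fixes G :: "'a::{topological_ab_group_add, t2_space} set"
  assumes K_compact: "compact (UNIV :: 'a set)"
    and G_subgrp: "subgrp G"
    and G_we: "weakly_essential UNIV G"
  shows
    "(locally_essential UNIV G \<longrightarrow> star_cond UNIV G)
   \<and> (star_cond UNIV G \<and> finite (pi_set UNIV G) \<longrightarrow> locally_essential UNIV G)
   \<and> (finite_dimensional (closure (socle (UNIV :: 'a set))) \<longrightarrow>
        (let K1 = closure (socle (UNIV :: 'a set)) in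
          (locally_essential UNIV G \<longleftrightarrow>
             ((\<forall>p. prime p \<longrightarrow> openin (top_of_set (tors p UNIV)) (tors p G)) \<and>
              (\<forall>M. delta_subgroup UNIV M \<longrightarrow> finite (pi_set M G))))
        \<and> (locally_essential UNIV G \<longleftrightarrow>
             (\<exists>N. delta_subgroup K1 N \<and> locally_essential N (G \<inter> N)))
        \<and> (locally_essential UNIV G \<longleftrightarrow>
             (\<forall>N. delta_subgroup K1 N \<longrightarrow> locally_essential N (G \<inter> N)))))
   \<and> (totally_disconn (UNIV :: 'a set) \<longrightarrow>
        (locally_essential UNIV G \<longleftrightarrow>
           finite (pi_set UNIV G) \<and>
           (\<forall>p. prime p \<longrightarrow> openin (top_of_set (tors p UNIV)) (tors p G))))"
proof -
  note K = K_compact and G = G_subgrp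
  let ?LE = "locally_essential UNIV G"
  let ?op = "\<forall>p. prime p \<longrightarrow> openin (top_of_set (tors p UNIV)) (tors p G)"
  define K1 where "K1 = closure (socle (UNIV :: 'a set))"
  have K1: "subgrp K1" "closed K1" unfolding K1_def by (rule subgrp_socle_closure, rule closed_closure)
  have cK1: "compact K1" using compact_Int_closed[OF K K1(2)] by simp
  have tors_K1: "tors p UNIV \<subseteq> K1" if "prime p" for p unfolding K1_def by (rule tors_subset_socle_closure[OF that])
  have UNIV: "subgrp (UNIV :: 'a set)" "closed (UNIV :: 'a set)" by (simp_all add: subgrp_def)
  have a: "star_cond UNIV G" if ?LE by (rule locally_essential_imp_star_cond[OF K G that])
  have star_op: ?op if "star_cond UNIV G" using that by (simp add: star_cond_def)
  \<comment> \<open>The empty set of characters has annihilator \<open>UNIV\<close>, so N may be all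
    of K.\<close>
  have b: ?LE if "?op" "finite (pi_set UNIV G)"
    by (rule locally_essential_of_finite_pi_set[OF K G G_we, of "{}" UNIV]) (use that in auto)
  have delta_td: "torsion_dual M" if M: "delta_subgroup L M" for L M :: "'a set"
  proof -
    have "subgrp M" "closed M" "totally_disconn M" using M by (simp_all add: delta_subgroup_def)
    moreover have "compact M" using compact_Int_closed[OF K \<open>closed M\<close>] by simp
    ultimately show ?thesis by (intro totally_disconn_imp_torsion_dual)
  qed
  have c12: "finite (pi_set M G)" if ?LE "delta_subgroup UNIV M" for M
    by (rule finite_pi_set_torsion_dual[OF K G that(1) delta_td[OF that(2)]])
  \<comment> \<open>This makes the universal form of the condition on \<delta>-subgroups of K1 imply
    the existential one.\<close>
  have ex_N: "\<exists>N. delta_subgroup K1 N"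
    by (rule delta_subgroup_exists[OF K K1, of "{0}"]) (use subgrp_0[OF K1(1)] torsion_dual_singleton in auto)
  have c13: "locally_essential N (G \<inter> N)" if ?LE "delta_subgroup K1 N" for N
    using that(2) by (intro locally_essential_Int[OF that(1)]) (simp_all add: delta_subgroup_def)
  \<comment> \<open>The hypothesis concerns \<delta>-subgroups of K, whereas finite dimension is
    known for K1: a \<delta>-subgroup N of K1 is therefore enlarged to a \<delta>-subgroup M of K,
    and finiteness passes down from M to N.\<close>
  have c21: ?LE if fd: "finite_dimensional K1" and "?op"
    and pi: "\<And>M. delta_subgroup UNIV M \<Longrightarrow> finite (pi_set M G)"
  proof -
    obtain N where N: "delta_subgroup K1 N" using ex_N by blast
    obtain F where F: "finite F" "\<And>\<gamma>. \<gamma> \<in> F \<Longrightarrow> character \<gamma>" "K1 \<inter> annih F \<subseteq> N"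
      by (fact delta_subgroup_contains_annih[OF K K1(1) cK1 fd N])
    obtain M where M: "delta_subgroup UNIV M" "N \<subseteq> M"
      by (fact delta_subgroup_exists[OF K UNIV subset_UNIV delta_td[OF N]])
    have "pi_set N G \<subseteq> pi_set M G" using M(2) by (auto simp: pi_set_def tors_def)
    then have "finite (pi_set N G)" using pi[OF M(1)] by (rule finite_subset)
    moreover have "tors p (annih F) \<subseteq> N" if "prime p" for p
      using F(3) tors_K1[OF that] by (auto simp: tors_def)
    ultimately show ?thesis
      using \<open>?op\<close> F(1,2) by (intro locally_essential_of_finite_pi_set[OF K G G_we, of F N]) auto
  qed
  \<comment> \<open>F brings the elements of prime order into N, and F' brings those of N into G;
    their union serves both purposes.\<close>
  have c31: ?LE if fd: "finite_dimensional K1" and N: "delta_subgroup K1 N" and le: "locally_essential N (G \<inter> N)" for N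
  proof -
    have Nsub: "subgrp N" using N by (simp add: delta_subgroup_def)
    obtain F where F: "finite F" "\<And>\<gamma>. \<gamma> \<in> F \<Longrightarrow> character \<gamma>" "K1 \<inter> annih F \<subseteq> N"
      by (fact delta_subgroup_contains_annih[OF K K1(1) cK1 fd N])
    obtain F' where F': "finite F'" "\<And>\<gamma>. \<gamma> \<in> F' \<Longrightarrow> character \<gamma>"
      "\<And>p. prime p \<Longrightarrow> tors p (N \<inter> annih F') \<subseteq> G \<inter> N"
      by (fact locally_essentialD[OF K Nsub subgrp_Int[OF G Nsub] le])
    show ?thesis
    proof (rule locally_essentialI[OF K G G_we, of "F \<union> F'"])
      show "finite (F \<union> F')" using F(1) F'(1) by simp
      show "character \<gamma>" if "\<gamma> \<in> F \<union> F'" for \<gamma> using that F(2) F'(2) by blast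
      fix p :: nat assume p: "prime p"
      have "tors p (annih (F \<union> F')) \<subseteq> tors p (N \<inter> annih F')"
        using F(3) tors_K1[OF p] by (auto simp: annih_Un tors_def)
      then show "tors p (annih (F \<union> F')) \<subseteq> G" using F'(3)[OF p] by blast
    qed
  qed
  \<comment> \<open>If K is totally disconnected, all characters have finite order on K, so the
    finiteness argument applies to M = K.\<close>
  have d: "finite (pi_set UNIV G)" if "totally_disconn (UNIV :: 'a set)" ?LE
    using totally_disconn_imp_torsion_dual[OF UNIV(1) K that(1)] by (rule finite_pi_set_torsion_dual[OF K G that(2)])
  have c2: "?LE \<longleftrightarrow> ?op \<and> (\<forall>M. delta_subgroup UNIV M \<longrightarrow> finite (pi_set M G))" if "finite_dimensional K1"
    using a star_op c12 c21[OF that] by blast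
  have c3: "?LE \<longleftrightarrow> (\<exists>N. delta_subgroup K1 N \<and> locally_essential N (G \<inter> N))" if "finite_dimensional K1"
    using ex_N c13 c31[OF that] by blast
  have c3': "?LE \<longleftrightarrow> (\<forall>N. delta_subgroup K1 N \<longrightarrow> locally_essential N (G \<inter> N))" if "finite_dimensional K1"
    using ex_N c13 c31[OF that] by blast
  have td: "?LE \<longleftrightarrow> finite (pi_set UNIV G) \<and> ?op" if "totally_disconn (UNIV :: 'a set)"
    using a star_op b d[OF that] by blast
  show ?thesis
    unfolding Let_def K1_def[symmetric]
  proof (intro conjI impI)
    show "star_cond UNIV G" if ?LE by (rule a[OF that])
    show ?LE if "star_cond UNIV G \<and> finite (pi_set UNIV G)" using b star_op that by blast
  qed (use c2 c3 c3' td in \<open>assumption | blast\<close>)+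
qed

end
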